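(* Let $N^2(C)$ be a 2-dimensional space form of constant sectional curvature $C$, let $I\subset\mathbb{R}$ be an open interval, let $f:I\to\mathbb{R}^+$ be a smooth positive function, and let $\gamma:I\to N^2(C)$ be a proper $f$-4-harmonic curve parametrized by arclength. If the curvature $\kappa>0$ of $\gamma$ is constant, then $C<0$ and $\kappa=\frac{\sqrt{-2C}}{2}$.
   Context: For a smooth map $\gamma:I\to N$ from an open interval $I$ (with its standard metric $ds^2$) into a Riemannian manifold $N$ and a smooth positive function $f$ on $I$, let $\overline{\nabla}_{\gamma'}$ be the covariant derivative along $\gamma$, $\tau(\gamma)=\overline{\nabla}_{\gamma'}\gamma'$ and $\overline{\Delta}=-\overline{\nabla}_{\gamma'}\overline{\nabla}_{\gamma'}$. The $f$-4-energy over a compact subinterval $\Omega\subset I$ is $E_{f,4}(\gamma)=\frac12\int_\Omega f\,|\overline{\Delta}\tau(\gamma)|^2ds$. The map $\gamma$ is $f$-4-harmonic if it is a critical point of $E_{f,4}$ with respect to all compactly supported smooth variations (through arbitrary smooth maps $I\to N$). It is 4-harmonic if this holds with $f\equiv1$. It is proper $f$-4-harmonic if it is $f$-4-harmonic but not 4-harmonic. The curvature (geodesic curvature) $\kappa$ of an arclength-parametrized curve $\gamma$ in a surface is defined by the Frenet formulas $\overline{\nabla}_{\gamma'}T=\kappa N$, $\overline{\nabla}_{\gamma'}N=-\kappa T$, where $T=\gamma'$ and $\{T,N\}$ is an orthonormal frame along $\gamma$. *)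

theory Defs
  imports "HOL-Analysis.Analysis"
begin

section \<open>Smooth maps between normed spaces\<close>

text \<open>For open \<open>S\<close> in a finite-dimensional space this is the usual \<open>C\<^sup>k\<close>: all iterated
  directional derivatives up to order \<open>k\<close> exist and are continuous.\<close>

primrec Ck_on :: "nat \<Rightarrow> 'a::real_normed_vector set \<Rightarrow> ('a \<Rightarrow> 'b::real_normed_vector) \<Rightarrow> bool" where
  "Ck_on 0 S f \<longleftrightarrow> continuous_on S f"
| "Ck_on (Suc k) S f \<longleftrightarrow>
     (\<forall>x\<in>S. f differentiable (at x)) \<and> (\<forall>v. Ck_on k S (\<lambda>x. frechet_derivative f (at x) v))"

definition smooth_on :: "'a::real_normed_vector set \<Rightarrow> ('a \<Rightarrow> 'b::real_normed_vector) \<Rightarrow> bool" where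
  "smooth_on S f \<longleftrightarrow> (\<forall>k. Ck_on k S f)"

section \<open>Riemannian manifolds\<close>

text \<open>A chart is a pair of its domain and its coordinate map (only the values on the domain
  matter). A Riemannian metric is given by its component matrices: \<open>metric M c x\<close> is the Gram
  matrix of the coordinate basis of the chart \<open>c\<close> at the point with coordinates \<open>x\<close>.\<close>

type_synonym ('a, 'n) chart = "'a set \<times> ('a \<Rightarrow> real ^ 'n)"

record ('a, 'n::finite) riemannian_structure =
  mtop :: "'a topology"
  atlas :: "('a, 'n) chart set"
  metric :: "('a, 'n) chart \<Rightarrow> real ^ 'n \<Rightarrow> real ^ 'n ^ 'n"

abbreviation cdom :: "('a, 'n::finite) chart \<Rightarrow> 'a set" where
  "cdom c \<equiv> fst c"

abbreviation coord :: "('a, 'n::finite) chart \<Rightarrow> 'a \<Rightarrow> real ^ 'n" where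
  "coord c \<equiv> snd c"

definition transition :: "('a, 'n::finite) chart \<Rightarrow> ('a, 'n) chart \<Rightarrow> real ^ 'n \<Rightarrow> real ^ 'n" where
  "transition c d = coord d \<circ> inv_into (cdom c) (coord c)"

definition is_chart :: "'a topology \<Rightarrow> ('a, 'n::finite) chart \<Rightarrow> bool" where
  "is_chart X c \<longleftrightarrow> openin X (cdom c) \<and> open (coord c ` cdom c) \<and>
     homeomorphic_map (subtopology X (cdom c)) (top_of_set (coord c ` cdom c)) (coord c)"

definition smooth_manifold :: "('a, 'n::finite) riemannian_structure \<Rightarrow> bool" where
  "smooth_manifold M \<longleftrightarrow>
     Hausdorff_space (mtop M) \<and> second_countable (mtop M) \<and>
     (\<forall>c\<in>atlas M. is_chart (mtop M) c) \<and>
     (\<Union>c\<in>atlas M. cdom c) = topspace (mtop M) \<and>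
     (\<forall>c\<in>atlas M. \<forall>d\<in>atlas M. smooth_on (coord c ` (cdom c \<inter> cdom d)) (transition c d))"

definition metric_inner ::
    "('a, 'n::finite) riemannian_structure \<Rightarrow> ('a, 'n) chart \<Rightarrow> real ^ 'n \<Rightarrow> real ^ 'n \<Rightarrow> real ^ 'n \<Rightarrow> real"
  where "metric_inner M c x v w = v \<bullet> (metric M c x *v w)"

definition riemannian_manifold :: "('a, 'n::finite) riemannian_structure \<Rightarrow> bool" where
  "riemannian_manifold M \<longleftrightarrow> smooth_manifold M \<and>
     (\<forall>c\<in>atlas M. smooth_on (coord c ` cdom c) (metric M c)) \<and>
     (\<forall>c\<in>atlas M. \<forall>x\<in>coord c ` cdom c.
        (\<forall>v w. metric_inner M c x v w = metric_inner M c x w v) \<and>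
        (\<forall>v. v \<noteq> 0 \<longrightarrow> 0 < metric_inner M c x v v)) \<and>
     (\<forall>c\<in>atlas M. \<forall>d\<in>atlas M. \<forall>p\<in>cdom c \<inter> cdom d. \<forall>v w.
        metric_inner M c (coord c p) v w =
        metric_inner M d (coord d p)
          (frechet_derivative (transition c d) (at (coord c p)) v)
          (frechet_derivative (transition c d) (at (coord c p)) w))"

section \<open>Levi-Civita connection and curvature in coordinates\<close>

definition pdiff :: "'n::finite \<Rightarrow> (real ^ 'n \<Rightarrow> real) \<Rightarrow> real ^ 'n \<Rightarrow> real" where
  "pdiff i h x = frechet_derivative h (at x) (axis i 1)"

text \<open>\<open>christoffel M c k i j x\<close> is \<open>\<Gamma>\<^sup>k\<^sub>i\<^sub>j\<close> at the point with coordinates \<open>x\<close> in the chart \<open>c\<close>.\<close>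

definition christoffel ::
    "('a, 'n::finite) riemannian_structure \<Rightarrow> ('a, 'n) chart \<Rightarrow> 'n \<Rightarrow> 'n \<Rightarrow> 'n \<Rightarrow> real ^ 'n \<Rightarrow> real"
  where "christoffel M c k i j x =
    (\<Sum>l\<in>UNIV. matrix_inv (metric M c x) $ k $ l *
        (pdiff i (\<lambda>y. metric M c y $ j $ l) x + pdiff j (\<lambda>y. metric M c y $ i $ l) x
         - pdiff l (\<lambda>y. metric M c y $ i $ j) x)) / 2"

text \<open>The components of \<open>R(u,v)w\<close>, with the sign convention
  \<open>R(X,Y)Z = \<nabla>\<^sub>X\<nabla>\<^sub>YZ - \<nabla>\<^sub>Y\<nabla>\<^sub>XZ - \<nabla>\<^bsub>[X,Y]\<^esub>Z\<close>.\<close>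

definition curvature_tensor ::
    "('a, 'n::finite) riemannian_structure \<Rightarrow> ('a, 'n) chart \<Rightarrow> real ^ 'n \<Rightarrow>
     real ^ 'n \<Rightarrow> real ^ 'n \<Rightarrow> real ^ 'n \<Rightarrow> real ^ 'n"
  where "curvature_tensor M c x u v w =
    (\<chi> l. \<Sum>i\<in>UNIV. \<Sum>j\<in>UNIV. \<Sum>k\<in>UNIV.
       (pdiff i (christoffel M c l j k) x - pdiff j (christoffel M c l i k) x +
        (\<Sum>m\<in>UNIV. christoffel M c l i m x * christoffel M c m j k x
                  - christoffel M c l j m x * christoffel M c m i k x))
       * u $ i * v $ j * w $ k)"

definition sectional_curvature ::
    "('a, 'n::finite) riemannian_structure \<Rightarrow> ('a, 'n) chart \<Rightarrow> real ^ 'n \<Rightarrow>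
     real ^ 'n \<Rightarrow> real ^ 'n \<Rightarrow> real"
  where "sectional_curvature M c x u v =
    metric_inner M c x (curvature_tensor M c x u v v) u /
    (metric_inner M c x u u * metric_inner M c x v v - (metric_inner M c x u v)\<^sup>2)"

section \<open>Curves and vector fields along curves\<close>

definition smooth_into ::
    "('a, 'n::finite) riemannian_structure \<Rightarrow> 'v::real_normed_vector set \<Rightarrow> ('v \<Rightarrow> 'a) \<Rightarrow> bool"
  where "smooth_into M S F \<longleftrightarrow>
    continuous_map (top_of_set S) (mtop M) F \<and>
    (\<forall>c\<in>atlas M. smooth_on {x \<in> S. F x \<in> cdom c} (coord c \<circ> F))"

text \<open>A vector field \<open>V\<close> along a curve \<open>\<gamma>\<close> is represented by its components in every chart:
  \<open>V c s\<close> is the component vector at parameter \<open>s\<close> in the chart \<open>c\<close>. It is meaningful only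
  if \<open>\<gamma> s\<close> lies in the domain of \<open>c\<close>.\<close>

type_synonym ('a, 'n) field_along = "('a, 'n) chart \<Rightarrow> real \<Rightarrow> real ^ 'n"

definition smooth_field_along ::
    "('a, 'n::finite) riemannian_structure \<Rightarrow> real set \<Rightarrow> (real \<Rightarrow> 'a) \<Rightarrow> ('a, 'n) field_along \<Rightarrow> bool"
  where "smooth_field_along M I \<gamma> V \<longleftrightarrow>
    (\<forall>c\<in>atlas M. smooth_on {s \<in> I. \<gamma> s \<in> cdom c} (V c)) \<and>
    (\<forall>s\<in>I. \<forall>c\<in>atlas M. \<forall>d\<in>atlas M. \<gamma> s \<in> cdom c \<inter> cdom d \<longrightarrow>
       V d s = frechet_derivative (transition c d) (at (coord c (\<gamma> s))) (V c s))"

definition field_eq_on ::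
    "('a, 'n::finite) riemannian_structure \<Rightarrow> real set \<Rightarrow> (real \<Rightarrow> 'a) \<Rightarrow>
     ('a, 'n) field_along \<Rightarrow> ('a, 'n) field_along \<Rightarrow> bool"
  where "field_eq_on M I \<gamma> V W \<longleftrightarrow>
    (\<forall>s\<in>I. \<forall>c\<in>atlas M. \<gamma> s \<in> cdom c \<longrightarrow> V c s = W c s)"

text \<open>The inner product of fields along \<open>\<gamma>\<close> may be computed in any chart around \<open>\<gamma> s\<close>, by
  the transformation law of the metric.\<close>

definition inner_along ::
    "('a, 'n::finite) riemannian_structure \<Rightarrow> (real \<Rightarrow> 'a) \<Rightarrow>
     ('a, 'n) field_along \<Rightarrow> ('a, 'n) field_along \<Rightarrow> real \<Rightarrow> real"
  where "inner_along M \<gamma> V W s =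
    (let c = (SOME c. c \<in> atlas M \<and> \<gamma> s \<in> cdom c)
     in metric_inner M c (coord c (\<gamma> s)) (V c s) (W c s))"

definition velocity :: "(real \<Rightarrow> 'a) \<Rightarrow> ('a, 'n::finite) field_along" where
  "velocity \<gamma> c s = vector_derivative (coord c \<circ> \<gamma>) (at s)"

definition cov_deriv ::
    "('a, 'n::finite) riemannian_structure \<Rightarrow> (real \<Rightarrow> 'a) \<Rightarrow> ('a, 'n) field_along \<Rightarrow> ('a, 'n) field_along"
  where "cov_deriv M \<gamma> V c s =
    vector_derivative (V c) (at s) +
    (\<chi> k. \<Sum>i\<in>UNIV. \<Sum>j\<in>UNIV.
       christoffel M c k i j (coord c (\<gamma> s)) * velocity \<gamma> c s $ i * V c s $ j)"

definition tension ::
    "('a, 'n::finite) riemannian_structure \<Rightarrow> (real \<Rightarrow> 'a) \<Rightarrow> ('a, 'n) field_along" where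
  "tension M \<gamma> = cov_deriv M \<gamma> (velocity \<gamma>)"

definition rough_laplacian ::
    "('a, 'n::finite) riemannian_structure \<Rightarrow> (real \<Rightarrow> 'a) \<Rightarrow> ('a, 'n) field_along \<Rightarrow> ('a, 'n) field_along"
  where "rough_laplacian M \<gamma> V = (\<lambda>c s. - cov_deriv M \<gamma> (cov_deriv M \<gamma> V) c s)"

definition arclength_param ::
    "('a, 'n::finite) riemannian_structure \<Rightarrow> real set \<Rightarrow> (real \<Rightarrow> 'a) \<Rightarrow> bool" where
  "arclength_param M I \<gamma> \<longleftrightarrow> smooth_into M I \<gamma> \<and>
     (\<forall>s\<in>I. inner_along M \<gamma> (velocity \<gamma>) (velocity \<gamma>) s = 1)"

section \<open>Space forms\<close>

definition open_interval :: "real set \<Rightarrow> bool" where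
  "open_interval I \<longleftrightarrow> I \<noteq> {} \<and> open I \<and> is_interval I"

definition geodesic ::
    "('a, 'n::finite) riemannian_structure \<Rightarrow> real set \<Rightarrow> (real \<Rightarrow> 'a) \<Rightarrow> bool" where
  "geodesic M J \<sigma> \<longleftrightarrow> smooth_into M J \<sigma> \<and> field_eq_on M J \<sigma> (tension M \<sigma>) (\<lambda>c s. 0)"

definition geodesically_complete :: "('a, 'n::finite) riemannian_structure \<Rightarrow> bool" where
  "geodesically_complete M \<longleftrightarrow>
     (\<forall>J \<sigma>. open_interval J \<and> geodesic M J \<sigma> \<longrightarrow>
        (\<exists>\<sigma>'. geodesic M UNIV \<sigma>' \<and> (\<forall>s\<in>J. \<sigma>' s = \<sigma> s)))"

definition constant_sectional_curvature ::
    "('a, 'n::finite) riemannian_structure \<Rightarrow> real \<Rightarrow> bool" where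
  "constant_sectional_curvature M C \<longleftrightarrow>
     (\<forall>c\<in>atlas M. \<forall>x\<in>coord c ` cdom c. \<forall>u v. u \<noteq> v \<and> independent {u, v} \<longrightarrow>
        sectional_curvature M c x u v = C)"

text \<open>Space forms are connected and complete, but not required to be simply connected.
  Completeness is geodesic completeness.\<close>

definition space_form :: "('a, 'n::finite) riemannian_structure \<Rightarrow> real \<Rightarrow> bool" where
  "space_form M C \<longleftrightarrow> riemannian_manifold M \<and> connected_space (mtop M) \<and>
     geodesically_complete M \<and> constant_sectional_curvature M C"

section \<open>Curvature of a curve in a surface\<close>

definition has_geodesic_curvature ::
    "('a, 2) riemannian_structure \<Rightarrow> real set \<Rightarrow> (real \<Rightarrow> 'a) \<Rightarrow> (real \<Rightarrow> real) \<Rightarrow> bool" where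
  "has_geodesic_curvature M I \<gamma> \<kappa> \<longleftrightarrow>
     (\<exists>N. smooth_field_along M I \<gamma> N \<and>
        (\<forall>s\<in>I. inner_along M \<gamma> (velocity \<gamma>) (velocity \<gamma>) s = 1 \<and>
               inner_along M \<gamma> N N s = 1 \<and> inner_along M \<gamma> (velocity \<gamma>) N s = 0) \<and>
        field_eq_on M I \<gamma> (cov_deriv M \<gamma> (velocity \<gamma>)) (\<lambda>c s. \<kappa> s *\<^sub>R N c s) \<and>
        field_eq_on M I \<gamma> (cov_deriv M \<gamma> N) (\<lambda>c s. - \<kappa> s *\<^sub>R velocity \<gamma> c s))"

section \<open>The \<open>f\<close>-4-energy and its critical points\<close>

definition f4_energy ::
    "('a, 'n::finite) riemannian_structure \<Rightarrow> (real \<Rightarrow> real) \<Rightarrow> real set \<Rightarrow> (real \<Rightarrow> 'a) \<Rightarrow> real"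
  where "f4_energy M f \<Omega> \<gamma> =
    1 / 2 * integral \<Omega> (\<lambda>s. f s *
      inner_along M \<gamma> (rough_laplacian M \<gamma> (tension M \<gamma>)) (rough_laplacian M \<gamma> (tension M \<gamma>)) s)"

text \<open>A variation supported in \<open>\<Omega>\<close>. Every compactly supported variation is supported in some
  compact subinterval of \<open>I\<close>, over which the energy is then taken.\<close>

definition smooth_variation ::
    "('a, 'n::finite) riemannian_structure \<Rightarrow> real set \<Rightarrow> real set \<Rightarrow> (real \<Rightarrow> 'a) \<Rightarrow>
     (real \<Rightarrow> real \<Rightarrow> 'a) \<Rightarrow> bool"
  where "smooth_variation M I \<Omega> \<gamma> \<Phi> \<longleftrightarrow>
    (\<forall>s\<in>I. \<Phi> 0 s = \<gamma> s) \<and>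
    (\<exists>\<epsilon>>0. smooth_into M ({-\<epsilon><..<\<epsilon>} \<times> I) (\<lambda>(t, s). \<Phi> t s) \<and>
       (\<forall>t\<in>{-\<epsilon><..<\<epsilon>}. \<forall>s\<in>I - \<Omega>. \<Phi> t s = \<gamma> s))"

definition f4_harmonic ::
    "('a, 'n::finite) riemannian_structure \<Rightarrow> real set \<Rightarrow> (real \<Rightarrow> real) \<Rightarrow> (real \<Rightarrow> 'a) \<Rightarrow> bool"
  where "f4_harmonic M I f \<gamma> \<longleftrightarrow> smooth_into M I \<gamma> \<and>
    (\<forall>a b \<Phi>. a < b \<and> {a..b} \<subseteq> I \<and> smooth_variation M I {a..b} \<gamma> \<Phi> \<longrightarrow>
       ((\<lambda>t. f4_energy M f {a..b} (\<Phi> t)) has_real_derivative 0) (at 0))"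

definition four_harmonic ::
    "('a, 'n::finite) riemannian_structure \<Rightarrow> real set \<Rightarrow> (real \<Rightarrow> 'a) \<Rightarrow> bool" where
  "four_harmonic M I \<gamma> \<longleftrightarrow> f4_harmonic M I (\<lambda>_. 1) \<gamma>"

definition proper_f4_harmonic ::
    "('a, 'n::finite) riemannian_structure \<Rightarrow> real set \<Rightarrow> (real \<Rightarrow> real) \<Rightarrow> (real \<Rightarrow> 'a) \<Rightarrow> bool"
  where "proper_f4_harmonic M I f \<gamma> \<longleftrightarrow> f4_harmonic M I f \<gamma> \<and> \<not> four_harmonic M I \<gamma>"

end

(*
  Along a curve of constant geodesic curvature k in a surface of constant curvature C, the
  f-4-energy density varies, in the direction a T + b N, at the rate
    - k^3 f (b'''' + (C - 6 k^2) b'' + (k^4 - 3 k^2 C) b + 4 k a''' - 4 k^3 a').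
  To see this, commute the covariant derivative in the variation parameter past those along the
  curve; each commutation costs a curvature term, which is explicit since the curvature is constant.
  Variations supported in a single chart are enough. Integrating by parts, criticality becomes
    f''' = k^2 f'   and   f'''' + (C - 6 k^2) f'' + (k^4 - 3 k^2 C) f = 0.
  Eliminating the higher derivatives leaves (C + 2 k^2) f' = 0. If C + 2 k^2 were nonzero, f would
  be constant, and the curve 4-harmonic.
*)

theory Submission
  imports Defs
begin

section \<open>Analysis: smooth calculus, symmetry of second derivatives, bump functions, bilinear
  families\<close>

section \<open>Calculus of smooth maps\<close>

text \<open>The energy is not invariant under reparametrization, so tangential variations carry
  information: they give f''' = k^2 f', normal ones the fourth-order equation. At t = 0 the thrice
  differentiated velocity is - k^3 N, so the first variation sees only the normal component of its
  derivative in t, and k > 0 allows dividing by k^3.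

  Fields along a curve are given chart by chart, and \<open>inner_along\<close> evaluates in an
  unspecified chart. Before the energy can be computed in one fixed chart, the covariant derivative
  must be shown to respect transition maps. Inside the chart the variation is the straight line x +
  t V in coordinates; the commutation takes place in the pullback connection along the resulting map
  of (t, s).

  The final factor arises as follows. Since f'''' = k^2 f'', the normal equation becomes (C - 5 k^2)
  f'' + (k^4 - 3 k^2 C) f = 0. Differentiating once more and replacing f''' by k^2 f' gives the
  coefficient k^2 (C - 5 k^2) + k^4 - 3 k^2 C = - 2 k^2 (C + 2 k^2) in front of f'.\<close>

lemma Ck_on_subset: "Ck_on k S f \<Longrightarrow> T \<subseteq> S \<Longrightarrow> Ck_on k T f"
  by (induction k arbitrary: f) (auto intro: continuous_on_subset)

lemma smooth_on_subset: "smooth_on S f \<Longrightarrow> T \<subseteq> S \<Longrightarrow> smooth_on T f"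
  unfolding smooth_on_def using Ck_on_subset by blast

text \<open>This holds even where neither map is differentiable: \<open>frechet_derivative\<close>
  chooses from the set of all derivatives at the point, and the two sets coincide.\<close>

lemma frechet_derivative_cong_open:
  assumes "open S" "x \<in> S" "\<And>y. y \<in> S \<Longrightarrow> f y = g y"
  shows "frechet_derivative f (at x) = frechet_derivative g (at x)"
proof -
  have "(f has_derivative D) (at x) \<longleftrightarrow> (g has_derivative D) (at x)" for D
    using has_derivative_transform_within_open[OF _ assms(1,2), of f D UNIV g]
      has_derivative_transform_within_open[OF _ assms(1,2), of g D UNIV f] assms(3) by auto
  then show ?thesis
    unfolding frechet_derivative_def by simp
qed

lemma differentiable_cong_open:
  assumes "open S" "x \<in> S" "\<And>y. y \<in> S \<Longrightarrow> f y = g y"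
  shows "f differentiable (at x) \<longleftrightarrow> g differentiable (at x)"
  unfolding differentiable_def
  using has_derivative_transform_within_open[OF _ assms(1,2), of f _ UNIV g]
    has_derivative_transform_within_open[OF _ assms(1,2), of g _ UNIV f] assms(3) by metis

lemma Ck_on_cong:
  assumes "open S" "\<And>x. x \<in> S \<Longrightarrow> f x = g x"
  shows "Ck_on k S f \<longleftrightarrow> Ck_on k S g"
  using assms(2)
proof (induction k arbitrary: f g)
  case 0
  then show ?case by (simp cong: continuous_on_cong)
next
  case (Suc k)
  have "Ck_on k S (\<lambda>x. frechet_derivative f (at x) v) \<longleftrightarrow>
        Ck_on k S (\<lambda>x. frechet_derivative g (at x) v)" for v
    by (rule Suc.IH) (metis frechet_derivative_cong_open[OF assms(1)] Suc.prems)
  moreover have "f differentiable (at x) \<longleftrightarrow> g differentiable (at x)" if "x \<in> S" for x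
    by (rule differentiable_cong_open[OF assms(1) that]) (rule Suc.prems)
  ultimately show ?case by auto
qed

lemma smooth_on_cong:
  assumes "open S" "\<And>x. x \<in> S \<Longrightarrow> f x = g x"
  shows "smooth_on S f \<longleftrightarrow> smooth_on S g"
  unfolding smooth_on_def using Ck_on_cong[OF assms] by simp

text \<open>The successor clause demands differentiability and says nothing about continuity of the
  map itself, so the descent bottoms out in differentiable maps being continuous.\<close>

lemma Ck_on_Suc_imp: "Ck_on (Suc k) S f \<Longrightarrow> Ck_on k S f"
proof (induction k arbitrary: f)
  case 0
  then show ?case
    by (auto intro!: continuous_at_imp_continuous_on differentiable_imp_continuous_within)
next
  case (Suc k)
  note D = iffD1[OF Ck_on.simps(2) Suc.prems]
  have "Ck_on k S (\<lambda>x. frechet_derivative f (at x) v)" for v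
    using D Suc.IH by blast
  then show ?case using D by (simp only: Ck_on.simps(2)) blast
qed

lemma Ck_on_local:
  assumes "open S" "\<And>x. x \<in> S \<Longrightarrow> \<exists>U. open U \<and> x \<in> U \<and> Ck_on k (U \<inter> S) f"
  shows "Ck_on k S f"
  using assms(2)
proof (induction k arbitrary: f)
  case 0
  have "isCont f x" if "x \<in> S" for x
  proof -
    obtain U where "open U" "x \<in> U" "continuous_on (U \<inter> S) f" using 0[OF \<open>x \<in> S\<close>] by auto
    then have "open (U \<inter> S)" "x \<in> U \<inter> S" using that assms(1) by auto
    then show ?thesis
      using \<open>continuous_on (U \<inter> S) f\<close> continuous_on_eq_continuous_at by blast
  qed
  then show ?case
    by (simp add: continuous_at_imp_continuous_on)
next
  case (Suc k)
  have "Ck_on k S (\<lambda>x. frechet_derivative f (at x) v)" for v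
  proof (rule Suc.IH)
    fix x assume "x \<in> S"
    then obtain U where "open U" "x \<in> U" "Ck_on (Suc k) (U \<inter> S) f" using Suc.prems by blast
    then show "\<exists>U. open U \<and> x \<in> U \<and> Ck_on k (U \<inter> S) (\<lambda>x. frechet_derivative f (at x) v)"
      by (intro exI[of _ U]) simp
  qed
  moreover have "f differentiable (at x)" if "x \<in> S" for x
  proof -
    obtain U where "open U" "x \<in> U" "Ck_on (Suc k) (U \<inter> S) f" using Suc.prems \<open>x \<in> S\<close> by blast
    then show ?thesis using that by simp
  qed
  ultimately show ?case by auto
qed

lemma smooth_on_local:
  assumes "open S" "\<And>x. x \<in> S \<Longrightarrow> \<exists>U. open U \<and> x \<in> U \<and> smooth_on (U \<inter> S) f"
  shows "smooth_on S f"
  unfolding smooth_on_def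
proof
  fix k
  show "Ck_on k S f"
  proof (rule Ck_on_local[OF assms(1)])
    fix x assume "x \<in> S"
    then obtain U where "open U" "x \<in> U" "smooth_on (U \<inter> S) f" using assms(2) by blast
    then show "\<exists>U. open U \<and> x \<in> U \<and> Ck_on k (U \<inter> S) f"
      unfolding smooth_on_def by (intro exI[of _ U]) simp
  qed
qed

lemma smooth_on_differentiable: "smooth_on S f \<Longrightarrow> x \<in> S \<Longrightarrow> f differentiable (at x)"
  unfolding smooth_on_def using Ck_on.simps(2)[of 0 S f] by blast

lemma smooth_on_frechet:
  "smooth_on S f \<Longrightarrow> x \<in> S \<Longrightarrow> (f has_derivative frechet_derivative f (at x)) (at x)"
  using smooth_on_differentiable frechet_derivative_works by blast

lemma smooth_on_frechet_derivative:
  "smooth_on S f \<Longrightarrow> smooth_on S (\<lambda>x. frechet_derivative f (at x) v)"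
  unfolding smooth_on_def
proof
  fix k
  assume "\<forall>k. Ck_on k S f"
  then have "Ck_on (Suc k) S f" by blast
  then show "Ck_on k S (\<lambda>x. frechet_derivative f (at x) v)" by simp
qed

lemma smooth_on_continuous: "smooth_on S f \<Longrightarrow> continuous_on S f"
  unfolding smooth_on_def using Ck_on.simps(1)[of S f] by blast

lemma smooth_onI_derivative:
  assumes "\<And>x. x \<in> S \<Longrightarrow> f differentiable (at x)"
    and "\<And>v. smooth_on S (\<lambda>x. frechet_derivative f (at x) v)"
  shows "smooth_on S f"
  unfolding smooth_on_def
proof
  fix k
  show "Ck_on k S f"
    by (rule Ck_on_Suc_imp) (use assms in \<open>simp add: smooth_on_def\<close>)
qed

lemma Ck_on_const: "Ck_on k S (\<lambda>x. c)"
  by (induction k arbitrary: c) auto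

lemma smooth_on_const: "smooth_on S (\<lambda>x. c)"
  by (simp add: smooth_on_def Ck_on_const)

lemma smooth_on_bounded_linear: assumes "bounded_linear f" shows "smooth_on S f"
proof (rule smooth_onI_derivative)
  have "frechet_derivative f (at x) = f" for x
    using frechet_derivative_at[OF bounded_linear_imp_has_derivative[OF assms]] by simp
  then show "smooth_on S (\<lambda>x. frechet_derivative f (at x) v)" for v
    by (simp add: smooth_on_const)
qed (use assms bounded_linear_imp_differentiable in blast)

lemma Ck_on_add:
  assumes "open S"
  shows "Ck_on k S h1 \<Longrightarrow> Ck_on k S h2 \<Longrightarrow> Ck_on k S (\<lambda>x. h1 x + h2 x)"
proof (induction k arbitrary: h1 h2)
  case 0
  then show ?case by (simp add: continuous_on_add)
next
  case (Suc k)
  have "frechet_derivative (\<lambda>x. h1 x + h2 x) (at x) v =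
      frechet_derivative h1 (at x) v + frechet_derivative h2 (at x) v" if "x \<in> S" for x v
  proof -
    have "h1 differentiable at x" "h2 differentiable at x" using Suc.prems that by auto
    then have "((\<lambda>x. h1 x + h2 x) has_derivative
        (\<lambda>v. frechet_derivative h1 (at x) v + frechet_derivative h2 (at x) v)) (at x)"
      by (intro has_derivative_add) (auto simp: frechet_derivative_works)
    then show ?thesis by (simp add: frechet_derivative_at[symmetric])
  qed
  then have "Ck_on k S (\<lambda>x. frechet_derivative (\<lambda>x. h1 x + h2 x) (at x) v) \<longleftrightarrow>
      Ck_on k S (\<lambda>x. frechet_derivative h1 (at x) v + frechet_derivative h2 (at x) v)" for v
    by (rule Ck_on_cong[OF assms])
  moreover have "Ck_on k S (\<lambda>x. frechet_derivative h1 (at x) v + frechet_derivative h2 (at x) v)" for v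
    using Suc.prems by (intro Suc.IH) auto
  ultimately have "Ck_on k S (\<lambda>x. frechet_derivative (\<lambda>x. h1 x + h2 x) (at x) v)" for v
    by blast
  then show ?case using Suc.prems by (auto intro: differentiable_add)
qed

text \<open>Covers scalar multiples, products and inner products at once. The product rule pairs a
  derivative with an undifferentiated factor, so the factors must first be lowered by one
  order.\<close>

lemma Ck_on_bilinear:
  assumes "open S" "bounded_bilinear prd"
  shows "Ck_on k S f \<Longrightarrow> Ck_on k S g \<Longrightarrow> Ck_on k S (\<lambda>x. prd (f x) (g x))"
proof -
  interpret bounded_bilinear prd by fact
  show "Ck_on k S f \<Longrightarrow> Ck_on k S g \<Longrightarrow> Ck_on k S (\<lambda>x. prd (f x) (g x))"
  proof (induction k arbitrary: f g)
    case 0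
    then show ?case by (simp add: continuous_on)
  next
    case (Suc k)
    have der: "((\<lambda>x. prd (f x) (g x)) has_derivative
        (\<lambda>v. prd (f x) (frechet_derivative g (at x) v) + prd (frechet_derivative f (at x) v) (g x))) (at x)"
      if "x \<in> S" for x
      using Suc.prems that by (intro FDERIV) (auto simp: frechet_derivative_works)
    have eq: "frechet_derivative (\<lambda>x. prd (f x) (g x)) (at x) v =
       prd (f x) (frechet_derivative g (at x) v) + prd (frechet_derivative f (at x) v) (g x)"
      if "x \<in> S" for x v
      using fun_cong[OF frechet_derivative_at[OF der[OF that]], of v] by simp
    have "Ck_on k S (\<lambda>x. prd (f x) (frechet_derivative g (at x) v) +
        prd (frechet_derivative f (at x) v) (g x))" for v
      using Suc.prems Ck_on_Suc_imp[OF Suc.prems(1)] Ck_on_Suc_imp[OF Suc.prems(2)]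
        by (intro Ck_on_add[OF assms(1)] Suc.IH) auto
    moreover have "Ck_on k S (\<lambda>x. frechet_derivative (\<lambda>x. prd (f x) (g x)) (at x) v) \<longleftrightarrow>
        Ck_on k S (\<lambda>x. prd (f x) (frechet_derivative g (at x) v) +
        prd (frechet_derivative f (at x) v) (g x))" for v
      by (rule Ck_on_cong[OF assms(1)]) (rule eq)
    ultimately have "Ck_on k S (\<lambda>x. frechet_derivative (\<lambda>x. prd (f x) (g x)) (at x) v)" for v
      by blast
    then show ?case using der by (auto simp: differentiable_def)
  qed
qed

lemma smooth_on_bilinear:
  assumes "bounded_bilinear prd" "open S" "smooth_on S f" "smooth_on S g"
  shows "smooth_on S (\<lambda>x. prd (f x) (g x))"
  using Ck_on_bilinear[OF assms(2,1)] assms(3,4) unfolding smooth_on_def by blast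

lemmas smooth_on_scaleR = smooth_on_bilinear[OF bounded_bilinear_scaleR]
lemmas smooth_on_mult = smooth_on_bilinear[OF bounded_bilinear_mult]
lemmas smooth_on_inner = smooth_on_bilinear[OF bounded_bilinear_inner]

lemma smooth_on_add:
  assumes "open S" "smooth_on S f" "smooth_on S g"
  shows "smooth_on S (\<lambda>x. f x + g x)"
  using assms Ck_on_add[OF assms(1)] unfolding smooth_on_def by blast

lemma smooth_on_sum:
  assumes "open S" "\<And>i. i \<in> A \<Longrightarrow> smooth_on S (f i)"
  shows "smooth_on S (\<lambda>x. \<Sum>i\<in>A. f i x)"
  using assms(2) by (induction A rule: infinite_finite_induct)
    (auto intro!: smooth_on_const smooth_on_add assms(1))

lemma smooth_on_prod:
  fixes f :: "'i \<Rightarrow> 'a::real_normed_vector \<Rightarrow> real"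
  assumes "open S" "\<And>i. i \<in> A \<Longrightarrow> smooth_on S (f i)"
  shows "smooth_on S (\<lambda>x. \<Prod>i\<in>A. f i x)"
  using assms(2) by (induction A rule: infinite_finite_induct)
    (auto intro!: smooth_on_const smooth_on_mult assms(1))

lemma smooth_on_uminus: "open S \<Longrightarrow> smooth_on S f \<Longrightarrow> smooth_on S (\<lambda>x. - f x)"
  using smooth_on_scaleR[OF _ smooth_on_const[of S "-1"], of f] by simp

lemma smooth_on_diff:
  "open S \<Longrightarrow> smooth_on S f \<Longrightarrow> smooth_on S g \<Longrightarrow> smooth_on S (\<lambda>x. f x - g x)"
  using smooth_on_add[OF _ _ smooth_on_uminus, of S f g] by simp

text \<open>The chain rule applies the derivative of \<open>f\<close> to a vector that moves with x,
  whereas \<open>Ck_on\<close> controls derivatives in fixed directions only. Expanding the moving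
  vector in a basis reduces to fixed directions; this is what the Euclidean middle space is
  for.\<close>

lemma Ck_on_compose:
  fixes g :: "'a::real_normed_vector \<Rightarrow> 'b::euclidean_space"
  assumes "open S" "open T" "g ` S \<subseteq> T" "smooth_on S g"
  shows "Ck_on k T f \<Longrightarrow> Ck_on k S (\<lambda>x. f (g x))"
proof (induction k arbitrary: f)
  case 0
  then show ?case
    using continuous_on_compose2[OF _ smooth_on_continuous[OF assms(4)] assms(3)] by simp
next
  case (Suc k)
  have der: "((\<lambda>x. f (g x)) has_derivative
      (\<lambda>v. frechet_derivative f (at (g x)) (frechet_derivative g (at x) v))) (at x)"
    if "x \<in> S" for x
  proof -
    have "(f has_derivative frechet_derivative f (at (g x))) (at (g x))"
      using Suc.prems that assms(3) by (auto simp: frechet_derivative_works)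
    then show ?thesis
      using has_derivative_compose[OF smooth_on_frechet[OF assms(4) that]] by blast
  qed
  have eq: "frechet_derivative (\<lambda>x. f (g x)) (at x) v =
    (\<Sum>b\<in>Basis. (frechet_derivative g (at x) v \<bullet> b) *\<^sub>R frechet_derivative f (at (g x)) b)"
    if "x \<in> S" for x v
  proof -
    have lin: "linear (frechet_derivative f (at (g x)))"
      using Suc.prems that assms(3) by (auto intro: linear_frechet_derivative)
    have "frechet_derivative (\<lambda>x. f (g x)) (at x) v =
        frechet_derivative f (at (g x)) (frechet_derivative g (at x) v)"
      using fun_cong[OF frechet_derivative_at[OF der[OF that]], of v] by simp
    also have "\<dots> = frechet_derivative f (at (g x))
        (\<Sum>b\<in>Basis. (frechet_derivative g (at x) v \<bullet> b) *\<^sub>R b)"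
      by (simp add: euclidean_representation)
    finally show ?thesis using lin by (simp add: linear_sum linear_scale)
  qed
  have sm: "Ck_on k S (\<lambda>x. \<Sum>b\<in>B. (frechet_derivative g (at x) v \<bullet> b) *\<^sub>R frechet_derivative f (at (g x)) b)"
    for v B
  proof (induction B rule: infinite_finite_induct)
    case (insert b B)
    have "Ck_on k S (\<lambda>x. frechet_derivative g (at x) v \<bullet> b)"
      using smooth_on_inner[OF assms(1) smooth_on_frechet_derivative[OF assms(4), of v] smooth_on_const[of S b]]
      by (simp add: smooth_on_def)
    moreover have "Ck_on k S (\<lambda>x. frechet_derivative f (at (g x)) b)"
      by (rule Suc.IH) (use Suc.prems in auto)
    ultimately have "Ck_on k S (\<lambda>x. (frechet_derivative g (at x) v \<bullet> b) *\<^sub>R frechet_derivative f (at (g x)) b)"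
      by (rule Ck_on_bilinear[OF assms(1) bounded_bilinear_scaleR])
    then show ?case
      using insert Ck_on_add[OF assms(1)] by simp
  qed (auto simp: Ck_on_const)
  have "Ck_on k S (\<lambda>x. frechet_derivative (\<lambda>x. f (g x)) (at x) v)" for v
    by (rule iffD2[OF Ck_on_cong[OF assms(1) eq] sm])
  then show ?case using der by (auto simp: differentiable_def)
qed

lemma smooth_on_compose:
  fixes g :: "'a::real_normed_vector \<Rightarrow> 'b::euclidean_space"
  assumes "open S" "open T" "smooth_on T f" "smooth_on S g" "\<And>x. x \<in> S \<Longrightarrow> g x \<in> T"
  shows "smooth_on S (\<lambda>x. f (g x))"
  using Ck_on_compose[of S T g] assms unfolding smooth_on_def by blast

lemma smooth_on_bounded_linear_compose:
  assumes "bounded_linear h" "open S" "smooth_on S f"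
  shows "smooth_on S (\<lambda>x. h (f x))"
proof -
  have "bounded_bilinear (\<lambda>(c::real) v. c *\<^sub>R h v)"
    by (rule bounded_bilinear.comp[OF bounded_bilinear_scaleR bounded_linear_ident assms(1)])
  from smooth_on_bilinear[OF this assms(2) smooth_on_const[of S 1] assms(3)]
  show ?thesis by simp
qed

text \<open>The derivative - f' / f^2 is a product of a smooth map with two copies of the inverse
  itself, so the induction on the order closes.\<close>

lemma smooth_on_inverse:
  fixes f :: "'a::real_normed_vector \<Rightarrow> real"
  assumes "open S" "smooth_on S f" "\<And>x. x \<in> S \<Longrightarrow> f x \<noteq> 0"
  shows "smooth_on S (\<lambda>x. inverse (f x))"
  unfolding smooth_on_def
proof
  fix k show "Ck_on k S (\<lambda>x. inverse (f x))"
  proof (induction k)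
    case 0
    then show ?case
      using smooth_on_continuous[OF assms(2)] assms(3) by (auto intro: continuous_on_inverse)
  next
    case (Suc k)
    have der: "((\<lambda>x. inverse (f x)) has_derivative
        (\<lambda>v. - (inverse (f x) * frechet_derivative f (at x) v * inverse (f x)))) (at x)"
      if "x \<in> S" for x
      using assms(3)[OF that] smooth_on_frechet[OF assms(2) that]
      by (auto intro!: derivative_eq_intros)
    have eq: "frechet_derivative (\<lambda>x. inverse (f x)) (at x) v =
        (- frechet_derivative f (at x) v) * (inverse (f x) * inverse (f x))" if "x \<in> S" for x v
      using fun_cong[OF frechet_derivative_at[OF der[OF that]], of v] by (simp add: mult_ac)
    have "Ck_on k S (\<lambda>x. - frechet_derivative f (at x) v)" for v
      using smooth_on_uminus[OF assms(1) smooth_on_frechet_derivative[OF assms(2)]]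
      by (simp add: smooth_on_def)
    then have "Ck_on k S (\<lambda>x. (- frechet_derivative f (at x) v) * (inverse (f x) * inverse (f x)))" for v
      using Suc by (intro Ck_on_bilinear[OF assms(1) bounded_bilinear_mult])
    moreover have "Ck_on k S (\<lambda>x. frechet_derivative (\<lambda>x. inverse (f x)) (at x) v) \<longleftrightarrow>
        Ck_on k S (\<lambda>x. (- frechet_derivative f (at x) v) * (inverse (f x) * inverse (f x)))" for v
      by (rule Ck_on_cong[OF assms(1)]) (rule eq)
    ultimately have "Ck_on k S (\<lambda>x. frechet_derivative (\<lambda>x. inverse (f x)) (at x) v)" for v
      by blast
    then show ?case using der by (auto simp: differentiable_def)
  qed
qed

lemma smooth_on_vec_nth:
  "open S \<Longrightarrow> smooth_on S f \<Longrightarrow> smooth_on S (\<lambda>x. f x $ i)"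
  by (rule smooth_on_bounded_linear_compose[OF bounded_linear_vec_nth])

lemma smooth_on_vec_lambda:
  fixes f :: "'n::finite \<Rightarrow> 'a::real_normed_vector \<Rightarrow> real"
  assumes "open S" "\<And>i. smooth_on S (f i)"
  shows "smooth_on S (\<lambda>x. \<chi> i. f i x)"
proof -
  have "(\<lambda>x. \<chi> i. f i x) = (\<lambda>x. \<Sum>i\<in>UNIV. f i x *\<^sub>R axis i 1)"
    by (auto simp: vec_eq_iff axis_def if_distrib cong: if_cong)
  then show ?thesis
    using assms by (auto intro!: smooth_on_sum smooth_on_scaleR smooth_on_const)
qed

lemma smooth_on_Pair:
  assumes "open S" "smooth_on S f" "smooth_on S g"
  shows "smooth_on S (\<lambda>x. (f x, g x))"
proof -
  have "smooth_on S (\<lambda>x. (f x, 0) + (0, g x))"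
    using assms by (intro smooth_on_add smooth_on_bounded_linear_compose[where h = "\<lambda>x. (x, 0)"]
      smooth_on_bounded_linear_compose[where h = "\<lambda>x. (0, x)"] bounded_linear_Pair
      bounded_linear_ident bounded_linear_zero)
  then show ?thesis by simp
qed

lemma smooth_on_fst: "smooth_on S fst" and smooth_on_snd: "smooth_on S snd"
  by (auto intro: smooth_on_bounded_linear bounded_linear_fst bounded_linear_snd)

lemma frechet_derivative_chain:
  assumes "g differentiable (at x)" "f differentiable (at (g x))"
  shows "frechet_derivative (\<lambda>x. f (g x)) (at x) v =
    frechet_derivative f (at (g x)) (frechet_derivative g (at x) v)"
  using fun_cong[OF frechet_derivative_at[OF has_derivative_compose[of g "frechet_derivative g (at x)" x UNIV f]], of _ v]
    assms by (simp add: frechet_derivative_works)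

section \<open>Symmetry of second derivatives\<close>

lemma has_real_derivative_along_line:
  fixes h :: "'v::real_normed_vector \<Rightarrow> real"
  assumes "h differentiable (at (x + s *\<^sub>R v))"
  shows "((\<lambda>s. h (x + s *\<^sub>R v)) has_real_derivative frechet_derivative h (at (x + s *\<^sub>R v)) v) (at s)"
proof -
  have 1: "((\<lambda>s. x + s *\<^sub>R v) has_derivative (\<lambda>r. r *\<^sub>R v)) (at s)"
    by (auto intro!: derivative_eq_intros)
  have 2: "(h has_derivative frechet_derivative h (at (x + s *\<^sub>R v))) (at (x + s *\<^sub>R v))"
    using assms by (simp add: frechet_derivative_works)
  have "linear (frechet_derivative h (at (x + s *\<^sub>R v)))"
    using assms linear_frechet_derivative by blast
  then have "(\<lambda>r. frechet_derivative h (at (x + s *\<^sub>R v)) (r *\<^sub>R v)) =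
      (*) (frechet_derivative h (at (x + s *\<^sub>R v)) v)"
    by (auto simp: linear_scale)
  then show ?thesis
    using has_derivative_compose[OF 1 2] by (simp add: has_field_derivative_def)
qed

text \<open>The mean value theorem is applied twice: to the increment in direction \<open>v\<close>,
  viewed as a function along \<open>u\<close>, and then to the derivative in direction
  \<open>u\<close>, viewed as a function along \<open>v\<close>.\<close>

lemma second_difference_mean_value:
  fixes h :: "'v::real_normed_vector \<Rightarrow> real"
  assumes h: "smooth_on S h" and d: "0 < d"
    and S: "\<And>s t. 0 \<le> s \<Longrightarrow> s \<le> d \<Longrightarrow> 0 \<le> t \<Longrightarrow> t \<le> d \<Longrightarrow> x + s *\<^sub>R u + t *\<^sub>R v \<in> S"
  obtains s t where "0 < s" "s < d" "0 < t" "t < d"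
    "h (x + d *\<^sub>R u + d *\<^sub>R v) - h (x + d *\<^sub>R u) - h (x + d *\<^sub>R v) + h x =
     d\<^sup>2 * frechet_derivative (\<lambda>y. frechet_derivative h (at y) u) (at (x + s *\<^sub>R u + t *\<^sub>R v)) v"
proof -
  define p where "p s = h (x + d *\<^sub>R v + s *\<^sub>R u) - h (x + s *\<^sub>R u)" for s
  define hu where "hu y = frechet_derivative h (at y) u" for y
  have "(p has_real_derivative hu (x + d *\<^sub>R v + s *\<^sub>R u) - hu (x + s *\<^sub>R u)) (at s)"
    if "0 \<le> s" "s \<le> d" for s
    unfolding p_def hu_def
    by (intro DERIV_diff has_real_derivative_along_line smooth_on_differentiable[OF h])
      (use S[OF that, of d] S[OF that, of 0] d in \<open>auto simp: ac_simps\<close>)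
  then obtain s where s: "0 < s" "s < d"
    "p d - p 0 = d * (hu (x + d *\<^sub>R v + s *\<^sub>R u) - hu (x + s *\<^sub>R u))"
    using MVT2[OF d, of p "\<lambda>s. hu (x + d *\<^sub>R v + s *\<^sub>R u) - hu (x + s *\<^sub>R u)"] by auto
  have "((\<lambda>t. hu (x + s *\<^sub>R u + t *\<^sub>R v)) has_real_derivative
      frechet_derivative hu (at (x + s *\<^sub>R u + t *\<^sub>R v)) v) (at t)"
    if "0 \<le> t" "t \<le> d" for t
    using S[of s t] s that smooth_on_differentiable[OF smooth_on_frechet_derivative[OF h, of u]]
    by (intro has_real_derivative_along_line) (auto simp: hu_def[abs_def])
  then obtain t where t: "0 < t" "t < d"
    "hu (x + s *\<^sub>R u + d *\<^sub>R v) - hu (x + s *\<^sub>R u + 0 *\<^sub>R v) =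
      d * frechet_derivative hu (at (x + s *\<^sub>R u + t *\<^sub>R v)) v"
    using MVT2[OF d, of "\<lambda>t. hu (x + s *\<^sub>R u + t *\<^sub>R v)"
      "\<lambda>t. frechet_derivative hu (at (x + s *\<^sub>R u + t *\<^sub>R v)) v"] by auto
  have "h (x + d *\<^sub>R u + d *\<^sub>R v) - h (x + d *\<^sub>R u) - h (x + d *\<^sub>R v) + h x = p d - p 0"
    by (simp add: p_def ac_simps)
  also have "\<dots> = d * (d * frechet_derivative hu (at (x + s *\<^sub>R u + t *\<^sub>R v)) v)"
    using s(3) t(3) by (simp add: ac_simps)
  finally show ?thesis
    using s t by (intro that[of s t]) (auto simp: power2_eq_square hu_def[abs_def])
qed

text \<open>The second difference over a small parallelogram is symmetric in \<open>u\<close> and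
  \<open>v\<close>. It therefore equates the two mixed derivatives at two points close to x, and
  continuity carries the equality to x as the parallelogram shrinks.\<close>

lemma frechet_derivative_swap_real:
  fixes h :: "'v::real_normed_vector \<Rightarrow> real"
  assumes S: "open S" and h: "smooth_on S h" and x: "x \<in> S"
  shows "frechet_derivative (\<lambda>y. frechet_derivative h (at y) u) (at x) v =
    frechet_derivative (\<lambda>y. frechet_derivative h (at y) v) (at x) u"
proof -
  define A where "A u v = (\<lambda>y. frechet_derivative (\<lambda>y. frechet_derivative h (at y) u) (at y) v)" for u v
  have contA: "isCont (A u v) x" for u v
    using smooth_on_continuous[OF smooth_on_frechet_derivative[OF smooth_on_frechet_derivative[OF h]]] S x
    unfolding A_def by (simp add: continuous_on_eq_continuous_at)
  define d where "d n = 1 / real (Suc n)" for n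
  have d0: "d \<longlonglongrightarrow> 0" unfolding d_def using LIMSEQ_inverse_real_of_nat by (simp add: inverse_eq_divide)
  have dpos: "d n > 0" for n by (simp add: d_def)
  obtain r where r: "r > 0" "ball x r \<subseteq> S" using S x openE by blast
  \<comment> \<open>Below this bound the whole parallelogram stays in the ball of radius
    \<open>r\<close>; the summand 1 keeps the denominator positive when both vectors vanish.\<close>
  have "eventually (\<lambda>n. d n < r / (norm u + norm v + 1)) sequentially"
    using order_tendstoD(2)[OF d0, of "r / (norm u + norm v + 1)"] r
    by (simp add: add_nonneg_pos)
  then have "eventually (\<lambda>n. \<exists>s1 t1 s2 t2. A u v (x + s1 *\<^sub>R u + t1 *\<^sub>R v) = A v u (x + s2 *\<^sub>R u + t2 *\<^sub>R v)
      \<and> \<bar>s1\<bar> \<le> d n \<and> \<bar>t1\<bar> \<le> d n \<and> \<bar>s2\<bar> \<le> d n \<and> \<bar>t2\<bar> \<le> d n) sequentially"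
  proof eventually_elim
    fix n assume dn: "d n < r / (norm u + norm v + 1)"
    have nn: "norm u + norm v + 1 > 0" by (simp add: add_nonneg_pos)
    have inS: "x + s *\<^sub>R u + t *\<^sub>R v \<in> S" if "0 \<le> s" "s \<le> d n" "0 \<le> t" "t \<le> d n" for s t
    proof -
      have "norm (s *\<^sub>R u + t *\<^sub>R v) \<le> norm (s *\<^sub>R u) + norm (t *\<^sub>R v)"
        by (rule norm_triangle_ineq)
      also have "\<dots> \<le> d n * norm u + d n * norm v"
        using that by (intro add_mono) (auto intro: mult_right_mono)
      also have "\<dots> \<le> d n * (norm u + norm v + 1)" using dpos[of n] by (simp add: algebra_simps)
      also have "\<dots> < r" using dn nn by (simp add: pos_less_divide_eq)
      finally have "norm (s *\<^sub>R u + t *\<^sub>R v) < r" .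
      moreover have "dist x (x + s *\<^sub>R u + t *\<^sub>R v) = norm (s *\<^sub>R u + t *\<^sub>R v)"
        by (metis add.assoc add_diff_cancel_left' dist_commute dist_norm)
      ultimately show ?thesis using r(2) by auto
    qed
    obtain s1 t1 where 1: "0 < s1" "s1 < d n" "0 < t1" "t1 < d n"
      "h (x + d n *\<^sub>R u + d n *\<^sub>R v) - h (x + d n *\<^sub>R u) - h (x + d n *\<^sub>R v) + h x =
       (d n)\<^sup>2 * A u v (x + s1 *\<^sub>R u + t1 *\<^sub>R v)"
      unfolding A_def by (rule second_difference_mean_value[OF h dpos inS]) auto
    obtain s2 t2 where 2: "0 < s2" "s2 < d n" "0 < t2" "t2 < d n"
      "h (x + d n *\<^sub>R v + d n *\<^sub>R u) - h (x + d n *\<^sub>R v) - h (x + d n *\<^sub>R u) + h x =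
       (d n)\<^sup>2 * A v u (x + s2 *\<^sub>R v + t2 *\<^sub>R u)"
      unfolding A_def
    proof (rule second_difference_mean_value[OF h dpos[of n], of x v u])
      show "x + s *\<^sub>R v + t *\<^sub>R u \<in> S" if "0 \<le> s" "s \<le> d n" "0 \<le> t" "t \<le> d n" for s t
        using inS[of t s] that by (simp add: ac_simps)
    qed auto
    \<comment> \<open>Both sides are the same second difference of \<open>h\<close>, read in the two
      orders.\<close>
    have "(d n)\<^sup>2 * A u v (x + s1 *\<^sub>R u + t1 *\<^sub>R v) = (d n)\<^sup>2 * A v u (x + t2 *\<^sub>R u + s2 *\<^sub>R v)"
      using 1(5) 2(5) by (simp add: algebra_simps)
    then have "A u v (x + s1 *\<^sub>R u + t1 *\<^sub>R v) = A v u (x + t2 *\<^sub>R u + s2 *\<^sub>R v)"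
      using dpos[of n] by simp
    then show "\<exists>s1 t1 s2 t2. A u v (x + s1 *\<^sub>R u + t1 *\<^sub>R v) = A v u (x + s2 *\<^sub>R u + t2 *\<^sub>R v)
      \<and> \<bar>s1\<bar> \<le> d n \<and> \<bar>t1\<bar> \<le> d n \<and> \<bar>s2\<bar> \<le> d n \<and> \<bar>t2\<bar> \<le> d n"
      using 1 2 by (intro exI[of _ s1] exI[of _ t1] exI[of _ t2] exI[of _ s2]) auto
  qed
  then obtain N where N: "\<And>n. n \<ge> N \<Longrightarrow> \<exists>s1 t1 s2 t2. A u v (x + s1 *\<^sub>R u + t1 *\<^sub>R v) = A v u (x + s2 *\<^sub>R u + t2 *\<^sub>R v)
      \<and> \<bar>s1\<bar> \<le> d n \<and> \<bar>t1\<bar> \<le> d n \<and> \<bar>s2\<bar> \<le> d n \<and> \<bar>t2\<bar> \<le> d n"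
    unfolding eventually_sequentially by blast
  \<comment> \<open>The four intermediate parameters are packed into one tuple so that a single
    choice yields all four sequences; the shift by \<open>N\<close> makes the property hold for
    every index.\<close>
  define P where "P n q \<longleftrightarrow> A u v (x + fst q *\<^sub>R u + fst (snd q) *\<^sub>R v) =
      A v u (x + fst (snd (snd q)) *\<^sub>R u + snd (snd (snd q)) *\<^sub>R v)
      \<and> \<bar>fst q\<bar> \<le> d (n + N) \<and> \<bar>fst (snd q)\<bar> \<le> d (n + N) \<and> \<bar>fst (snd (snd q))\<bar> \<le> d (n + N)
      \<and> \<bar>snd (snd (snd q))\<bar> \<le> d (n + N)" for n q
  have "\<exists>q. P n q" for n
    using N[of "n + N"] by (auto simp: P_def)
  then obtain q where q: "\<And>n. P n (q n)" by metis
  have dN: "(\<lambda>n. d (n + N)) \<longlonglongrightarrow> 0" by (rule LIMSEQ_ignore_initial_segment[OF d0])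
  have lim0: "w \<longlonglongrightarrow> 0" if "\<And>n. \<bar>w n\<bar> \<le> d (n + N)" for w :: "nat \<Rightarrow> real"
    by (rule tendsto_0_le[OF dN, of _ 1]) (use that dpos in \<open>auto simp: less_imp_le\<close>)
  have limA: "(\<lambda>n. A a b (x + s n *\<^sub>R u + t n *\<^sub>R v)) \<longlonglongrightarrow> A a b x"
    if "\<And>n. \<bar>s n\<bar> \<le> d (n + N)" "\<And>n. \<bar>t n\<bar> \<le> d (n + N)" for a b s t
  proof -
    have "(\<lambda>n. x + s n *\<^sub>R u + t n *\<^sub>R v) \<longlonglongrightarrow> x + 0 *\<^sub>R u + 0 *\<^sub>R v"
      by (intro tendsto_intros lim0 that)
    then show ?thesis using isCont_tendsto_compose[OF contA] by simp
  qed
  have "(\<lambda>n. A u v (x + fst (q n) *\<^sub>R u + fst (snd (q n)) *\<^sub>R v)) \<longlonglongrightarrow> A u v x"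
    by (rule limA) (use q in \<open>auto simp: P_def\<close>)
  moreover have "(\<lambda>n. A v u (x + fst (snd (snd (q n))) *\<^sub>R u + snd (snd (snd (q n))) *\<^sub>R v)) \<longlonglongrightarrow> A v u x"
    by (rule limA) (use q in \<open>auto simp: P_def\<close>)
  moreover have "A u v (x + fst (q n) *\<^sub>R u + fst (snd (q n)) *\<^sub>R v) =
      A v u (x + fst (snd (snd (q n))) *\<^sub>R u + snd (snd (snd (q n))) *\<^sub>R v)" for n
    using q[of n] by (simp add: P_def)
  ultimately have "A u v x = A v u x" using LIMSEQ_unique by auto
  then show ?thesis by (simp add: A_def)
qed

lemma frechet_derivative_vec_nth:
  fixes f :: "'a::real_normed_vector \<Rightarrow> real ^ 'n"
  assumes "f differentiable (at x)"
  shows "frechet_derivative (\<lambda>y. f y $ i) (at x) v = frechet_derivative f (at x) v $ i"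
proof -
  have "((\<lambda>y. f y $ i) has_derivative (\<lambda>v. frechet_derivative f (at x) v $ i)) (at x)"
    using bounded_linear.has_derivative[OF bounded_linear_vec_nth] assms frechet_derivative_works by blast
  from fun_cong[OF frechet_derivative_at[OF this], of v] show ?thesis by simp
qed

lemma frechet_derivative_swap:
  fixes h :: "'v::real_normed_vector \<Rightarrow> real ^ 'n"
  assumes S: "open S" and h: "smooth_on S h" and x: "x \<in> S"
  shows "frechet_derivative (\<lambda>y. frechet_derivative h (at y) u) (at x) v =
    frechet_derivative (\<lambda>y. frechet_derivative h (at y) v) (at x) u"
proof -
  have *: "frechet_derivative (\<lambda>y. frechet_derivative h (at y) u) (at x) v $ i =
      frechet_derivative (\<lambda>y. frechet_derivative (\<lambda>y. h y $ i) (at y) u) (at x) v" for u v i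
  proof -
    have "frechet_derivative (\<lambda>y. frechet_derivative h (at y) u) (at x) v $ i =
        frechet_derivative (\<lambda>y. frechet_derivative h (at y) u $ i) (at x) v"
      using smooth_on_differentiable[OF smooth_on_frechet_derivative[OF h] x]
      by (simp add: frechet_derivative_vec_nth)
    also have "frechet_derivative (\<lambda>y. frechet_derivative h (at y) u $ i) (at x) =
        frechet_derivative (\<lambda>y. frechet_derivative (\<lambda>y. h y $ i) (at y) u) (at x)"
      by (rule frechet_derivative_cong_open[OF S x])
        (simp add: frechet_derivative_vec_nth smooth_on_differentiable[OF h])
    finally show ?thesis .
  qed
  show ?thesis
    unfolding vec_eq_iff *
    using frechet_derivative_swap_real[OF S smooth_on_vec_nth[OF S h] x] by blast
qed

section \<open>Smooth functions of one variable\<close>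

lemma frechet_derivative_eq_deriv:
  fixes f :: "real \<Rightarrow> real"
  assumes "f differentiable (at x)"
  shows "frechet_derivative f (at x) v = v * deriv f x"
  using assms by (metis DERIV_deriv_iff_real_differentiable frechet_derivative_at
      has_field_derivative_def mult.commute)

lemma smooth_on_deriv:
  fixes f :: "real \<Rightarrow> real"
  assumes "open S" "smooth_on S f"
  shows "smooth_on S (deriv f)"
  using smooth_on_cong[OF assms(1), of "deriv f" "\<lambda>x. frechet_derivative f (at x) 1"]
    smooth_on_frechet_derivative[OF assms(2), of 1] smooth_on_differentiable[OF assms(2)]
  by (simp add: frechet_derivative_eq_deriv)

lemma smooth_on_has_deriv:
  fixes f :: "real \<Rightarrow> real"
  assumes "smooth_on S f" "x \<in> S"
  shows "(f has_real_derivative deriv f x) (at x)"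
  using smooth_on_differentiable[OF assms] DERIV_deriv_iff_real_differentiable by blast

lemma smooth_on_higher_deriv:
  fixes f :: "real \<Rightarrow> real"
  assumes "open S" "smooth_on S f"
  shows "smooth_on S ((deriv ^^ n) f)"
  by (induction n) (auto intro: smooth_on_deriv assms)

text \<open>A family closed under differentiation is smooth: the induction on the order runs over
  all members at once, so passing to the derivative merely changes the index.\<close>

lemma smooth_onI_sequence:
  fixes F :: "'i \<Rightarrow> real \<Rightarrow> real"
  assumes "open S" "\<And>i x. x \<in> S \<Longrightarrow> (F i has_real_derivative F (D i) x) (at x)"
  shows "smooth_on S (F i)"
  unfolding smooth_on_def
proof
  fix k show "Ck_on k S (F i)"
  proof (induction k arbitrary: i)
    case 0
    then show ?case
      using DERIV_isCont[OF assms(2)] by (simp add: continuous_at_imp_continuous_on)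
  next
    case (Suc k)
    have d: "F i differentiable (at x)" "frechet_derivative (F i) (at x) v = v * F (D i) x"
      if "x \<in> S" for x v
    proof -
      note D = assms(2)[OF that, of i]
      show diff: "F i differentiable (at x)" using D real_differentiable_def by blast
      show "frechet_derivative (F i) (at x) v = v * F (D i) x"
        by (simp add: frechet_derivative_eq_deriv[OF diff] DERIV_imp_deriv[OF D])
    qed
    have "Ck_on k S (\<lambda>x. v * F (D i) x)" for v
      by (rule Ck_on_bilinear[OF assms(1) bounded_bilinear_mult Ck_on_const Suc])
    moreover have "Ck_on k S (\<lambda>x. frechet_derivative (F i) (at x) v) \<longleftrightarrow> Ck_on k S (\<lambda>x. v * F (D i) x)" for v
      by (rule Ck_on_cong[OF assms(1)]) (rule d)
    ultimately have "Ck_on k S (\<lambda>x. frechet_derivative (F i) (at x) v)" for v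
      by blast
    then show ?case using d by auto
  qed
qed

text \<open>The functions p(1/x) exp(-1/x), extended by 0. Admitting a polynomial factor makes the
  classical flat function part of a family closed under differentiation.\<close>

definition flat_exp :: "real poly \<Rightarrow> real \<Rightarrow> real" where
  "flat_exp p x = (if x \<le> 0 then 0 else poly p (inverse x) * exp (- inverse x))"

text \<open>With y = 1/x, differentiating p(y) exp(-y) in x gives y^2 (p(y) - p'(y)) exp(-y), and
  \<open>[:0, 0, 1:]\<close> is the factor y^2. At the origin the exponential beats every
  polynomial.\<close>

lemma flat_exp_derivative:
  "(flat_exp p has_real_derivative flat_exp ([:0, 0, 1:] * (p - pderiv p)) x) (at x)"
proof -
  consider "x < 0" | "x > 0" | "x = 0" by linarith
  then show ?thesis
  proof cases
    case 1
    have "((\<lambda>x. 0) has_real_derivative flat_exp ([:0, 0, 1:] * (p - pderiv p)) x) (at x)"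
      using 1 by (simp add: flat_exp_def)
    then show ?thesis
      by (rule has_field_derivative_transform_within_open[of _ _ _ "{..<0}"])
        (use 1 in \<open>auto simp: flat_exp_def\<close>)
  next
    case 2
    have "((\<lambda>x. poly p (inverse x) * exp (- inverse x)) has_real_derivative
        flat_exp ([:0, 0, 1:] * (p - pderiv p)) x) (at x)"
    proof -
      have i: "(inverse has_real_derivative - (inverse x * inverse x)) (at x)"
        using DERIV_inverse[of x UNIV] 2 by (simp add: power2_eq_square)
      have "((\<lambda>x. poly p (inverse x) * exp (- inverse x)) has_real_derivative
          (poly (pderiv p) (inverse x) * - (inverse x * inverse x)) * exp (- inverse x) +
          (exp (- inverse x) * (inverse x * inverse x)) * poly p (inverse x)) (at x)"
        using DERIV_mult[OF DERIV_chain2[OF poly_DERIV i] DERIV_chain2[OF DERIV_exp DERIV_minus[OF i]], of p] by (simp only: minus_minus)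
      then show ?thesis
        using 2 by (simp add: flat_exp_def algebra_simps)
    qed
    then show ?thesis
      by (rule has_field_derivative_transform_within_open[of _ _ _ "{0<..}"])
        (use 2 in \<open>auto simp: flat_exp_def\<close>)
  next
    case 3
    have lim: "((\<lambda>y. poly q y / exp y) \<longlongrightarrow> 0) at_top" for q :: "real poly"
    proof -
      have "((\<lambda>y. \<Sum>i\<le>degree q. coeff q i * (y ^ i / exp y)) \<longlongrightarrow> (\<Sum>i\<le>degree q. coeff q i * 0)) at_top"
        by (intro tendsto_sum tendsto_mult tendsto_const tendsto_power_div_exp_0)
      then show ?thesis by (simp add: poly_altdef sum_divide_distrib)
    qed
    have "((\<lambda>h. flat_exp p h / h) \<longlongrightarrow> 0) (at_right 0)"
    proof -
      \<comment> \<open>\<open>pCons 0 p\<close> multiplies by the variable 1/h, which is the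
        denominator of the difference quotient.\<close>
      have "((\<lambda>h. poly (pCons 0 p) (inverse h) / exp (inverse h)) \<longlongrightarrow> 0) (at_right 0)"
        using filterlim_compose[OF lim filterlim_inverse_at_top_right] .
      moreover have "eventually (\<lambda>h. poly (pCons 0 p) (inverse h) / exp (inverse h) = flat_exp p h / h) (at_right 0)"
        using eventually_at_right_less[of 0] by eventually_elim
          (simp add: flat_exp_def exp_minus divide_inverse)
      ultimately show ?thesis by (rule Lim_transform_eventually)
    qed
    moreover have "((\<lambda>h. flat_exp p h / h) \<longlongrightarrow> 0) (at_left 0)"
    proof -
      have "eventually (\<lambda>h. 0 = flat_exp p h / h) (at_left (0::real))"
        unfolding eventually_at_filter by (rule always_eventually) (auto simp: flat_exp_def)
      then show ?thesis by (rule Lim_transform_eventually[OF tendsto_const])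
    qed
    ultimately have "((\<lambda>h. flat_exp p h / h) \<longlongrightarrow> 0) (at 0)"
      by (intro filterlim_split_at)
    then show ?thesis
      unfolding 3 DERIV_def by (simp add: flat_exp_def)
  qed
qed

lemma smooth_flat_exp: "smooth_on UNIV (flat_exp p)"
  by (rule smooth_onI_sequence[where F = flat_exp and D = "\<lambda>p. [:0, 0, 1:] * (p - pderiv p)"])
    (rule open_UNIV, rule flat_exp_derivative)

text \<open>The product of exp(-1/(x-a)) and exp(-1/(b-x)), each continued by 0 on its far
  side.\<close>

lemma smooth_bump_exists:
  fixes a b :: real
  assumes "a < b"
  obtains u :: "real \<Rightarrow> real" where "smooth_on UNIV u" "\<And>x. 0 \<le> u x" "\<And>x. x \<in> {a<..<b} \<Longrightarrow> 0 < u x"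
    "\<And>x. x \<notin> {a<..<b} \<Longrightarrow> u x = 0"
proof
  let ?u = "\<lambda>x. flat_exp 1 (x - a) * flat_exp 1 (b - x)"
  show "smooth_on UNIV ?u"
  proof (rule smooth_on_mult[OF open_UNIV])
    have id: "smooth_on UNIV (\<lambda>x::real. x)"
      by (rule smooth_on_bounded_linear[OF bounded_linear_ident])
    show "smooth_on UNIV (\<lambda>x. flat_exp 1 (x - a))"
      by (rule smooth_on_compose[OF open_UNIV open_UNIV smooth_flat_exp])
        (rule smooth_on_diff[OF open_UNIV id smooth_on_const], simp)
    show "smooth_on UNIV (\<lambda>x. flat_exp 1 (b - x))"
      by (rule smooth_on_compose[OF open_UNIV open_UNIV smooth_flat_exp])
        (rule smooth_on_diff[OF open_UNIV smooth_on_const id], simp)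
  qed
qed (auto simp: flat_exp_def)

section \<open>Families of bilinear maps\<close>

lemma vec_basis_sum: "(v :: real ^ 'n::finite) = (\<Sum>i\<in>UNIV. v $ i *\<^sub>R axis i 1)"
  by (auto simp: vec_eq_iff axis_def if_distrib cong: if_cong)

lemma bounded_bilinear_axis_sum:
  fixes B :: "real ^ 'n::finite \<Rightarrow> real ^ 'm::finite \<Rightarrow> 'c::real_normed_vector"
  assumes "bounded_bilinear B"
  shows "B u v = (\<Sum>i\<in>UNIV. \<Sum>j\<in>UNIV. (u $ i * v $ j) *\<^sub>R B (axis i 1) (axis j 1))"
proof -
  interpret bounded_bilinear B by fact
  have "B u v = B (\<Sum>i\<in>UNIV. u $ i *\<^sub>R axis i 1) (\<Sum>j\<in>UNIV. v $ j *\<^sub>R axis j 1)"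
    using vec_basis_sum by metis
  then have "B u v = (\<Sum>j\<in>UNIV. \<Sum>i\<in>UNIV. (v $ j * u $ i) *\<^sub>R B (axis i 1) (axis j 1))"
    by (simp add: sum_left sum_right scaleR_left scaleR_right scaleR_sum_right)
  then show ?thesis by (subst sum.swap) (simp add: mult.commute)
qed

text \<open>Made for the metric and the Christoffel symbols, which are bilinear with a moving base
  point. Expansion in axis vectors reduces smoothness in all three arguments to smoothness in the
  base point for fixed vectors.\<close>

lemma smooth_on_bilinear_family:
  fixes B :: "'b::euclidean_space \<Rightarrow> real ^ 'n::finite \<Rightarrow> real ^ 'm::finite \<Rightarrow> 'c::real_normed_vector"
  assumes B: "\<And>y. bounded_bilinear (B y)" and U: "open U" "\<And>a b. smooth_on U (\<lambda>y. B y a b)"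
    and S: "open S" "smooth_on S X" "\<And>p. p \<in> S \<Longrightarrow> X p \<in> U" "smooth_on S u" "smooth_on S v"
  shows "smooth_on S (\<lambda>p. B (X p) (u p) (v p))"
  unfolding bounded_bilinear_axis_sum[OF B, of _ "u _" "v _"]
  by (intro smooth_on_sum[OF S(1)] smooth_on_scaleR[OF S(1)] smooth_on_mult[OF S(1)]
      smooth_on_vec_nth[OF S(1)] S(4,5)) (rule smooth_on_compose[OF S(1) U(1) U(2) S(2,3)])

text \<open>The product rule in three arguments. The first summand differentiates the base point
  with the two vectors frozen, and is what the abbreviations \<open>dg\<close> and
  \<open>d\<Gamma>\<close> below denote.\<close>

lemma frechet_derivative_bilinear_family:
  fixes B :: "'b::real_normed_vector \<Rightarrow> real ^ 'n::finite \<Rightarrow> real ^ 'm::finite \<Rightarrow> 'c::real_normed_vector"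
    and p :: "'p::real_normed_vector"
  assumes B: "\<And>y. bounded_bilinear (B y)" and d: "\<And>a b. (\<lambda>y. B y a b) differentiable (at (X p))"
    and X: "X differentiable (at p)" and u: "u differentiable (at p)" and v: "v differentiable (at p)"
  shows "(\<lambda>p. B (X p) (u p) (v p)) differentiable (at p)" (is ?dif)
    and "frechet_derivative (\<lambda>p. B (X p) (u p) (v p)) (at p) e =
      frechet_derivative (\<lambda>y. B y (u p) (v p)) (at (X p)) (frechet_derivative X (at p) e)
      + B (X p) (frechet_derivative u (at p) e) (v p) + B (X p) (u p) (frechet_derivative v (at p) e)" (is ?der)
proof -
  define b where "b i j y = B y (axis i 1) (axis j 1)" for i j y
  define D where "D i j = frechet_derivative (b i j) (at (X p))" for i j
  have bd: "(b i j has_derivative D i j) (at (X p))" for i j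
    using d unfolding b_def D_def by (simp add: frechet_derivative_works)
  have bX: "((\<lambda>p. b i j (X p)) has_derivative (\<lambda>e. D i j (frechet_derivative X (at p) e))) (at p)" for i j
    using has_derivative_compose[OF X[unfolded frechet_derivative_works] bd] .
  have un: "((\<lambda>p. u p $ i) has_derivative (\<lambda>e. frechet_derivative u (at p) e $ i)) (at p)" for i
    using bounded_linear.has_derivative[OF bounded_linear_vec_nth] u frechet_derivative_works by blast
  have vn: "((\<lambda>p. v p $ i) has_derivative (\<lambda>e. frechet_derivative v (at p) e $ i)) (at p)" for i
    using bounded_linear.has_derivative[OF bounded_linear_vec_nth] v frechet_derivative_works by blast
  have eqB: "(\<lambda>p. B (X p) (u p) (v p)) = (\<lambda>p. \<Sum>i\<in>UNIV. \<Sum>j\<in>UNIV. (u p $ i * v p $ j) *\<^sub>R b i j (X p))"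
    unfolding b_def by (rule ext) (rule bounded_bilinear_axis_sum[OF B])
  have main: "((\<lambda>p. \<Sum>i\<in>UNIV. \<Sum>j\<in>UNIV. (u p $ i * v p $ j) *\<^sub>R b i j (X p)) has_derivative
      (\<lambda>e. \<Sum>i\<in>UNIV. \<Sum>j\<in>UNIV. (u p $ i * v p $ j) *\<^sub>R D i j (frechet_derivative X (at p) e) +
        (u p $ i * frechet_derivative v (at p) e $ j + frechet_derivative u (at p) e $ i * v p $ j) *\<^sub>R b i j (X p))) (at p)"
    by (intro has_derivative_sum has_derivative_scaleR has_derivative_mult un vn bX)
  then show ?dif unfolding eqB by (auto simp: differentiable_def)
  have "((\<lambda>y. \<Sum>i\<in>UNIV. \<Sum>j\<in>UNIV. (u p $ i * v p $ j) *\<^sub>R b i j y) has_derivative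
      (\<lambda>e. \<Sum>i\<in>UNIV. \<Sum>j\<in>UNIV. (u p $ i * v p $ j) *\<^sub>R D i j e)) (at (X p))"
    by (intro has_derivative_sum has_derivative_scaleR_right bd)
  moreover have "(\<lambda>y. \<Sum>i\<in>UNIV. \<Sum>j\<in>UNIV. (u p $ i * v p $ j) *\<^sub>R b i j y) = (\<lambda>y. B y (u p) (v p))"
    unfolding b_def by (rule ext) (rule bounded_bilinear_axis_sum[OF B, symmetric])
  ultimately have 1: "frechet_derivative (\<lambda>y. B y (u p) (v p)) (at (X p)) w =
      (\<Sum>i\<in>UNIV. \<Sum>j\<in>UNIV. (u p $ i * v p $ j) *\<^sub>R D i j w)" for w
    using frechet_derivative_at[symmetric] by fastforce
  have 2: "frechet_derivative (\<lambda>p. B (X p) (u p) (v p)) (at p) e = (\<Sum>i\<in>UNIV. \<Sum>j\<in>UNIV. (u p $ i * v p $ j) *\<^sub>R D i j (frechet_derivative X (at p) e) +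
        (u p $ i * frechet_derivative v (at p) e $ j + frechet_derivative u (at p) e $ i * v p $ j) *\<^sub>R b i j (X p))"
    unfolding eqB using fun_cong[OF frechet_derivative_at[OF main], of e] by simp
  show ?der
    unfolding 1 2 bounded_bilinear_axis_sum[OF B, of "X p"] b_def[symmetric]
    by (simp add: sum.distrib scaleR_add_left algebra_simps)
qed

section \<open>Riemannian geometry in coordinates: connection, curvature, change of charts\<close>

section \<open>The Levi-Civita connection in a chart\<close>

lemma matrix_inv_mult:
  fixes A :: "real ^ 'n ^ 'n"
  assumes "invertible A"
  shows "A ** matrix_inv A = mat 1"
proof -
  have "\<exists>A'. A ** A' = mat 1 \<and> A' ** A = mat 1" using assms by (simp add: invertible_def)
  from someI_ex[OF this] show ?thesis by (simp add: matrix_inv_def)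
qed

text \<open>Cramer's rule. It exhibits the entries of the inverse metric as rational in those of the
  metric, hence as smooth functions of the point.\<close>

lemma matrix_inv_component:
  fixes A :: "real ^ 'n ^ 'n"
  assumes "invertible A"
  shows "matrix_inv A $ k $ l = det (\<chi> i j. if j = k then axis l 1 $ i else A $ i $ j) * inverse (det A)"
proof -
  have "det A \<noteq> 0" using assms by (simp add: invertible_det_nz)
  moreover have "A *v (matrix_inv A *v axis l 1) = axis l 1"
    using matrix_inv_mult[OF assms] by (simp add: matrix_vector_mul_assoc)
  ultimately have "(matrix_inv A *v axis l 1) = (\<chi> k. det (\<chi> i j. if j = k then axis l 1 $ i else A $ i $ j) / det A)"
    using cramer by blast
  moreover have "(matrix_inv A *v axis l 1) $ k = matrix_inv A $ k $ l"
    by (simp add: matrix_vector_mult_basis column_def)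
  ultimately show ?thesis by (simp add: divide_inverse)
qed

lemma smooth_on_det:
  fixes A :: "'a::real_normed_vector \<Rightarrow> real ^ 'n ^ 'n"
  assumes "open S" "\<And>i j. smooth_on S (\<lambda>x. A x $ i $ j)"
  shows "smooth_on S (\<lambda>x. det (A x))"
  unfolding det_def
  by (rule smooth_on_sum[OF assms(1)], rule smooth_on_mult[OF assms(1) smooth_on_const],
      rule smooth_on_prod[OF assms(1)], rule assms(2))

lemma bounded_bilinear_metric_inner: "bounded_bilinear (metric_inner M c x)"
  unfolding metric_inner_def bilinear_conv_bounded_bilinear[symmetric] bilinear_def
  by (auto intro!: linearI simp: inner_add_left inner_add_right matrix_vector_right_distrib
      matrix_vector_mult_scaleR)

text \<open>Bundling the symbols into a bilinear map lets the identities of the connection be stated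
  and used without index sums.\<close>

definition christoffel_map ::
    "('a, 'n::finite) riemannian_structure \<Rightarrow> ('a, 'n) chart \<Rightarrow> real ^ 'n \<Rightarrow> real ^ 'n \<Rightarrow> real ^ 'n \<Rightarrow> real ^ 'n"
  where "christoffel_map M c x u v =
    (\<chi> k. \<Sum>i\<in>UNIV. \<Sum>j\<in>UNIV. christoffel M c k i j x * u $ i * v $ j)"

lemma bounded_bilinear_christoffel_map: "bounded_bilinear (christoffel_map M c x)"
  unfolding bilinear_conv_bounded_bilinear[symmetric] bilinear_def christoffel_map_def
  by (auto intro!: linearI simp: vec_eq_iff algebra_simps sum.distrib sum_distrib_left)

locale riemannian_chart =
  fixes M :: "('a, 'n::finite) riemannian_structure" and c :: "('a, 'n) chart"
  assumes manifold: "riemannian_manifold M" and chart: "c \<in> atlas M"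
begin

abbreviation U where "U \<equiv> coord c ` cdom c"
abbreviation g where "g \<equiv> metric_inner M c"
abbreviation \<Gamma> where "\<Gamma> \<equiv> christoffel_map M c"

text \<open>Here and in \<open>d\<Gamma>\<close> the first vector is the direction of
  differentiation; the other two are held constant in coordinates.\<close>

abbreviation dg where "dg x u v w \<equiv> frechet_derivative (\<lambda>y. g y v w) (at x) u"
abbreviation d\<Gamma> where "d\<Gamma> x u v w \<equiv> frechet_derivative (\<lambda>y. \<Gamma> y v w) (at x) u"

lemmas g_simps =
  bounded_bilinear.add_left[OF bounded_bilinear_metric_inner]
  bounded_bilinear.add_right[OF bounded_bilinear_metric_inner]
  bounded_bilinear.diff_left[OF bounded_bilinear_metric_inner]
  bounded_bilinear.diff_right[OF bounded_bilinear_metric_inner]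
  bounded_bilinear.minus_left[OF bounded_bilinear_metric_inner]
  bounded_bilinear.minus_right[OF bounded_bilinear_metric_inner]
  bounded_bilinear.scaleR_left[OF bounded_bilinear_metric_inner]
  bounded_bilinear.scaleR_right[OF bounded_bilinear_metric_inner]
  bounded_bilinear.zero_left[OF bounded_bilinear_metric_inner]
  bounded_bilinear.zero_right[OF bounded_bilinear_metric_inner]

lemmas \<Gamma>_simps =
  bounded_bilinear.add_left[OF bounded_bilinear_christoffel_map]
  bounded_bilinear.add_right[OF bounded_bilinear_christoffel_map]
  bounded_bilinear.minus_left[OF bounded_bilinear_christoffel_map]
  bounded_bilinear.minus_right[OF bounded_bilinear_christoffel_map]
  bounded_bilinear.diff_right[OF bounded_bilinear_christoffel_map]
  bounded_bilinear.scaleR_left[OF bounded_bilinear_christoffel_map]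
  bounded_bilinear.scaleR_right[OF bounded_bilinear_christoffel_map]
  bounded_bilinear.zero_left[OF bounded_bilinear_christoffel_map]
  bounded_bilinear.zero_right[OF bounded_bilinear_christoffel_map]

lemma open_U: "open U"
  using manifold chart by (auto simp: riemannian_manifold_def smooth_manifold_def is_chart_def)

lemma g_sym: "x \<in> U \<Longrightarrow> g x v w = g x w v"
  using manifold chart unfolding riemannian_manifold_def by blast

lemma g_pos: "x \<in> U \<Longrightarrow> v \<noteq> 0 \<Longrightarrow> 0 < g x v v"
  using manifold chart unfolding riemannian_manifold_def by blast

lemma g_nondegenerate:
  assumes "x \<in> U" "\<And>w. g x v w = g x v' w"
  shows "v = v'"
proof (rule ccontr)
  assume "v \<noteq> v'"
  then have "0 < g x (v - v') (v - v')" using g_pos[OF assms(1)] by simp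
  then show False using assms(2)[of "v - v'"] by (simp add: g_simps)
qed

lemma smooth_metric: "smooth_on U (metric M c)"
  using manifold chart unfolding riemannian_manifold_def by blast

lemma smooth_metric_component: "smooth_on U (\<lambda>x. metric M c x $ i $ j)"
  by (intro smooth_on_vec_nth open_U smooth_metric)

lemma invertible_metric: assumes "x \<in> U" shows "invertible (metric M c x)"
proof -
  have "\<forall>v. metric M c x *v v = 0 \<longrightarrow> v = 0"
    using g_pos[OF assms] unfolding metric_inner_def by (metis inner_zero_right less_irrefl)
  then show ?thesis
    by (simp add: invertible_left_inverse matrix_left_invertible_ker)
qed

lemma smooth_g:
  assumes "open S" "smooth_on S X" "\<And>p. p \<in> S \<Longrightarrow> X p \<in> U" "smooth_on S u" "smooth_on S v"
  shows "smooth_on S (\<lambda>p. g (X p) (u p) (v p))"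
proof (rule smooth_on_bilinear_family[OF bounded_bilinear_metric_inner open_U _ assms])
  fix a b :: "real ^ 'n"
  show "smooth_on U (\<lambda>y. g y a b)"
    unfolding metric_inner_def inner_vec_def matrix_vector_mult_def inner_real_def vec_lambda_beta
    by (intro smooth_on_sum[OF open_U] smooth_on_mult[OF open_U] smooth_on_const
        smooth_metric_component)
qed

lemma g_differentiable: "x \<in> U \<Longrightarrow> (\<lambda>y. g y v w) differentiable (at x)"
  by (rule smooth_on_differentiable[OF smooth_g[OF open_U smooth_on_bounded_linear[OF bounded_linear_ident]
    _ smooth_on_const smooth_on_const]]) auto

lemma smooth_christoffel: "smooth_on U (christoffel M c k i j)"
proof -
  have inv: "smooth_on U (\<lambda>x. matrix_inv (metric M c x) $ k $ l)" for k l
  proof -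
    have "smooth_on U (\<lambda>x. det (\<chi> i j. if j = k then axis l 1 $ i else metric M c x $ i $ j) * inverse (det (metric M c x)))"
    proof (intro smooth_on_mult[OF open_U] smooth_on_inverse[OF open_U] smooth_on_det[OF open_U])
      show "smooth_on U (\<lambda>x. (\<chi> i j. if j = k then axis l 1 $ i else metric M c x $ i $ j) $ i $ j)" for i j
        by (cases "j = k") (simp_all add: smooth_on_const smooth_metric_component)
    qed (use invertible_metric in \<open>auto simp: invertible_det_nz smooth_metric_component\<close>)
    then show ?thesis
      using smooth_on_cong[OF open_U, of "\<lambda>x. matrix_inv (metric M c x) $ k $ l"
        "\<lambda>x. det (\<chi> i j. if j = k then axis l 1 $ i else metric M c x $ i $ j) * inverse (det (metric M c x))"]
        matrix_inv_component[OF invertible_metric] by simp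
  qed
  have pd: "smooth_on U (pdiff i (\<lambda>y. metric M c y $ j $ l))" for i j l
    unfolding pdiff_def by (rule smooth_on_frechet_derivative[OF smooth_metric_component])
  show ?thesis
    unfolding christoffel_def[abs_def] divide_inverse
    by (intro smooth_on_mult[OF open_U] smooth_on_sum[OF open_U] smooth_on_diff[OF open_U]
        smooth_on_add[OF open_U] inv pd smooth_on_const)
qed

lemma smooth_\<Gamma>:
  assumes "open S" "smooth_on S X" "\<And>p. p \<in> S \<Longrightarrow> X p \<in> U" "smooth_on S u" "smooth_on S v"
  shows "smooth_on S (\<lambda>p. \<Gamma> (X p) (u p) (v p))"
proof (rule smooth_on_bilinear_family[OF bounded_bilinear_christoffel_map open_U _ assms])
  fix a b :: "real ^ 'n"
  show "smooth_on U (\<lambda>y. \<Gamma> y a b)"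
    unfolding christoffel_map_def
    by (intro smooth_on_vec_lambda[OF open_U] smooth_on_sum[OF open_U] smooth_on_mult[OF open_U]
        smooth_christoffel smooth_on_const)
qed

lemma \<Gamma>_differentiable: "x \<in> U \<Longrightarrow> (\<lambda>y. \<Gamma> y v w) differentiable (at x)"
  by (rule smooth_on_differentiable[OF smooth_\<Gamma>[OF open_U smooth_on_bounded_linear[OF bounded_linear_ident]
    _ smooth_on_const smooth_on_const]]) auto

lemma g_axis: "g x (axis i 1) (axis j 1) = metric M c x $ i $ j"
  by (simp add: metric_inner_def matrix_vector_mult_basis column_def inner_axis' )

lemma dg_expand:
  assumes "x \<in> U"
  shows "dg x u v w = (\<Sum>a\<in>UNIV. \<Sum>i\<in>UNIV. \<Sum>j\<in>UNIV. u $ a * v $ i * w $ j * pdiff a (\<lambda>y. metric M c y $ i $ j) x)"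
proof -
  have comp: "((\<lambda>y. metric M c y $ i $ j) has_derivative
      (\<lambda>u. \<Sum>a\<in>UNIV. u $ a * pdiff a (\<lambda>y. metric M c y $ i $ j) x)) (at x)" for i j
  proof -
    have d: "(\<lambda>y. metric M c y $ i $ j) differentiable (at x)"
      by (rule smooth_on_differentiable[OF smooth_metric_component assms])
    then have "linear (frechet_derivative (\<lambda>y. metric M c y $ i $ j) (at x))"
      by (rule linear_frechet_derivative)
    then have "frechet_derivative (\<lambda>y. metric M c y $ i $ j) (at x) u =
      (\<Sum>a\<in>UNIV. u $ a * pdiff a (\<lambda>y. metric M c y $ i $ j) x)" for u
      unfolding pdiff_def by (subst vec_basis_sum[of u]) (simp add: linear_sum linear_scale)
    then have "frechet_derivative (\<lambda>y. metric M c y $ i $ j) (at x) =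
      (\<lambda>u. \<Sum>a\<in>UNIV. u $ a * pdiff a (\<lambda>y. metric M c y $ i $ j) x)" by blast
    then show ?thesis using d by (simp add: frechet_derivative_works)
  qed
  have eq: "(\<lambda>y. g y v w) = (\<lambda>y. \<Sum>i\<in>UNIV. \<Sum>j\<in>UNIV. v $ i * w $ j * metric M c y $ i $ j)"
    using bounded_bilinear_axis_sum[OF bounded_bilinear_metric_inner, of M c _ v w] by (simp add: g_axis)
  have "((\<lambda>y. \<Sum>i\<in>UNIV. \<Sum>j\<in>UNIV. v $ i * w $ j * metric M c y $ i $ j) has_derivative
     (\<lambda>u. \<Sum>i\<in>UNIV. \<Sum>j\<in>UNIV. v $ i * w $ j * (\<Sum>a\<in>UNIV. u $ a * pdiff a (\<lambda>y. metric M c y $ i $ j) x))) (at x)"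
    by (intro has_derivative_sum has_derivative_mult_right comp)
  from fun_cong[OF frechet_derivative_at[OF this], of u]
  have "dg x u v w = (\<Sum>i\<in>UNIV. \<Sum>j\<in>UNIV. \<Sum>a\<in>UNIV. u $ a * v $ i * w $ j * pdiff a (\<lambda>y. metric M c y $ i $ j) x)"
    unfolding eq by (simp add: sum_distrib_left mult_ac)
  also have "\<dots> = (\<Sum>i\<in>UNIV. \<Sum>a\<in>UNIV. \<Sum>j\<in>UNIV. u $ a * v $ i * w $ j * pdiff a (\<lambda>y. metric M c y $ i $ j) x)"
    by (rule sum.cong[OF refl sum.swap])
  also have "\<dots> = (\<Sum>a\<in>UNIV. \<Sum>i\<in>UNIV. \<Sum>j\<in>UNIV. u $ a * v $ i * w $ j * pdiff a (\<lambda>y. metric M c y $ i $ j) x)"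
    by (rule sum.swap)
  finally show ?thesis .
qed

text \<open>Contracting with the metric cancels the inverse matrix in the Christoffel symbols. This
  is the Koszul formula for fields with constant coordinates, whose brackets vanish. Symmetry,
  metric compatibility and the transformation law of \<open>\<Gamma>\<close> are all read off from
  it.\<close>

lemma koszul:
  assumes x: "x \<in> U"
  shows "g x (\<Gamma> x u v) w = (dg x u v w + dg x v u w - dg x w u v) / 2"
proof -
  define P where "P i j l = pdiff i (\<lambda>y. metric M c y $ j $ l) x" for i j l
  \<comment> \<open>The Christoffel symbols of the first kind, contracted with \<open>u\<close> and
    \<open>v\<close>.\<close>
  define q :: "real ^ 'n" where "q = (\<chi> l. (\<Sum>i\<in>UNIV. \<Sum>j\<in>UNIV. (P i j l + P j i l - P l i j) * u $ i * v $ j) / 2)"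
  have "\<Gamma> x u v $ k = (matrix_inv (metric M c x) *v q) $ k" for k
  proof -
    have "\<Gamma> x u v $ k = (\<Sum>i\<in>UNIV. \<Sum>j\<in>UNIV. \<Sum>l\<in>UNIV. matrix_inv (metric M c x) $ k $ l * ((P i j l + P j i l - P l i j) * u $ i * v $ j / 2))"
      by (simp add: christoffel_map_def christoffel_def P_def sum_distrib_left sum_distrib_right
          sum_divide_distrib mult_ac)
    also have "\<dots> = (\<Sum>i\<in>UNIV. \<Sum>l\<in>UNIV. \<Sum>j\<in>UNIV. matrix_inv (metric M c x) $ k $ l * ((P i j l + P j i l - P l i j) * u $ i * v $ j / 2))"
      by (rule sum.cong[OF refl sum.swap])
    also have "\<dots> = (\<Sum>l\<in>UNIV. \<Sum>i\<in>UNIV. \<Sum>j\<in>UNIV. matrix_inv (metric M c x) $ k $ l * ((P i j l + P j i l - P l i j) * u $ i * v $ j / 2))"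
      by (rule sum.swap)
    also have "\<dots> = (matrix_inv (metric M c x) *v q) $ k"
      by (simp add: matrix_vector_mult_def q_def sum_distrib_left sum_divide_distrib mult_ac)
    finally show ?thesis .
  qed
  then have "\<Gamma> x u v = matrix_inv (metric M c x) *v q" by (simp add: vec_eq_iff)
  then have "metric M c x *v \<Gamma> x u v = q"
    using matrix_inv_mult[OF invertible_metric[OF x]] by (simp add: matrix_vector_mul_assoc)
  then have "g x (\<Gamma> x u v) w = w \<bullet> q" using g_sym[OF x] by (simp add: metric_inner_def)
  also have "\<dots> = (\<Sum>l\<in>UNIV. \<Sum>i\<in>UNIV. \<Sum>j\<in>UNIV. (P i j l * u $ i * v $ j * w $ l + P j i l * u $ i * v $ j * w $ l - P l i j * u $ i * v $ j * w $ l) / 2)"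
    by (simp add: q_def inner_vec_def sum_distrib_left sum_divide_distrib algebra_simps)
  also have "\<dots> = ((\<Sum>l\<in>UNIV. \<Sum>i\<in>UNIV. \<Sum>j\<in>UNIV. P i j l * u $ i * v $ j * w $ l)
      + (\<Sum>l\<in>UNIV. \<Sum>i\<in>UNIV. \<Sum>j\<in>UNIV. P j i l * u $ i * v $ j * w $ l)
      - (\<Sum>l\<in>UNIV. \<Sum>i\<in>UNIV. \<Sum>j\<in>UNIV. P l i j * u $ i * v $ j * w $ l)) / 2"
    by (simp add: sum_divide_distrib[symmetric] sum.distrib sum_subtractf)
  also have "(\<Sum>l\<in>UNIV. \<Sum>i\<in>UNIV. \<Sum>j\<in>UNIV. P i j l * u $ i * v $ j * w $ l) = dg x u v w"
  proof -
    have "(\<Sum>l\<in>UNIV. \<Sum>i\<in>UNIV. \<Sum>j\<in>UNIV. P i j l * u $ i * v $ j * w $ l) =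
        (\<Sum>i\<in>UNIV. \<Sum>l\<in>UNIV. \<Sum>j\<in>UNIV. P i j l * u $ i * v $ j * w $ l)" by (rule sum.swap)
    also have "\<dots> = (\<Sum>i\<in>UNIV. \<Sum>j\<in>UNIV. \<Sum>l\<in>UNIV. P i j l * u $ i * v $ j * w $ l)"
      by (rule sum.cong[OF refl sum.swap])
    finally show ?thesis unfolding dg_expand[OF x] P_def by (simp add: mult_ac)
  qed
  also have "(\<Sum>l\<in>UNIV. \<Sum>i\<in>UNIV. \<Sum>j\<in>UNIV. P j i l * u $ i * v $ j * w $ l) = dg x v u w"
  proof -
    have "(\<Sum>l\<in>UNIV. \<Sum>i\<in>UNIV. \<Sum>j\<in>UNIV. P j i l * u $ i * v $ j * w $ l) =
        (\<Sum>l\<in>UNIV. \<Sum>j\<in>UNIV. \<Sum>i\<in>UNIV. P j i l * u $ i * v $ j * w $ l)" by (rule sum.cong[OF refl sum.swap])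
    also have "\<dots> = (\<Sum>j\<in>UNIV. \<Sum>l\<in>UNIV. \<Sum>i\<in>UNIV. P j i l * u $ i * v $ j * w $ l)" by (rule sum.swap)
    also have "\<dots> = (\<Sum>j\<in>UNIV. \<Sum>i\<in>UNIV. \<Sum>l\<in>UNIV. P j i l * u $ i * v $ j * w $ l)"
      by (rule sum.cong[OF refl sum.swap])
    finally show ?thesis unfolding dg_expand[OF x] P_def by (simp add: mult_ac)
  qed
  also have "(\<Sum>l\<in>UNIV. \<Sum>i\<in>UNIV. \<Sum>j\<in>UNIV. P l i j * u $ i * v $ j * w $ l) = dg x w u v"
    unfolding dg_expand[OF x] P_def by (simp add: mult_ac)
  finally show ?thesis .
qed

lemma dg_sym: "x \<in> U \<Longrightarrow> dg x u v w = dg x u w v"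
  using fun_cong[OF frechet_derivative_cong_open[OF open_U, of x "\<lambda>y. g y v w" "\<lambda>y. g y w v"], of u] g_sym
  by simp

lemma \<Gamma>_sym: assumes "x \<in> U" shows "\<Gamma> x u v = \<Gamma> x v u"
  by (rule g_nondegenerate[OF assms]) (simp add: koszul[OF assms] dg_sym[OF assms, of u v])

lemma metric_compatible:
  assumes "x \<in> U" shows "dg x u v w = g x (\<Gamma> x u v) w + g x v (\<Gamma> x u w)"
  unfolding g_sym[OF assms, of v] koszul[OF assms]
  using dg_sym[OF assms, of v w u] dg_sym[OF assms, of u w v] dg_sym[OF assms, of u v w]
  by (simp add: field_simps)

text \<open>This index-free form is the one in which the commutator of two pullback derivatives
  produces the curvature.\<close>

lemma curvature_tensor_eq:
  assumes "x \<in> U"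
  shows "curvature_tensor M c x u v w =
    d\<Gamma> x u v w - d\<Gamma> x v u w + \<Gamma> x u (\<Gamma> x v w) - \<Gamma> x v (\<Gamma> x u w)"
proof -
  have d: "d\<Gamma> x u v w $ l = (\<Sum>i\<in>UNIV. \<Sum>j\<in>UNIV. \<Sum>k\<in>UNIV. pdiff i (christoffel M c l j k) x * u $ i * v $ j * w $ k)"
    for u v w l
  proof -
    have dc: "christoffel M c l j k differentiable (at x)" for j k
      by (rule smooth_on_differentiable[OF smooth_christoffel assms])
    have fd: "frechet_derivative (christoffel M c l j k) (at x) u =
        (\<Sum>i\<in>UNIV. u $ i * pdiff i (christoffel M c l j k) x)" for j k
      unfolding pdiff_def using linear_frechet_derivative[OF dc, of j k]
      by (subst vec_basis_sum[of u]) (simp add: linear_sum linear_scale)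
    have "((\<lambda>y. \<Sum>j\<in>UNIV. \<Sum>k\<in>UNIV. christoffel M c l j k y * v $ j * w $ k) has_derivative
        (\<lambda>u. \<Sum>j\<in>UNIV. \<Sum>k\<in>UNIV. frechet_derivative (christoffel M c l j k) (at x) u * v $ j * w $ k)) (at x)"
      by (intro has_derivative_sum has_derivative_mult_left dc[unfolded frechet_derivative_works])
    from fun_cong[OF frechet_derivative_at[OF this], of u]
    have "frechet_derivative (\<lambda>y. \<Gamma> y v w $ l) (at x) u =
        (\<Sum>j\<in>UNIV. \<Sum>k\<in>UNIV. \<Sum>i\<in>UNIV. pdiff i (christoffel M c l j k) x * u $ i * v $ j * w $ k)"
      by (simp add: christoffel_map_def fd sum_distrib_left sum_distrib_right mult_ac)
    also have "\<dots> = (\<Sum>j\<in>UNIV. \<Sum>i\<in>UNIV. \<Sum>k\<in>UNIV. pdiff i (christoffel M c l j k) x * u $ i * v $ j * w $ k)"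
      by (rule sum.cong[OF refl sum.swap])
    also have "\<dots> = (\<Sum>i\<in>UNIV. \<Sum>j\<in>UNIV. \<Sum>k\<in>UNIV. pdiff i (christoffel M c l j k) x * u $ i * v $ j * w $ k)"
      by (rule sum.swap)
    finally show ?thesis
      using frechet_derivative_vec_nth[OF \<Gamma>_differentiable[OF assms, of v w], of l u] by simp
  qed
  have GG: "\<Gamma> x u (\<Gamma> x v w) $ l = (\<Sum>i\<in>UNIV. \<Sum>j\<in>UNIV. \<Sum>k\<in>UNIV.
      (\<Sum>m\<in>UNIV. christoffel M c l i m x * christoffel M c m j k x) * u $ i * v $ j * w $ k)" for u v w l
  proof -
    have "\<Gamma> x u (\<Gamma> x v w) $ l = (\<Sum>i\<in>UNIV. \<Sum>m\<in>UNIV. \<Sum>j\<in>UNIV. \<Sum>k\<in>UNIV.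
        christoffel M c l i m x * christoffel M c m j k x * u $ i * v $ j * w $ k)"
      by (simp add: christoffel_map_def sum_distrib_left sum_distrib_right mult_ac)
    also have "\<dots> = (\<Sum>i\<in>UNIV. \<Sum>j\<in>UNIV. \<Sum>m\<in>UNIV. \<Sum>k\<in>UNIV.
        christoffel M c l i m x * christoffel M c m j k x * u $ i * v $ j * w $ k)"
      by (rule sum.cong[OF refl sum.swap])
    also have "\<dots> = (\<Sum>i\<in>UNIV. \<Sum>j\<in>UNIV. \<Sum>k\<in>UNIV. \<Sum>m\<in>UNIV.
        christoffel M c l i m x * christoffel M c m j k x * u $ i * v $ j * w $ k)"
      by (rule sum.cong[OF refl], rule sum.cong[OF refl sum.swap])
    finally show ?thesis by (simp add: sum_distrib_right)
  qed
  have swap: "(\<Sum>i\<in>UNIV. \<Sum>j\<in>UNIV. \<Sum>k\<in>UNIV. F j i k * v $ i * u $ j * w $ k) =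
      (\<Sum>i\<in>UNIV. \<Sum>j\<in>UNIV. \<Sum>k\<in>UNIV. F i j k * u $ i * v $ j * w $ k)" for F :: "'n \<Rightarrow> 'n \<Rightarrow> 'n \<Rightarrow> real"
    by (subst sum.swap) (simp add: mult_ac)
  show ?thesis
    unfolding vec_eq_iff
  proof
    fix l
    have "curvature_tensor M c x u v w $ l =
      (\<Sum>i\<in>UNIV. \<Sum>j\<in>UNIV. \<Sum>k\<in>UNIV. pdiff i (christoffel M c l j k) x * u $ i * v $ j * w $ k)
      - (\<Sum>i\<in>UNIV. \<Sum>j\<in>UNIV. \<Sum>k\<in>UNIV. pdiff j (christoffel M c l i k) x * u $ i * v $ j * w $ k)
      + (\<Sum>i\<in>UNIV. \<Sum>j\<in>UNIV. \<Sum>k\<in>UNIV. (\<Sum>m\<in>UNIV. christoffel M c l i m x * christoffel M c m j k x) * u $ i * v $ j * w $ k)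
      - (\<Sum>i\<in>UNIV. \<Sum>j\<in>UNIV. \<Sum>k\<in>UNIV. (\<Sum>m\<in>UNIV. christoffel M c l j m x * christoffel M c m i k x) * u $ i * v $ j * w $ k)"
      by (simp add: curvature_tensor_def algebra_simps sum.distrib sum_subtractf)
    then show "curvature_tensor M c x u v w $ l =
        (d\<Gamma> x u v w - d\<Gamma> x v u w + \<Gamma> x u (\<Gamma> x v w) - \<Gamma> x v (\<Gamma> x u w)) $ l"
      by (simp add: d GG swap[of "\<lambda>i j k. pdiff j (christoffel M c l i k) x"]
        swap[of "\<lambda>i j k. (\<Sum>m\<in>UNIV. christoffel M c l j m x * christoffel M c m i k x)"])
  qed
qed

end

section \<open>The pullback connection\<close>

text \<open>The pullback of the Levi-Civita connection along \<open>F\<close>, in the parameter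
  direction \<open>e\<close>. With a real parameter and e = 1 it is the derivative along a curve;
  with parameters (t, s) it holds both derivatives of a variation.\<close>

definition pullback_cov ::
    "('a, 'n::finite) riemannian_structure \<Rightarrow> ('a, 'n) chart \<Rightarrow> ('p::real_normed_vector \<Rightarrow> real ^ 'n) \<Rightarrow>
     'p \<Rightarrow> ('p \<Rightarrow> real ^ 'n) \<Rightarrow> 'p \<Rightarrow> real ^ 'n"
  where "pullback_cov M c F e Y p = frechet_derivative Y (at p) e
    + christoffel_map M c (F p) (frechet_derivative F (at p) e) (Y p)"

lemma frechet_derivative_add:
  assumes "f differentiable (at x)" "h differentiable (at x)"
  shows "frechet_derivative (\<lambda>x. f x + h x) (at x) v =
    frechet_derivative f (at x) v + frechet_derivative h (at x) v"
proof -
  have "((\<lambda>x. f x + h x) has_derivative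
      (\<lambda>v. frechet_derivative f (at x) v + frechet_derivative h (at x) v)) (at x)"
    using assms by (intro has_derivative_add) (auto simp: frechet_derivative_works)
  then show ?thesis by (simp add: frechet_derivative_at[symmetric])
qed

locale chart_map = riemannian_chart M c for M :: "('a, 'n::finite) riemannian_structure" and c +
  fixes F :: "'p::real_normed_vector \<Rightarrow> real ^ 'n" and S :: "'p set"
  assumes open_S: "open S" and smooth_F: "smooth_on S F" and F_U: "\<And>p. p \<in> S \<Longrightarrow> F p \<in> U"
begin

abbreviation D where "D \<equiv> pullback_cov M c F"
abbreviation dF where "dF e \<equiv> (\<lambda>p. frechet_derivative F (at p) e)"

lemma smooth_dF: "smooth_on S (dF e)"
  by (rule smooth_on_frechet_derivative[OF smooth_F])

lemma smooth_D: "smooth_on S Y \<Longrightarrow> smooth_on S (D e Y)"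
  unfolding pullback_cov_def[abs_def]
  by (intro smooth_on_add[OF open_S] smooth_on_frechet_derivative smooth_\<Gamma>[OF open_S smooth_F]
      smooth_dF F_U)

lemma frechet_derivative_D:
  assumes "smooth_on S Y" "p \<in> S"
  shows "frechet_derivative (D e Y) (at p) v =
    frechet_derivative (\<lambda>q. frechet_derivative Y (at q) e) (at p) v
    + (d\<Gamma> (F p) (dF v p) (dF e p) (Y p)
    + \<Gamma> (F p) (frechet_derivative (dF e) (at p) v) (Y p)
    + \<Gamma> (F p) (dF e p) (frechet_derivative Y (at p) v))"
proof -
  note dY = smooth_on_differentiable[OF assms]
    and dYe = smooth_on_differentiable[OF smooth_on_frechet_derivative[OF assms(1)] assms(2)]
    and d2F = smooth_on_differentiable[OF smooth_dF assms(2)]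
    and d1F = smooth_on_differentiable[OF smooth_F assms(2)]
  note B = frechet_derivative_bilinear_family[OF bounded_bilinear_christoffel_map
      \<Gamma>_differentiable[OF F_U[OF assms(2)]] d1F d2F dY]
  show ?thesis
    unfolding pullback_cov_def[abs_def]
    by (simp only: frechet_derivative_add[OF dYe B(1)] B(2))
qed

text \<open>The second derivatives of \<open>Y\<close> and of \<open>F\<close> are symmetric in the
  two directions and cancel in the commutator; the remaining terms in \<open>\<Gamma>\<close> and
  its derivative are the curvature.\<close>

lemma D_commute:
  assumes "smooth_on S Y" "p \<in> S"
  shows "D u (D v Y) p = D v (D u Y) p + curvature_tensor M c (F p) (dF u p) (dF v p) (Y p)"
proof -
  have YY: "frechet_derivative (\<lambda>q. frechet_derivative Y (at q) v) (at p) u =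
      frechet_derivative (\<lambda>q. frechet_derivative Y (at q) u) (at p) v"
    by (rule frechet_derivative_swap[OF open_S assms])
  have FF: "frechet_derivative (dF v) (at p) u = frechet_derivative (dF u) (at p) v"
    by (rule frechet_derivative_swap[OF open_S smooth_F assms(2)])
  show ?thesis
    unfolding pullback_cov_def[of M c F u "D v Y"] pullback_cov_def[of M c F v "D u Y"]
      frechet_derivative_D[OF assms] YY FF curvature_tensor_eq[OF F_U[OF assms(2)]]
    by (simp add: pullback_cov_def \<Gamma>_simps)
qed

text \<open>Symmetry of the second derivatives of \<open>F\<close> together with symmetry of
  \<open>\<Gamma>\<close>. It turns the t-derivative of the velocity into the s-derivative of the
  variation field.\<close>

lemma D_torsion_free:
  assumes "p \<in> S"
  shows "D u (dF v) p = D v (dF u) p"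
  unfolding pullback_cov_def
  using frechet_derivative_swap[OF open_S smooth_F assms, of v u] \<Gamma>_sym[OF F_U[OF assms]] by simp

lemma D_metric:
  assumes "smooth_on S Y" "smooth_on S Z" "p \<in> S"
  shows "frechet_derivative (\<lambda>q. g (F q) (Y q) (Z q)) (at p) e = g (F p) (D e Y p) (Z p) + g (F p) (Y p) (D e Z p)"
proof -
  note d = smooth_on_differentiable[OF _ assms(3)]
  show ?thesis
    using frechet_derivative_bilinear_family(2)[OF bounded_bilinear_metric_inner
      g_differentiable[OF F_U[OF assms(3)]] d[OF smooth_F] d[OF assms(1)] d[OF assms(2)], of e]
    by (simp add: metric_compatible[OF F_U[OF assms(3)]] pullback_cov_def g_simps)
qed

end

section \<open>Curvature of a surface of constant sectional curvature\<close>

context riemannian_chart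
begin

text \<open>The nonzero vector g(v,v) u - g(u,v) v has squared length g(v,v) times the Gram
  determinant.\<close>

lemma gram_pos:
  assumes x: "x \<in> U" and ind: "independent {u, v}" "u \<noteq> v"
  shows "0 < g x u u * g x v v - (g x u v)\<^sup>2"
proof -
  have v: "v \<noteq> 0" using ind dependent_zero by blast
  have "g x v v *\<^sub>R u - g x u v *\<^sub>R v \<noteq> 0"
  proof
    assume "g x v v *\<^sub>R u - g x u v *\<^sub>R v = 0"
    then have "g x v v *\<^sub>R u = g x u v *\<^sub>R v" by simp
    then have "(1 / g x v v) *\<^sub>R (g x v v *\<^sub>R u) = (1 / g x v v) *\<^sub>R (g x u v *\<^sub>R v)" by simp
    then have "u = (g x u v / g x v v) *\<^sub>R v"
      using g_pos[OF x v] by simp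
    then have "u \<in> span {v}" by (metis span_base span_scale singletonI)
    moreover have "{u, v} - {u} = {v}" using ind(2) by auto
    ultimately show False using ind(1) unfolding dependent_def by auto
  qed
  from g_pos[OF x this] have "0 < g x v v * (g x u u * g x v v - (g x u v)\<^sup>2)"
    using g_sym[OF x, of v u] by (simp add: g_simps algebra_simps power2_eq_square)
  then show ?thesis using g_pos[OF x v] by (simp add: zero_less_mult_iff)
qed

lemma bounded_bilinear_curvature:
  assumes "x \<in> U"
  shows "bounded_bilinear (\<lambda>u v. curvature_tensor M c x u v w)"
    and "linear (curvature_tensor M c x u v)"
    and "curvature_tensor M c x v u w = - curvature_tensor M c x u v w"
proof -
  show "bounded_bilinear (\<lambda>u v. curvature_tensor M c x u v w)"
    unfolding bilinear_conv_bounded_bilinear[symmetric] bilinear_def curvature_tensor_def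
    by (auto intro!: linearI simp: vec_eq_iff algebra_simps sum.distrib sum_subtractf sum_distrib_left)
  show "linear (curvature_tensor M c x u v)"
    unfolding curvature_tensor_def
    by (auto intro!: linearI simp: vec_eq_iff algebra_simps sum.distrib sum_subtractf sum_distrib_left)
  show "curvature_tensor M c x v u w = - curvature_tensor M c x u v w"
    by (simp add: curvature_tensor_eq[OF assms])
qed

end

lemma span_pair_real2:
  fixes u v :: "real ^ 2"
  assumes "independent {u, v}" "u \<noteq> v"
  obtains a b where "z = a *\<^sub>R u + b *\<^sub>R v"
proof -
  have "UNIV \<subseteq> span {u, v}"
    by (rule card_ge_dim_independent) (use assms in auto)
  then have "z \<in> span {u, v}" by auto
  then obtain a b where "z - a *\<^sub>R u = b *\<^sub>R v"
    by (auto simp: span_insert span_singleton)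
  then have "z = a *\<^sub>R u + b *\<^sub>R v" by (simp add: algebra_simps)
  then show ?thesis using that by blast
qed

locale orthonormal_frame = riemannian_chart M c for M :: "('a, 2) riemannian_structure" and c +
  fixes x T N :: "real ^ 2"
  assumes x: "x \<in> U" and TT: "g x T T = 1" and NN: "g x N N = 1" and TN: "g x T N = 0"
begin

lemma NT: "g x N T = 0"
  using g_sym[OF x, of N T] TN by simp

lemma T_neq_N: "T \<noteq> N" using TT TN by auto

lemma independent_comb:
  assumes "a * d - b * c' \<noteq> 0"
  shows "independent {a *\<^sub>R T + b *\<^sub>R N, c' *\<^sub>R T + d *\<^sub>R N}"
    and "a *\<^sub>R T + b *\<^sub>R N \<noteq> c' *\<^sub>R T + d *\<^sub>R N"
proof -
  let ?u = "a *\<^sub>R T + b *\<^sub>R N" and ?v = "c' *\<^sub>R T + d *\<^sub>R N"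
  have coords: "g x (p *\<^sub>R T + q *\<^sub>R N) T = p" "g x (p *\<^sub>R T + q *\<^sub>R N) N = q" for p q
    using TT NN TN NT by (simp_all add: g_simps)
  show "?u \<noteq> ?v"
  proof
    assume "?u = ?v"
    then have "a = c'" "b = d" using coords by metis+
    then show False using assms by simp
  qed
  show "independent {?u, ?v}"
  proof -
    have vne: "?v \<noteq> 0"
    proof
      assume "?v = 0"
      then have "c' = 0" "d = 0" using coords[of c' d] unfolding \<open>?v = 0\<close> g_simps by simp_all
      then show False using assms by simp
    qed
    have "?u \<notin> span {?v}"
    proof
      assume "?u \<in> span {?v}"
      then obtain k where "?u = k *\<^sub>R ?v" by (auto simp: span_singleton)
      then have k: "?u = (k * c') *\<^sub>R T + (k * d) *\<^sub>R N" by (simp add: algebra_simps)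
      have "a = k * c'" "b = k * d"
        using coords[of a b] coords[of "k * c'" "k * d"] unfolding k by simp_all
      then show False using assms by simp
    qed
    then show ?thesis using vne by (simp add: independent_insert)
  qed
qed

lemma frame_eqI:
  assumes "g x v T = g x w T" "g x v N = g x w N"
  shows "v = w"
proof (rule g_nondegenerate[OF x])
  fix z
  obtain a b where z: "z = a *\<^sub>R T + b *\<^sub>R N"
    using span_pair_real2[of T N z] independent_comb(1)[of 1 1 0 0] T_neq_N by auto
  show "g x v z = g x w z" unfolding z using assms by (simp add: g_simps)
qed

text \<open>In dimension two, antisymmetry in the first two slots leaves the single operator R(T,N),
  multiplied by the determinant of the pair in the frame. Its four matrix entries follow by
  evaluating the sectional curvature on different bases of the same plane. The second slot is
  \<open>T\<close> because the velocity of the curve will stand there.\<close>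

lemma curvature_frame:
  assumes "constant_sectional_curvature M C"
  shows "curvature_tensor M c x (a *\<^sub>R T + b *\<^sub>R N) T (p *\<^sub>R T + q *\<^sub>R N) = (b * C) *\<^sub>R (p *\<^sub>R N - q *\<^sub>R T)"
proof -
  define A where "A = curvature_tensor M c x T N"
  interpret R: bounded_bilinear "\<lambda>u v. curvature_tensor M c x u v w" for w
    by (rule bounded_bilinear_curvature(1)[OF x])
  have A: "linear A" unfolding A_def by (rule bounded_bilinear_curvature(2)[OF x])
  note A_simps = linear_add[OF A] linear_scale[OF A]
  note anti = bounded_bilinear_curvature(3)[OF x]
  have TT0: "curvature_tensor M c x v v w = 0" for v w
    using anti[of v v w] by (simp add: vec_eq_iff)
  have RA: "curvature_tensor M c x (a *\<^sub>R T + b *\<^sub>R N) (c' *\<^sub>R T + d *\<^sub>R N) w = (a * d - b * c') *\<^sub>R A w"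
    for a b c' d w
    by (simp add: R.add_left R.add_right R.scaleR_left R.scaleR_right TT0 anti[of N T] A_def algebra_simps)
  have key: "g x (A (c' *\<^sub>R T + d *\<^sub>R N)) (a *\<^sub>R T + b *\<^sub>R N) = C * (a * d - b * c')"
    if "a * d - b * c' \<noteq> 0" for a b c' d
  proof -
    let ?u = "a *\<^sub>R T + b *\<^sub>R N" and ?v = "c' *\<^sub>R T + d *\<^sub>R N"
    note ind = independent_comb[OF that]
    have "sectional_curvature M c x ?u ?v = C"
      using assms chart x ind unfolding constant_sectional_curvature_def by blast
    then have "g x (curvature_tensor M c x ?u ?v ?v) ?u = C * (g x ?u ?u * g x ?v ?v - (g x ?u ?v)\<^sup>2)"
      using gram_pos[OF x ind] unfolding sectional_curvature_def by (simp add: field_simps)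
    \<comment> \<open>In an orthonormal frame the Gram determinant is the square of the coefficient
      determinant, so one factor cancels below.\<close>
    also have "g x ?u ?u * g x ?v ?v - (g x ?u ?v)\<^sup>2 = (a * d - b * c')\<^sup>2"
      using TT NN TN NT by (simp add: g_simps power2_eq_square algebra_simps)
    finally have "(a * d - b * c') * g x (A ?v) ?u = C * (a * d - b * c')\<^sup>2"
      unfolding RA by (simp only: bounded_bilinear.scaleR_left[OF bounded_bilinear_metric_inner] real_scaleR_def)
    then have "(a * d - b * c') * g x (A ?v) ?u = (a * d - b * c') * (C * (a * d - b * c'))"
      by (simp add: power2_eq_square)
    then show ?thesis using that by simp
  qed
  \<comment> \<open>The instantiations follow the order a, d, b, c' of occurrence in the premise of
    \<open>key\<close>. The four pairs (u, v) used are (T, N), (N, T), (T + N, N) and (T + N,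
    T).\<close>
  have ANT: "g x (A N) T = C" using key[of 1 1 0 0] by simp
  have ATN: "g x (A T) N = - C" using key[of 0 0 1 1] by simp
  have ANN: "g x (A N) N = 0" using key[of 1 1 1 0] ANT by (simp add: g_simps)
  have ATT: "g x (A T) T = 0" using key[of 1 0 1 1] ATN by (simp add: g_simps)
  have AN: "A N = C *\<^sub>R T"
    by (rule frame_eqI) (use ANT ANN TT TN in \<open>simp_all add: g_simps\<close>)
  have AT: "A T = - C *\<^sub>R N"
    by (rule frame_eqI) (use ATN ATT NN NT in \<open>simp_all add: g_simps\<close>)
  show ?thesis
    using RA[of a b 1 0 "p *\<^sub>R T + q *\<^sub>R N"]
    by (simp add: A_simps AT AN algebra_simps)
qed

end

section \<open>Change of charts\<close>

locale chart_pair = C: riemannian_chart M c + D: riemannian_chart M d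
  for M :: "('a, 'n::finite) riemannian_structure" and c d
begin

abbreviation overlap where "overlap \<equiv> coord c ` (cdom c \<inter> cdom d)"
abbreviation \<phi> where "\<phi> \<equiv> transition c d"
abbreviation d\<phi> where "d\<phi> x v \<equiv> frechet_derivative \<phi> (at x) v"

lemma is_chart: "is_chart (mtop M) c" "is_chart (mtop M) d"
  using C.manifold C.chart D.chart unfolding riemannian_manifold_def smooth_manifold_def by blast+

lemma inj_coord: "inj_on (coord c) (cdom c)"
proof -
  have "homeomorphic_map (subtopology (mtop M) (cdom c)) (top_of_set C.U) (coord c)"
    and "cdom c \<subseteq> topspace (mtop M)"
    using is_chart(1) openin_subset unfolding is_chart_def by blast+
  then show ?thesis
    using homeomorphic_imp_injective_map by (metis inf.absorb2 topspace_subtopology)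
qed

lemma transition_coord: "p \<in> cdom c \<Longrightarrow> \<phi> (coord c p) = coord d p"
  by (simp add: transition_def inj_coord)

lemma \<phi>_U: "x \<in> overlap \<Longrightarrow> \<phi> x \<in> D.U"
  using transition_coord by auto

lemma overlap_U: "x \<in> overlap \<Longrightarrow> x \<in> C.U"
  by auto

lemma open_overlap: "open overlap"
proof -
  have c: "openin (mtop M) (cdom c)" "openin (mtop M) (cdom d)"
    and h: "homeomorphic_map (subtopology (mtop M) (cdom c)) (top_of_set C.U) (coord c)"
    using is_chart unfolding is_chart_def by blast+
  have "openin (subtopology (mtop M) (cdom c)) (cdom c \<inter> cdom d)"
    using c by (simp add: openin_subtopology_Int2)
  then have "openin (top_of_set C.U) overlap"
    using homeomorphic_imp_open_map[OF h] unfolding open_map_def by blast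
  then show ?thesis using C.open_U openin_open_trans by blast
qed

lemma smooth_\<phi>: "smooth_on overlap \<phi>"
  using C.manifold C.chart D.chart
  unfolding riemannian_manifold_def smooth_manifold_def by blast

lemma metric_transition:
  assumes "x \<in> overlap" shows "C.g x v w = D.g (\<phi> x) (d\<phi> x v) (d\<phi> x w)"
proof -
  obtain p where p: "p \<in> cdom c \<inter> cdom d" "x = coord c p" using assms by blast
  have "\<forall>p\<in>cdom c \<inter> cdom d. \<forall>v w. C.g (coord c p) v w = D.g (coord d p) (d\<phi> (coord c p) v) (d\<phi> (coord c p) w)"
    using C.manifold C.chart D.chart unfolding riemannian_manifold_def by blast
  then show ?thesis using p transition_coord[of p] by simp
qed

lemma linear_d\<phi>: "x \<in> overlap \<Longrightarrow> linear (d\<phi> x)"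
  by (rule linear_frechet_derivative[OF smooth_on_differentiable[OF smooth_\<phi>]])

text \<open>The derivative carries one positive definite metric to the other, so it kills no nonzero
  vector; equal dimensions make it onto. Surjectivity lets nondegeneracy in the second chart be
  tested on pushed-forward vectors.\<close>

lemma surj_d\<phi>: assumes "x \<in> overlap" shows "surj (d\<phi> x)"
proof (rule linear_injective_imp_surjective[OF linear_d\<phi>[OF assms]])
  have "v = 0" if "d\<phi> x v = 0" for v
  proof (rule ccontr)
    assume "v \<noteq> 0"
    then have "0 < C.g x v v" using C.g_pos[OF overlap_U[OF assms]] by blast
    then show False using metric_transition[OF assms, of v v] that by (simp add: D.g_simps)
  qed
  then show "inj (d\<phi> x)" using linear_injective_0[OF linear_d\<phi>[OF assms]] by blast
qed simp

abbreviation d2\<phi> where "d2\<phi> x v u \<equiv> frechet_derivative (\<lambda>y. d\<phi> y v) (at x) u"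

lemma d2\<phi>_sym: "x \<in> overlap \<Longrightarrow> d2\<phi> x v u = d2\<phi> x u v"
  by (rule frechet_derivative_swap[OF open_overlap smooth_\<phi>])

lemma dg_transition:
  assumes x: "x \<in> overlap"
  shows "C.dg x u v w = D.dg (\<phi> x) (d\<phi> x u) (d\<phi> x v) (d\<phi> x w)
    + D.g (\<phi> x) (d2\<phi> x v u) (d\<phi> x w) + D.g (\<phi> x) (d\<phi> x v) (d2\<phi> x w u)"
proof -
  have "C.dg x u v w = frechet_derivative (\<lambda>y. D.g (\<phi> y) (d\<phi> y v) (d\<phi> y w)) (at x) u"
    using frechet_derivative_cong_open[OF open_overlap x, of "\<lambda>y. C.g y v w"] metric_transition by simp
  also have "\<dots> = D.dg (\<phi> x) (d\<phi> x u) (d\<phi> x v) (d\<phi> x w)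
    + D.g (\<phi> x) (d2\<phi> x v u) (d\<phi> x w) + D.g (\<phi> x) (d\<phi> x v) (d2\<phi> x w u)"
    by (rule frechet_derivative_bilinear_family(2)[where B = D.g and X = \<phi>
        and u = "\<lambda>y. d\<phi> y v" and v = "\<lambda>y. d\<phi> y w", OF bounded_bilinear_metric_inner
        D.g_differentiable[OF \<phi>_U[OF x]]])
      (intro smooth_on_differentiable[OF _ x] smooth_on_frechet_derivative smooth_\<phi>)+
  finally show ?thesis .
qed

text \<open>The Koszul combination of \<open>dg_transition\<close> contains six terms with second
  derivatives of the transition map. By their symmetry four cancel, and the other two are equal and
  absorb the factor 1/2.\<close>

lemma \<Gamma>_transition:
  assumes x: "x \<in> overlap"
  shows "d\<phi> x (C.\<Gamma> x u v) = D.\<Gamma> (\<phi> x) (d\<phi> x u) (d\<phi> x v) + d2\<phi> x u v"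
proof (rule D.g_nondegenerate[OF \<phi>_U[OF x]])
  fix w'
  obtain w where w: "w' = d\<phi> x w" using surj_d\<phi>[OF x] by (metis surjD)
  have "D.g (\<phi> x) (d\<phi> x (C.\<Gamma> x u v)) w' = C.g x (C.\<Gamma> x u v) w"
    using metric_transition[OF x] w by simp
  also have "\<dots> = D.g (\<phi> x) (D.\<Gamma> (\<phi> x) (d\<phi> x u) (d\<phi> x v)) (d\<phi> x w) + D.g (\<phi> x) (d2\<phi> x u v) (d\<phi> x w)"
    unfolding C.koszul[OF overlap_U[OF x]] D.koszul[OF \<phi>_U[OF x]] dg_transition[OF x]
    using d2\<phi>_sym[OF x, of v u] d2\<phi>_sym[OF x, of w u] d2\<phi>_sym[OF x, of w v]
      D.g_sym[OF \<phi>_U[OF x], of "d\<phi> x u" "d2\<phi> x v w"] D.g_sym[OF \<phi>_U[OF x], of "d2\<phi> x u w" "d\<phi> x v"]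
    by (simp add: field_simps)
  finally show "D.g (\<phi> x) (d\<phi> x (C.\<Gamma> x u v)) w' =
      D.g (\<phi> x) (D.\<Gamma> (\<phi> x) (d\<phi> x u) (d\<phi> x v) + d2\<phi> x u v) w'"
    by (simp add: w D.g_simps)
qed

text \<open>The product rule for \<open>d\<phi>\<close> applied to a moving vector at a moving
  point. Linearity of \<open>d\<phi> y\<close> is available for y in the overlap only, so the
  expansion in axis vectors is made there.\<close>

lemma frechet_derivative_pushforward:
  assumes p: "F p \<in> overlap" and F: "F differentiable (at p)" and Y: "Y differentiable (at p)"
    and S: "open S" "p \<in> S" "\<And>q. q \<in> S \<Longrightarrow> F q \<in> overlap"
  shows "frechet_derivative (\<lambda>q. d\<phi> (F q) (Y q)) (at p) e =
    d2\<phi> (F p) (Y p) (frechet_derivative F (at p) e) + d\<phi> (F p) (frechet_derivative Y (at p) e)"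
proof -
  define b where "b i y = d\<phi> y (axis i 1)" for i y
  define B where "B i = frechet_derivative (b i) (at (F p))" for i
  have eq: "d\<phi> y v = (\<Sum>i\<in>UNIV. v $ i *\<^sub>R b i y)" if "y \<in> overlap" for y v
    using linear_d\<phi>[OF that] unfolding b_def
    by (subst vec_basis_sum[of v]) (simp add: linear_sum linear_scale)
  have bd: "(b i has_derivative B i) (at (F p))" for i
    using smooth_on_frechet[OF smooth_on_frechet_derivative[OF smooth_\<phi>] p]
    unfolding b_def[abs_def] B_def .
  have bF: "((\<lambda>q. b i (F q)) has_derivative (\<lambda>e. B i (frechet_derivative F (at p) e))) (at p)" for i
    using has_derivative_compose[OF F[unfolded frechet_derivative_works] bd] .
  have Yn: "((\<lambda>q. Y q $ i) has_derivative (\<lambda>e. frechet_derivative Y (at p) e $ i)) (at p)" for i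
    using bounded_linear.has_derivative[OF bounded_linear_vec_nth] Y frechet_derivative_works by blast
  have "((\<lambda>q. \<Sum>i\<in>UNIV. Y q $ i *\<^sub>R b i (F q)) has_derivative
      (\<lambda>e. \<Sum>i\<in>UNIV. Y p $ i *\<^sub>R B i (frechet_derivative F (at p) e) + frechet_derivative Y (at p) e $ i *\<^sub>R b i (F p))) (at p)"
    by (intro has_derivative_sum has_derivative_scaleR Yn bF)
  from fun_cong[OF frechet_derivative_at[OF this], of e]
  have 1: "frechet_derivative (\<lambda>q. d\<phi> (F q) (Y q)) (at p) e =
      (\<Sum>i\<in>UNIV. Y p $ i *\<^sub>R B i (frechet_derivative F (at p) e)) + d\<phi> (F p) (frechet_derivative Y (at p) e)"
    using frechet_derivative_cong_open[OF S(1,2), of "\<lambda>q. d\<phi> (F q) (Y q)" "\<lambda>q. \<Sum>i\<in>UNIV. Y q $ i *\<^sub>R b i (F q)"]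
      eq S(3) eq[OF p] by (simp add: sum.distrib)
  have "((\<lambda>y. \<Sum>i\<in>UNIV. Y p $ i *\<^sub>R b i y) has_derivative (\<lambda>u. \<Sum>i\<in>UNIV. Y p $ i *\<^sub>R B i u)) (at (F p))"
    by (intro has_derivative_sum has_derivative_scaleR_right bd)
  from fun_cong[OF frechet_derivative_at[OF this]]
  have "d2\<phi> (F p) (Y p) u = (\<Sum>i\<in>UNIV. Y p $ i *\<^sub>R B i u)" for u
    using frechet_derivative_cong_open[OF open_overlap p, of "\<lambda>y. d\<phi> y (Y p)" "\<lambda>y. \<Sum>i\<in>UNIV. Y p $ i *\<^sub>R b i y"] eq
    by simp
  then show ?thesis using 1 by simp
qed

text \<open>Two terms with second derivatives of the transition map arise, one from differentiating
  the pushed-forward field and one from the Christoffel symbols, and they cancel.\<close>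

lemma pullback_cov_transition:
  assumes S: "open S" "p \<in> S" "\<And>q. q \<in> S \<Longrightarrow> F q \<in> overlap"
    and F: "F differentiable (at p)" and Y: "Y differentiable (at p)"
    and F': "\<And>q. q \<in> S \<Longrightarrow> F' q = \<phi> (F q)" and Y': "\<And>q. q \<in> S \<Longrightarrow> Y' q = d\<phi> (F q) (Y q)"
  shows "pullback_cov M d F' e Y' p = d\<phi> (F p) (pullback_cov M c F e Y p)"
proof -
  have p: "F p \<in> overlap" using S by blast
  have 1: "frechet_derivative F' (at p) e = d\<phi> (F p) (frechet_derivative F (at p) e)"
    using frechet_derivative_cong_open[OF S(1,2), of F' "\<lambda>q. \<phi> (F q)"] F'
      frechet_derivative_chain[OF F smooth_on_differentiable[OF smooth_\<phi> p]] by simp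
  have 2: "frechet_derivative Y' (at p) e =
    d2\<phi> (F p) (Y p) (frechet_derivative F (at p) e) + d\<phi> (F p) (frechet_derivative Y (at p) e)"
    using frechet_derivative_cong_open[OF S(1,2), of Y' "\<lambda>q. d\<phi> (F q) (Y q)"] Y'
      frechet_derivative_pushforward[OF p F Y S] by simp
  show ?thesis
    unfolding pullback_cov_def 1 2 F'[OF S(2)] Y'[OF S(2)] linear_add[OF linear_d\<phi>[OF p]]
      \<Gamma>_transition[OF p] d2\<phi>_sym[OF p, of "Y p"]
    by simp
qed

end

section \<open>Smooth fields along a curve\<close>

lemma vector_derivative_eq_frechet:
  assumes "f differentiable (at s)"
  shows "vector_derivative f (at s) = frechet_derivative f (at s) 1"
  using assms frechet_derivative_eq_vector_derivative by (metis scaleR_one)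

locale curve_in =
  fixes M :: "('a, 'n::finite) riemannian_structure" and J :: "real set" and \<sigma> :: "real \<Rightarrow> 'a"
  assumes manifold: "riemannian_manifold M" and open_J: "open J" and smooth_\<sigma>: "smooth_into M J \<sigma>"
begin

abbreviation dom where "dom c \<equiv> {s \<in> J. \<sigma> s \<in> cdom c}"

lemma open_dom: assumes "c \<in> atlas M" shows "open (dom c)"
proof -
  have "openin (mtop M) (cdom c)"
    using assms manifold unfolding riemannian_manifold_def smooth_manifold_def is_chart_def by blast
  then have "openin (top_of_set J) {s \<in> topspace (top_of_set J). \<sigma> s \<in> cdom c}"
    using smooth_\<sigma> openin_continuous_map_preimage unfolding smooth_into_def by blast
  then show ?thesis using openin_open_trans[OF _ open_J] by simp
qed

lemma smooth_coord: "c \<in> atlas M \<Longrightarrow> smooth_on (dom c) (coord c \<circ> \<sigma>)"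
  using smooth_\<sigma> unfolding smooth_into_def by blast

lemma chart_map: assumes "c \<in> atlas M" shows "chart_map M c (coord c \<circ> \<sigma>) (dom c)"
  by unfold_locales (use assms manifold open_dom smooth_coord in auto)

lemma velocity_eq:
  assumes "c \<in> atlas M" "s \<in> dom c"
  shows "velocity \<sigma> c s = frechet_derivative (coord c \<circ> \<sigma>) (at s) 1"
  unfolding velocity_def
  by (rule vector_derivative_eq_frechet[OF smooth_on_differentiable[OF smooth_coord[OF assms(1)] assms(2)]])

lemma cov_deriv_eq:
  assumes "c \<in> atlas M" "s \<in> dom c" "V c differentiable (at s)"
  shows "cov_deriv M \<sigma> V c s = pullback_cov M c (coord c \<circ> \<sigma>) 1 (V c) s"
  unfolding cov_deriv_def pullback_cov_def christoffel_map_def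
  by (simp add: velocity_eq[OF assms(1,2)] vector_derivative_eq_frechet[OF assms(3)])

lemma smooth_velocity: "smooth_field_along M J \<sigma> (velocity \<sigma>)"
  unfolding smooth_field_along_def
proof (intro conjI ballI impI)
  fix c assume c: "c \<in> atlas M"
  show "smooth_on (dom c) (velocity \<sigma> c)"
  proof (rule iffD2[OF smooth_on_cong[OF open_dom[OF c]]])
    show "smooth_on (dom c) (\<lambda>s. frechet_derivative (coord c \<circ> \<sigma>) (at s) 1)"
      by (rule smooth_on_frechet_derivative[OF smooth_coord[OF c]])
  qed (rule velocity_eq[OF c])
next
  fix s c d assume s: "s \<in> J" and c: "c \<in> atlas M" and d: "d \<in> atlas M" and "\<sigma> s \<in> cdom c \<inter> cdom d"
  then have dom: "s \<in> dom c" "s \<in> dom d" by auto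
  interpret chart_pair M c d by unfold_locales (use c d manifold in auto)
  have "frechet_derivative (coord d \<circ> \<sigma>) (at s) = frechet_derivative (\<lambda>s. \<phi> ((coord c \<circ> \<sigma>) s)) (at s)"
    by (rule frechet_derivative_cong_open[OF open_dom[OF c] dom(1)]) (simp add: transition_coord)
  moreover have "(coord c \<circ> \<sigma>) s \<in> overlap" using dom by auto
  ultimately have "frechet_derivative (coord d \<circ> \<sigma>) (at s) 1 =
      d\<phi> ((coord c \<circ> \<sigma>) s) (frechet_derivative (coord c \<circ> \<sigma>) (at s) 1)"
    using frechet_derivative_chain[OF smooth_on_differentiable[OF smooth_coord[OF c] dom(1)]
        smooth_on_differentiable[OF smooth_\<phi>], of 1] by simp
  then show "velocity \<sigma> d s = frechet_derivative (transition c d) (at (coord c (\<sigma> s))) (velocity \<sigma> c s)"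
    by (simp add: velocity_eq[OF c dom(1)] velocity_eq[OF d dom(2)])
qed

text \<open>Iterated covariant derivatives thus remain genuine fields along the curve, so their
  inner products do not depend on the chart.\<close>

lemma smooth_cov_deriv:
  assumes "smooth_field_along M J \<sigma> V"
  shows "smooth_field_along M J \<sigma> (cov_deriv M \<sigma> V)"
proof -
  have sm: "smooth_on (dom c) (V c)" if "c \<in> atlas M" for c
    using assms that unfolding smooth_field_along_def by blast
  have eq: "cov_deriv M \<sigma> V c s = pullback_cov M c (coord c \<circ> \<sigma>) 1 (V c) s"
    if "c \<in> atlas M" "s \<in> dom c" for c s
    by (rule cov_deriv_eq[of c s V, OF that smooth_on_differentiable[OF sm[OF that(1)] that(2)]])
  show ?thesis
    unfolding smooth_field_along_def
  proof (intro conjI ballI impI)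
    fix c assume c: "c \<in> atlas M"
    interpret chart_map M c "coord c \<circ> \<sigma>" "dom c" by (rule chart_map[OF c])
    show "smooth_on (dom c) (cov_deriv M \<sigma> V c)"
    proof (rule iffD2[OF smooth_on_cong[OF open_dom[OF c]]])
      show "smooth_on (dom c) (pullback_cov M c (coord c \<circ> \<sigma>) 1 (V c))"
        by (rule smooth_D[OF sm[OF c]])
    qed (rule eq[OF c])
  next
    fix s c d assume s: "s \<in> J" and c: "c \<in> atlas M" and d: "d \<in> atlas M" and "\<sigma> s \<in> cdom c \<inter> cdom d"
    then have dom: "s \<in> dom c" "s \<in> dom d" by auto
    interpret chart_pair M c d by unfold_locales (use c d manifold in auto)
    have "pullback_cov M d (coord d \<circ> \<sigma>) 1 (V d) s =
        d\<phi> ((coord c \<circ> \<sigma>) s) (pullback_cov M c (coord c \<circ> \<sigma>) 1 (V c) s)"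
    proof (rule pullback_cov_transition)
      show "open (dom c \<inter> dom d)" using open_dom c d by blast
      show "s \<in> dom c \<inter> dom d" using dom by blast
      show "(coord c \<circ> \<sigma>) differentiable at s" by (rule smooth_on_differentiable[OF smooth_coord[OF c] dom(1)])
      show "V c differentiable at s" by (rule smooth_on_differentiable[OF sm[OF c] dom(1)])
      show "V d q = d\<phi> ((coord c \<circ> \<sigma>) q) (V c q)" if "q \<in> dom c \<inter> dom d" for q
        using assms c d that unfolding smooth_field_along_def comp_apply by blast
      show "(coord c \<circ> \<sigma>) q \<in> overlap" if "q \<in> dom c \<inter> dom d" for q
        using that unfolding comp_apply by blast
      show "(coord d \<circ> \<sigma>) q = \<phi> ((coord c \<circ> \<sigma>) q)" if "q \<in> dom c \<inter> dom d" for q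
        using transition_coord[of "\<sigma> q"] that by simp
    qed
    then show "cov_deriv M \<sigma> V d s =
        frechet_derivative (transition c d) (at (coord c (\<sigma> s))) (cov_deriv M \<sigma> V c s)"
      by (simp only: eq[OF c dom(1)] eq[OF d dom(2)] comp_apply)
  qed
qed

text \<open>Replaces the chart picked by the choice operator with any chart at hand; the
  transformation laws of the metric and of the fields match.\<close>

lemma inner_along_eq:
  assumes V: "smooth_field_along M J \<sigma> V" and W: "smooth_field_along M J \<sigma> W"
    and c: "c \<in> atlas M" and s: "s \<in> J" "\<sigma> s \<in> cdom c"
  shows "inner_along M \<sigma> V W s = metric_inner M c (coord c (\<sigma> s)) (V c s) (W c s)"
proof -
  define d where "d = (SOME d. d \<in> atlas M \<and> \<sigma> s \<in> cdom d)"
  have d: "d \<in> atlas M" "\<sigma> s \<in> cdom d"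
    using someI[of "\<lambda>d. d \<in> atlas M \<and> \<sigma> s \<in> cdom d" c] c s unfolding d_def by blast+
  interpret chart_pair M c d by unfold_locales (use c d manifold in auto)
  have o: "coord c (\<sigma> s) \<in> overlap" using d s by blast
  have tr: "X d s = d\<phi> (coord c (\<sigma> s)) (X c s)" if "smooth_field_along M J \<sigma> X" for X
    using that c d s unfolding smooth_field_along_def by blast
  have "metric_inner M c (coord c (\<sigma> s)) (V c s) (W c s) = metric_inner M d (coord d (\<sigma> s)) (V d s) (W d s)"
    unfolding tr[OF V] tr[OF W] metric_transition[OF o] transition_coord[OF s(2)] ..
  then show ?thesis by (simp add: inner_along_def Let_def d_def)
qed

text \<open>The sign in the rough Laplacian disappears in the squared norm, leaving the third
  covariant derivative of the velocity.\<close>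

lemma inner_along_bilaplacian:
  assumes c: "c \<in> atlas M" and s: "s \<in> J" "\<sigma> s \<in> cdom c"
  shows "inner_along M \<sigma> (rough_laplacian M \<sigma> (tension M \<sigma>)) (rough_laplacian M \<sigma> (tension M \<sigma>)) s =
    metric_inner M c (coord c (\<sigma> s)) (cov_deriv M \<sigma> (cov_deriv M \<sigma> (tension M \<sigma>)) c s)
      (cov_deriv M \<sigma> (cov_deriv M \<sigma> (tension M \<sigma>)) c s)"
proof -
  define V where "V = cov_deriv M \<sigma> (cov_deriv M \<sigma> (tension M \<sigma>))"
  have "smooth_field_along M J \<sigma> V"
    unfolding V_def tension_def by (intro smooth_cov_deriv smooth_velocity)
  moreover have "inner_along M \<sigma> (rough_laplacian M \<sigma> (tension M \<sigma>)) (rough_laplacian M \<sigma> (tension M \<sigma>)) s = inner_along M \<sigma> V V s"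
    by (simp add: inner_along_def rough_laplacian_def V_def Let_def
        bounded_bilinear.minus_left[OF bounded_bilinear_metric_inner]
        bounded_bilinear.minus_right[OF bounded_bilinear_metric_inner])
  ultimately show ?thesis using inner_along_eq[OF _ _ c s, of V V] unfolding V_def by simp
qed

end

section \<open>Variations: the Frenet calculation and the construction of variations inside a
  chart\<close>

section \<open>The first variation at a curve of constant curvature\<close>

text \<open>\<open>a n\<close> and \<open>b n\<close> are the \<open>n\<close>-th derivatives of the tangential and the normal
  component of the variation field; the parameter space is that of pairs \<open>(t, s)\<close>.\<close>

locale surface_variation = chart_map M c F S
  for M :: "('a, 2) riemannian_structure" and c and F :: "real \<times> real \<Rightarrow> real ^ 2" and S +
  fixes T N :: "real \<Rightarrow> real ^ 2" and a b :: "nat \<Rightarrow> real \<Rightarrow> real" and K :: "real set" and \<kappa> C :: real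
  assumes open_K: "open K" and K_S: "s \<in> K \<Longrightarrow> (0, s) \<in> S"
    and F_T: "s \<in> K \<Longrightarrow> dF (0, 1) (0, s) = T s"
    and F_V: "s \<in> K \<Longrightarrow> dF (1, 0) (0, s) = a 0 s *\<^sub>R T s + b 0 s *\<^sub>R N s"
    and frame: "s \<in> K \<Longrightarrow> orthonormal_frame M c (F (0, s)) (T s) (N s)"
    and T': "s \<in> K \<Longrightarrow> (T has_vector_derivative \<kappa> *\<^sub>R N s - \<Gamma> (F (0, s)) (T s) (T s)) (at s)"
    and N': "s \<in> K \<Longrightarrow> (N has_vector_derivative - \<kappa> *\<^sub>R T s - \<Gamma> (F (0, s)) (T s) (N s)) (at s)"
    and a': "s \<in> K \<Longrightarrow> (a n has_real_derivative a (Suc n) s) (at s)"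
    and b': "s \<in> K \<Longrightarrow> (b n has_real_derivative b (Suc n) s) (at s)"
    and curvature: "constant_sectional_curvature M C"
begin

abbreviation V where "V \<equiv> dF (1, 0)"
abbreviation X where "X \<equiv> dF (0, 1)"
abbreviation Dt where "Dt \<equiv> D (1, 0)"
abbreviation Ds where "Ds \<equiv> D (0, 1)"

text \<open>The Frenet formulas applied to p T + q N. The frame exists only on the slice t = 0,
  which suffices because \<open>Ds\<close> differentiates within that slice.\<close>

lemma Ds_frame:
  assumes Y: "smooth_on S Y" and eq: "\<And>s. s \<in> K \<Longrightarrow> Y (0, s) = p s *\<^sub>R T s + q s *\<^sub>R N s"
    and p: "\<And>s. s \<in> K \<Longrightarrow> (p has_real_derivative p' s) (at s)"
    and q: "\<And>s. s \<in> K \<Longrightarrow> (q has_real_derivative q' s) (at s)" and s: "s \<in> K"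
  shows "Ds Y (0, s) = (p' s - \<kappa> * q s) *\<^sub>R T s + (q' s + \<kappa> * p s) *\<^sub>R N s"
proof -
  have "((\<lambda>s. (0, s)) has_derivative (\<lambda>r. (0::real, r))) (at s)"
    by (auto intro!: derivative_eq_intros)
  moreover have "(Y has_derivative frechet_derivative Y (at (0, s))) (at (0, s))"
    by (rule smooth_on_frechet[OF Y K_S[OF s]])
  ultimately have "((\<lambda>s. Y (0, s)) has_derivative (\<lambda>r. frechet_derivative Y (at (0, s)) (0, r))) (at s)"
    by (rule has_derivative_compose[of "\<lambda>s. (0, s)" "\<lambda>r. (0, r)" s UNIV Y])
  moreover have "(\<lambda>r. frechet_derivative Y (at (0, s)) (0, r)) = (\<lambda>r. r *\<^sub>R frechet_derivative Y (at (0, s)) (0, 1))"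
  proof
    fix r :: real
    have "frechet_derivative Y (at (0, s)) (r *\<^sub>R (0, 1)) = r *\<^sub>R frechet_derivative Y (at (0, s)) (0, 1)"
      by (rule linear_scale[OF linear_frechet_derivative[OF smooth_on_differentiable[OF Y K_S[OF s]]]])
    then show "frechet_derivative Y (at (0, s)) (0, r) = r *\<^sub>R frechet_derivative Y (at (0, s)) (0, 1)"
      by simp
  qed
  ultimately have "((\<lambda>s. Y (0, s)) has_vector_derivative frechet_derivative Y (at (0, s)) (0, 1)) (at s)"
    unfolding has_vector_derivative_def by (simp only:)
  then have 1: "((\<lambda>s. p s *\<^sub>R T s + q s *\<^sub>R N s) has_vector_derivative frechet_derivative Y (at (0, s)) (0, 1)) (at s)"
    by (rule has_vector_derivative_transform_within_open[OF _ open_K s]) (rule eq)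
  have 2: "((\<lambda>s. p s *\<^sub>R T s + q s *\<^sub>R N s) has_vector_derivative
      (p s *\<^sub>R (\<kappa> *\<^sub>R N s - \<Gamma> (F (0, s)) (T s) (T s)) + p' s *\<^sub>R T s) +
      (q s *\<^sub>R (- \<kappa> *\<^sub>R T s - \<Gamma> (F (0, s)) (T s) (N s)) + q' s *\<^sub>R N s)) (at s)"
    by (intro has_vector_derivative_add has_vector_derivative_scaleR T' N' p q s)
  show ?thesis
    unfolding pullback_cov_def vector_derivative_unique_at[OF 1 2] F_T[OF s] eq[OF s]
    by (simp add: \<Gamma>_simps algebra_simps)
qed

lemma curvature_along:
  assumes "s \<in> K" "Y = p *\<^sub>R T s + q *\<^sub>R N s"
  shows "curvature_tensor M c (F (0, s)) (V (0, s)) (X (0, s)) Y = (b 0 s * C) *\<^sub>R (p *\<^sub>R N s - q *\<^sub>R T s)"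
  unfolding F_T[OF assms(1)] F_V[OF assms(1)] assms(2)
  by (rule orthonormal_frame.curvature_frame[OF frame[OF assms(1)] curvature])

text \<open>As \<open>\<kappa>\<close> is constant, each derivative is a rotation by a right angle
  times \<open>\<kappa>\<close>, without terms in derivatives of \<open>\<kappa>\<close>.\<close>

lemma Ds_iterates:
  assumes "s \<in> K"
  shows "Ds X (0, s) = \<kappa> *\<^sub>R N s" "Ds (Ds X) (0, s) = (- \<kappa>\<^sup>2) *\<^sub>R T s"
    "Ds (Ds (Ds X)) (0, s) = (- (\<kappa> ^ 3)) *\<^sub>R N s"
proof -
  have 1: "Ds X (0, s) = \<kappa> *\<^sub>R N s" if s: "s \<in> K" for s
  proof -
    have "Ds X (0, s) = (0 - \<kappa> * 0) *\<^sub>R T s + (0 + \<kappa> * 1) *\<^sub>R N s"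
      by (rule Ds_frame[of X "\<lambda>_. 1" "\<lambda>_. 0" "\<lambda>_. 0" "\<lambda>_. 0", OF smooth_dF _ _ _ s])
        (simp_all add: F_T)
    then show ?thesis by simp
  qed
  have 2: "Ds (Ds X) (0, s) = (- \<kappa>\<^sup>2) *\<^sub>R T s" if s: "s \<in> K" for s
  proof -
    have "Ds (Ds X) (0, s) = (0 - \<kappa> * \<kappa>) *\<^sub>R T s + (0 + \<kappa> * 0) *\<^sub>R N s"
      by (rule Ds_frame[of "Ds X" "\<lambda>_. 0" "\<lambda>_. \<kappa>" "\<lambda>_. 0" "\<lambda>_. 0", OF smooth_D[OF smooth_dF] _ _ _ s])
        (simp_all add: 1)
    then show ?thesis by (simp add: power2_eq_square)
  qed
  have 3: "Ds (Ds (Ds X)) (0, s) = (- (\<kappa> ^ 3)) *\<^sub>R N s" if s: "s \<in> K" for s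
  proof -
    have "Ds (Ds (Ds X)) (0, s) = (0 - \<kappa> * 0) *\<^sub>R T s + (0 + \<kappa> * (- \<kappa>\<^sup>2)) *\<^sub>R N s"
      by (rule Ds_frame[of "Ds (Ds X)" "\<lambda>_. - \<kappa>\<^sup>2" "\<lambda>_. 0" "\<lambda>_. 0" "\<lambda>_. 0",
            OF smooth_D[OF smooth_D[OF smooth_dF]] _ _ _ s]) (simp_all add: 2)
    then show ?thesis by (simp add: power2_eq_square power3_eq_cube)
  qed
  show "Ds X (0, s) = \<kappa> *\<^sub>R N s" "Ds (Ds X) (0, s) = (- \<kappa>\<^sup>2) *\<^sub>R T s"
    "Ds (Ds (Ds X)) (0, s) = (- (\<kappa> ^ 3)) *\<^sub>R N s"
    using 1 2 3 assms by blast+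
qed

text \<open>\<open>Dt\<close> is moved inward past one \<open>Ds\<close> at a time, each exchange
  adding the curvature of V and T applied to the field at hand. The tangential component of the last
  stage is discarded, since the result will be paired with a multiple of \<open>N\<close>.\<close>

lemma Dt_iterates:
  assumes "s \<in> K"
  shows "g (F (0, s)) (Dt (Ds (Ds (Ds X))) (0, s)) (N s) =
    b 4 s + 4 * \<kappa> * a 3 s + (C - 6 * \<kappa>\<^sup>2) * b 2 s - 4 * \<kappa> ^ 3 * a 1 s + (\<kappa> ^ 4 - 3 * \<kappa>\<^sup>2 * C) * b 0 s"
proof -
  have a0: "(a 0 has_real_derivative a 1 s) (at s)" and a1: "(a 1 has_real_derivative a 2 s) (at s)"
    and a2: "(a 2 has_real_derivative a 3 s) (at s)" and a3: "(a 3 has_real_derivative a 4 s) (at s)"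
    and b0: "(b 0 has_real_derivative b 1 s) (at s)" and b1: "(b 1 has_real_derivative b 2 s) (at s)"
    and b2: "(b 2 has_real_derivative b 3 s) (at s)" and b3: "(b 3 has_real_derivative b 4 s) (at s)"
    if "s \<in> K" for s
    using a'[OF that, of 0] a'[OF that, of 1] a'[OF that, of 2] a'[OF that, of 3]
      b'[OF that, of 0] b'[OF that, of 1] b'[OF that, of 2] b'[OF that, of 3]
    by (simp_all add: numeral_eq_Suc)
  note ab' = a0 a1 a2 a3 b0 b1 b2 b3
  \<comment> \<open>Torsion-freeness replaces \<open>Dt X\<close> by \<open>Ds V\<close>, whose
    frame components are known.\<close>
  have Z1: "Dt X (0, s) = (a 1 s - \<kappa> * b 0 s) *\<^sub>R T s + (b 1 s + \<kappa> * a 0 s) *\<^sub>R N s" if s: "s \<in> K" for s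
    unfolding D_torsion_free[OF K_S[OF s], of "(1, 0)" "(0, 1)"]
    by (rule Ds_frame[OF smooth_dF F_V a0 b0 s])
  have Z2: "Dt (Ds X) (0, s) = (a 2 s - 2 * \<kappa> * b 1 s - \<kappa>\<^sup>2 * a 0 s) *\<^sub>R T s
      + (b 2 s + 2 * \<kappa> * a 1 s - \<kappa>\<^sup>2 * b 0 s + C * b 0 s) *\<^sub>R N s" if s: "s \<in> K" for s
  proof -
    have d: "Ds (Dt X) (0, s) = ((a 2 s - \<kappa> * b 1 s) - \<kappa> * (b 1 s + \<kappa> * a 0 s)) *\<^sub>R T s
        + ((b 2 s + \<kappa> * a 1 s) + \<kappa> * (a 1 s - \<kappa> * b 0 s)) *\<^sub>R N s"
      by (rule Ds_frame[OF smooth_D[OF smooth_dF] Z1 DERIV_diff[OF a1 DERIV_cmult[OF b0]]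
            DERIV_add[OF b1 DERIV_cmult[OF a0]] s])
    have R: "curvature_tensor M c (F (0, s)) (V (0, s)) (X (0, s)) (X (0, s)) =
        (b 0 s * C) *\<^sub>R (1 *\<^sub>R N s - 0 *\<^sub>R T s)"
      by (rule curvature_along[OF s]) (simp add: F_T[OF s])
    show ?thesis
      unfolding D_commute[where u = "(1, 0)" and v = "(0, 1)", OF smooth_dF K_S[OF s]] d R vec_eq_iff vector_add_component
        vector_minus_component vector_scaleR_component
      by (intro allI) (simp add: algebra_simps power2_eq_square power3_eq_cube power4_eq_xxxx)
  qed
  have Z3: "Dt (Ds (Ds X)) (0, s) = (a 3 s - 3 * \<kappa> * b 2 s - 3 * \<kappa>\<^sup>2 * a 1 s + \<kappa> ^ 3 * b 0 s - 2 * \<kappa> * C * b 0 s) *\<^sub>R T s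
      + (b 3 s + 3 * \<kappa> * a 2 s - 3 * \<kappa>\<^sup>2 * b 1 s + C * b 1 s - \<kappa> ^ 3 * a 0 s) *\<^sub>R N s" if s: "s \<in> K" for s
  proof -
    have d: "Ds (Dt (Ds X)) (0, s) = ((a 3 s - 2 * \<kappa> * b 2 s - \<kappa>\<^sup>2 * a 1 s)
          - \<kappa> * (b 2 s + 2 * \<kappa> * a 1 s - \<kappa>\<^sup>2 * b 0 s + C * b 0 s)) *\<^sub>R T s
        + ((b 3 s + 2 * \<kappa> * a 2 s - \<kappa>\<^sup>2 * b 1 s + C * b 1 s) + \<kappa> * (a 2 s - 2 * \<kappa> * b 1 s - \<kappa>\<^sup>2 * a 0 s)) *\<^sub>R N s"
      by (rule Ds_frame[OF smooth_D[OF smooth_D[OF smooth_dF]] Z2 _ _ s])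
        (auto intro!: DERIV_add DERIV_diff DERIV_cmult ab' simp del: One_nat_def)
    have R: "curvature_tensor M c (F (0, s)) (V (0, s)) (X (0, s)) (Ds X (0, s)) =
        (b 0 s * C) *\<^sub>R (0 *\<^sub>R N s - \<kappa> *\<^sub>R T s)"
      by (rule curvature_along[OF s]) (simp add: Ds_iterates[OF s])
    show ?thesis
      unfolding D_commute[where u = "(1, 0)" and v = "(0, 1)", OF smooth_D[OF smooth_dF] K_S[OF s]] d R vec_eq_iff vector_add_component
        vector_minus_component vector_scaleR_component
      by (intro allI) (simp add: algebra_simps power2_eq_square power3_eq_cube power4_eq_xxxx)
  qed
  have d: "Ds (Dt (Ds (Ds X))) (0, s) =
      ((a 4 s - 3 * \<kappa> * b 3 s - 3 * \<kappa>\<^sup>2 * a 2 s + \<kappa> ^ 3 * b 1 s - 2 * \<kappa> * C * b 1 s)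
        - \<kappa> * (b 3 s + 3 * \<kappa> * a 2 s - 3 * \<kappa>\<^sup>2 * b 1 s + C * b 1 s - \<kappa> ^ 3 * a 0 s)) *\<^sub>R T s
      + ((b 4 s + 3 * \<kappa> * a 3 s - 3 * \<kappa>\<^sup>2 * b 2 s + C * b 2 s - \<kappa> ^ 3 * a 1 s)
        + \<kappa> * (a 3 s - 3 * \<kappa> * b 2 s - 3 * \<kappa>\<^sup>2 * a 1 s + \<kappa> ^ 3 * b 0 s - 2 * \<kappa> * C * b 0 s)) *\<^sub>R N s"
    by (rule Ds_frame[OF smooth_D[OF smooth_D[OF smooth_D[OF smooth_dF]]] Z3 _ _ assms])
      (auto intro!: DERIV_add DERIV_diff DERIV_cmult ab' simp del: One_nat_def)
  \<comment> \<open>This contributes - \<kappa>^2 C b to the normal part. The tangential term - 2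
    \<kappa> C b of \<open>Z3\<close>, rotated by one more \<open>Ds\<close>, contributes twice as
    much; together they form the coefficient - 3 \<kappa>^2 C.\<close>
  have R: "curvature_tensor M c (F (0, s)) (V (0, s)) (X (0, s)) (Ds (Ds X) (0, s)) =
      (b 0 s * C) *\<^sub>R ((- \<kappa>\<^sup>2) *\<^sub>R N s - 0 *\<^sub>R T s)"
    by (rule curvature_along[OF assms]) (simp add: Ds_iterates[OF assms])
  interpret O: orthonormal_frame M c "F (0, s)" "T s" "N s" by (rule frame[OF assms])
  show ?thesis
    unfolding D_commute[where u = "(1, 0)" and v = "(0, 1)", OF smooth_D[OF smooth_D[OF smooth_dF]] K_S[OF assms]] d R g_simps O.TN O.NN
    by (simp add: algebra_simps power2_eq_square power3_eq_cube power4_eq_xxxx)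
qed

text \<open>By metric compatibility the derivative is twice the pairing of the field with its
  t-derivative, and at t = 0 the field is - \<kappa>^3 N.\<close>

lemma energy_density_derivative:
  assumes "s \<in> K"
  shows "frechet_derivative (\<lambda>p. g (F p) (Ds (Ds (Ds X)) p) (Ds (Ds (Ds X)) p)) (at (0, s)) (1, 0) =
    - 2 * \<kappa> ^ 3 * (b 4 s + 4 * \<kappa> * a 3 s + (C - 6 * \<kappa>\<^sup>2) * b 2 s - 4 * \<kappa> ^ 3 * a 1 s
      + (\<kappa> ^ 4 - 3 * \<kappa>\<^sup>2 * C) * b 0 s)"
proof -
  have W: "smooth_on S (Ds (Ds (Ds X)))" by (intro smooth_D smooth_dF)
  show ?thesis
    unfolding D_metric[OF W W K_S[OF assms]] Ds_iterates(3)[OF assms]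
    using Dt_iterates[OF assms] g_sym[OF F_U[OF K_S[OF assms]], of "N s" "Dt (Ds (Ds (Ds X))) (0, s)"]
    by (simp add: g_simps)
qed

end

section \<open>Smooth maps into a manifold\<close>

lemma smooth_into_open_preimage:
  assumes "open S" "smooth_into M S F" "smooth_manifold M" "c \<in> atlas M"
  shows "open {p \<in> S. F p \<in> cdom c}"
proof -
  have "openin (mtop M) (cdom c)" using assms unfolding smooth_manifold_def is_chart_def by blast
  then have "openin (top_of_set S) {p \<in> topspace (top_of_set S). F p \<in> cdom c}"
    using assms(2) openin_continuous_map_preimage unfolding smooth_into_def by blast
  then show ?thesis using openin_open_trans[OF _ assms(1)] by simp
qed

lemma smooth_into_cong:
  assumes S: "open S" and F: "smooth_into M S F" and eq: "\<And>p. p \<in> S \<Longrightarrow> F p = G p"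
    and M: "smooth_manifold M"
  shows "smooth_into M S G"
  unfolding smooth_into_def
proof (intro conjI ballI)
  show "continuous_map (top_of_set S) (mtop M) G"
  proof (rule continuous_map_eq)
    show "continuous_map (top_of_set S) (mtop M) F" using F unfolding smooth_into_def by blast
  qed (simp add: eq)
next
  fix c assume c: "c \<in> atlas M"
  have sets: "{p \<in> S. G p \<in> cdom c} = {p \<in> S. F p \<in> cdom c}" using eq by auto
  have o: "open {p \<in> S. F p \<in> cdom c}" by (rule smooth_into_open_preimage[OF S F M c])
  have "smooth_on {p \<in> S. F p \<in> cdom c} (coord c \<circ> F)" using F c unfolding smooth_into_def by blast
  then show "smooth_on {p \<in> S. G p \<in> cdom c} (coord c \<circ> G)"
    unfolding sets
  proof (rule iffD1[OF smooth_on_cong[OF o], rotated])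
    show "(coord c \<circ> F) p = (coord c \<circ> G) p" if "p \<in> {p \<in> S. F p \<in> cdom c}" for p
      using that eq by simp
  qed
qed

text \<open>Needed to glue a variation defined through a chart to the unvaried curve
  elsewhere.\<close>

lemma smooth_into_Un:
  assumes A: "open A" "smooth_into M A F" and B: "open B" "smooth_into M B F" and M: "smooth_manifold M"
  shows "smooth_into M (A \<union> B) F"
proof -
  have cont: "continuous_map (top_of_set (A \<union> B)) (mtop M) F"
    unfolding continuous_map_def
  proof (intro conjI allI impI)
    show "F \<in> topspace (top_of_set (A \<union> B)) \<rightarrow> topspace (mtop M)"
      using continuous_map_funspace[of "top_of_set A" "mtop M" F] continuous_map_funspace[of "top_of_set B" "mtop M" F]
        A(2) B(2) unfolding smooth_into_def by (simp add: Pi_iff) blast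
  next
    fix V assume V: "openin (mtop M) V"
    have "open {p \<in> S. F p \<in> V}" if "open S" "smooth_into M S F" for S
    proof -
      have "openin (top_of_set S) {p \<in> topspace (top_of_set S). F p \<in> V}"
        using that(2) V openin_continuous_map_preimage unfolding smooth_into_def by blast
      then show ?thesis using openin_open_trans[OF _ that(1)] by simp
    qed
    then have "open {p \<in> A. F p \<in> V}" "open {p \<in> B. F p \<in> V}" using A B by blast+
    then have "open ({p \<in> A. F p \<in> V} \<union> {p \<in> B. F p \<in> V})" by (rule open_Un)
    moreover have "{p \<in> topspace (top_of_set (A \<union> B)). F p \<in> V} = {p \<in> A. F p \<in> V} \<union> {p \<in> B. F p \<in> V}"
      by auto
    ultimately have "open {p \<in> topspace (top_of_set (A \<union> B)). F p \<in> V}" by (simp only:)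
    then show "openin (top_of_set (A \<union> B)) {p \<in> topspace (top_of_set (A \<union> B)). F p \<in> V}"
      by (rule open_subset[rotated]) auto
  qed
  show ?thesis
    unfolding smooth_into_def
  proof (intro conjI ballI cont)
    fix c assume c: "c \<in> atlas M"
    let ?A = "{p \<in> A. F p \<in> cdom c}" and ?B = "{p \<in> B. F p \<in> cdom c}"
    have o: "open ?A" "open ?B"
      using smooth_into_open_preimage[OF A M c] smooth_into_open_preimage[OF B M c] by blast+
    have AB: "{p \<in> A \<union> B. F p \<in> cdom c} = ?A \<union> ?B" by auto
    have s: "smooth_on ?A (coord c \<circ> F)" "smooth_on ?B (coord c \<circ> F)"
      using A(2) B(2) c unfolding smooth_into_def by blast+
    show "smooth_on {p \<in> A \<union> B. F p \<in> cdom c} (coord c \<circ> F)"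
      unfolding AB
    proof (rule smooth_on_local)
      show "open (?A \<union> ?B)" using o by (rule open_Un)
      fix p assume "p \<in> ?A \<union> ?B"
      then consider "p \<in> ?A" | "p \<in> ?B" by blast
      then show "\<exists>U. open U \<and> p \<in> U \<and> smooth_on (U \<inter> (?A \<union> ?B)) (coord c \<circ> F)"
      proof cases
        case 1
        then show ?thesis using o(1) s(1) by (intro exI[of _ ?A]) (simp add: Int_absorb2)
      next
        case 2
        then show ?thesis using o(2) s(2) by (intro exI[of _ ?B]) (simp add: Int_absorb2)
      qed
    qed
  qed
qed

lemma smooth_into_compose:
  fixes h :: "'v::real_normed_vector \<Rightarrow> 'w::euclidean_space"
  assumes A: "open A" and h: "smooth_on A h" "\<And>p. p \<in> A \<Longrightarrow> h p \<in> B"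
    and F: "open B" "smooth_into M B F" and M: "smooth_manifold M"
  shows "smooth_into M A (\<lambda>p. F (h p))"
  unfolding smooth_into_def
proof (intro conjI ballI)
  have c: "continuous_map (top_of_set A) (top_of_set B) h"
    using smooth_on_continuous[OF h(1)] h(2) by (auto simp: continuous_map_in_subtopology)
  then show "continuous_map (top_of_set A) (mtop M) (\<lambda>p. F (h p))"
    using continuous_map_compose[OF c, of "mtop M" F] F(2) unfolding smooth_into_def comp_def by blast
next
  fix c assume c: "c \<in> atlas M"
  let ?B = "{q \<in> B. F q \<in> cdom c}" and ?A = "{p \<in> A. F (h p) \<in> cdom c}"
  have oB: "open ?B" by (rule smooth_into_open_preimage[OF F M c])
  have "open (h -` ?B \<inter> A)"
    using iffD1[OF continuous_on_open_vimage[OF A] smooth_on_continuous[OF h(1)]] oB by blast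
  moreover have eqA: "?A = h -` ?B \<inter> A" using h(2) by auto
  ultimately have oA: "open ?A" by simp
  have "smooth_on ?A (\<lambda>p. (coord c \<circ> F) (h p))"
  proof (rule smooth_on_compose[OF oA oB])
    show "smooth_on ?B (coord c \<circ> F)" using F(2) c unfolding smooth_into_def by blast
    show "smooth_on ?A h" by (rule smooth_on_subset[OF h(1)]) blast
    show "h p \<in> ?B" if "p \<in> ?A" for p using that h(2) by blast
  qed
  then show "smooth_on ?A (coord c \<circ> (\<lambda>p. F (h p)))" by (simp add: comp_def)
qed

context riemannian_chart
begin

abbreviation coord_inv where "coord_inv \<equiv> inv_into (cdom c) (coord c)"

lemma smooth_manifold: "smooth_manifold M"
  using manifold unfolding riemannian_manifold_def by blast

lemma inj_on_coord: "inj_on (coord c) (cdom c)"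
proof -
  interpret chart_pair M c c by unfold_locales
  show ?thesis by (rule inj_coord)
qed

lemma continuous_map_coord_inv: "continuous_map (top_of_set U) (mtop M) coord_inv"
proof -
  have "is_chart (mtop M) c" using smooth_manifold chart unfolding smooth_manifold_def by blast
  then have h: "homeomorphic_map (subtopology (mtop M) (cdom c)) (top_of_set U) (coord c)"
    and sub: "cdom c \<subseteq> topspace (mtop M)"
    using openin_subset unfolding is_chart_def by blast+
  from h obtain k where k: "homeomorphic_maps (subtopology (mtop M) (cdom c)) (top_of_set U) (coord c) k"
    using homeomorphic_map_maps by metis
  have "topspace (subtopology (mtop M) (cdom c)) = cdom c"
    using sub by (simp add: topspace_subtopology Int_absorb1)
  then have kc: "k (coord c p) = p" if "p \<in> cdom c" for p
    using k that unfolding homeomorphic_maps_def by simp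
  have ck: "continuous_map (top_of_set U) (subtopology (mtop M) (cdom c)) k"
    using k unfolding homeomorphic_maps_def by (elim conjE)
  have "continuous_map (top_of_set U) (mtop M) k"
    by (rule continuous_map_into_fulltopology[OF ck])
  moreover have "k y = coord_inv y" if "y \<in> U" for y
  proof -
    obtain p where p: "p \<in> cdom c" "y = coord c p" using \<open>y \<in> U\<close> by blast
    show ?thesis unfolding p(2) kc[OF p(1)] inv_into_f_f[OF inj_on_coord p(1)] ..
  qed
  ultimately show ?thesis
    by (rule continuous_map_eq) simp
qed

text \<open>Read in another chart, the map is the transition map after \<open>F\<close>, on the open
  set where \<open>F\<close> meets the overlap.\<close>

lemma smooth_into_coord_inv:
  assumes S: "open S" and F: "smooth_on S F" "\<And>p. p \<in> S \<Longrightarrow> F p \<in> U"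
  shows "smooth_into M S (\<lambda>p. coord_inv (F p))"
  unfolding smooth_into_def
proof (intro conjI ballI)
  have 1: "continuous_map (top_of_set S) (top_of_set U) F"
    using smooth_on_continuous[OF F(1)] F(2) by (auto simp: continuous_map_in_subtopology)
  show "continuous_map (top_of_set S) (mtop M) (\<lambda>p. coord_inv (F p))"
    using continuous_map_compose[OF 1 continuous_map_coord_inv] unfolding comp_def .
next
  fix d assume d: "d \<in> atlas M"
  interpret chart_pair M c d by unfold_locales (use d manifold in auto)
  let ?S = "{p \<in> S. coord_inv (F p) \<in> cdom d}"
  have eq: "?S = F -` overlap \<inter> S"
  proof -
    have "coord_inv (F p) \<in> cdom d \<longleftrightarrow> F p \<in> overlap" if "p \<in> S" for p
    proof -
      obtain q where q: "q \<in> cdom c" "F p = coord c q" using F(2)[OF \<open>p \<in> S\<close>] by blast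
      have "coord c q \<in> overlap \<longleftrightarrow> q \<in> cdom d"
        using inj_on_image_mem_iff[OF inj_coord q(1), of "cdom c \<inter> cdom d"] q(1) by blast
      then show ?thesis unfolding q(2) inv_into_f_f[OF inj_coord q(1)] by blast
    qed
    then show ?thesis by blast
  qed
  have o: "open ?S"
    unfolding eq
    using iffD1[OF continuous_on_open_vimage[OF S] smooth_on_continuous[OF F(1)]] open_overlap by blast
  have "smooth_on ?S (\<lambda>p. \<phi> (F p))"
  proof (rule smooth_on_compose[OF o open_overlap smooth_\<phi>])
    show "smooth_on ?S F" by (rule smooth_on_subset[OF F(1)]) blast
    show "F p \<in> overlap" if "p \<in> ?S" for p using that unfolding eq by blast
  qed
  then show "smooth_on ?S (coord d \<circ> (\<lambda>p. coord_inv (F p)))"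
    unfolding transition_def comp_def .
qed

end

section \<open>Variations of a curve of constant curvature inside a chart\<close>

locale frenet_curve =
  fixes M :: "('a, 2) riemannian_structure" and I :: "real set" and \<gamma> :: "real \<Rightarrow> 'a"
    and \<nu> :: "('a, 2) field_along" and \<kappa> C :: real
  assumes manifold: "riemannian_manifold M" and curvature: "constant_sectional_curvature M C"
    and open_I: "open I" and smooth_\<gamma>: "smooth_into M I \<gamma>"
    and smooth_\<nu>: "smooth_field_along M I \<gamma> \<nu>"
    and unit_velocity: "s \<in> I \<Longrightarrow> inner_along M \<gamma> (velocity \<gamma>) (velocity \<gamma>) s = 1"
    and unit_normal: "s \<in> I \<Longrightarrow> inner_along M \<gamma> \<nu> \<nu> s = 1"
    and orthogonal: "s \<in> I \<Longrightarrow> inner_along M \<gamma> (velocity \<gamma>) \<nu> s = 0"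
    and D_velocity: "field_eq_on M I \<gamma> (cov_deriv M \<gamma> (velocity \<gamma>)) (\<lambda>c s. \<kappa> *\<^sub>R \<nu> c s)"
    and D_normal: "field_eq_on M I \<gamma> (cov_deriv M \<gamma> \<nu>) (\<lambda>c s. - \<kappa> *\<^sub>R velocity \<gamma> c s)"

sublocale frenet_curve \<subseteq> curve_in M I \<gamma>
  by unfold_locales (rule manifold open_I smooth_\<gamma>)+

locale frenet_chart = frenet_curve + riemannian_chart M c for c +
  fixes K :: "real set"
  assumes open_K: "open K" and K_I: "K \<subseteq> I" and K_dom: "s \<in> K \<Longrightarrow> \<gamma> s \<in> cdom c"
begin

abbreviation x where "x \<equiv> coord c \<circ> \<gamma>"
abbreviation T where "T \<equiv> velocity \<gamma> c"
abbreviation N where "N \<equiv> \<nu> c"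

lemma K_dom': "K \<subseteq> dom c" using K_dom K_I by blast

lemma x_U: "s \<in> K \<Longrightarrow> x s \<in> U" using K_dom by simp

lemma smooth_x: "smooth_on K x"
  by (rule smooth_on_subset[OF smooth_coord[OF chart] K_dom'])

lemma smooth_T: "smooth_on K T"
  using smooth_velocity chart smooth_on_subset[OF _ K_dom'] unfolding smooth_field_along_def by blast

lemma smooth_N: "smooth_on K N"
  using smooth_\<nu> chart smooth_on_subset[OF _ K_dom'] unfolding smooth_field_along_def by blast

lemma frame: assumes "s \<in> K" shows "orthonormal_frame M c (x s) (T s) (N s)"
proof -
  have s: "s \<in> I" "\<gamma> s \<in> cdom c" using K_dom K_I assms by auto
  show ?thesis
    using inner_along_eq[OF smooth_velocity smooth_velocity chart s] unit_velocity[OF s(1)]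
      inner_along_eq[OF smooth_\<nu> smooth_\<nu> chart s] unit_normal[OF s(1)]
      inner_along_eq[OF smooth_velocity smooth_\<nu> chart s] orthogonal[OF s(1)] x_U[OF assms]
    by unfold_locales simp_all
qed

lemma frechet_x: "s \<in> K \<Longrightarrow> frechet_derivative x (at s) 1 = T s"
  using velocity_eq[OF chart] K_dom' by auto

lemma cov_deriv_vector_derivative:
  assumes "s \<in> K" "V c differentiable (at s)"
  shows "(V c has_vector_derivative cov_deriv M \<gamma> V c s - \<Gamma> (x s) (T s) (V c s)) (at s)"
proof -
  have "cov_deriv M \<gamma> V c s = frechet_derivative (V c) (at s) 1 + \<Gamma> (x s) (T s) (V c s)"
    using cov_deriv_eq[of c s V, OF chart _ assms(2)] K_dom' assms(1) frechet_x[OF assms(1)]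
    by (auto simp: pullback_cov_def)
  moreover have "(V c has_vector_derivative frechet_derivative (V c) (at s) 1) (at s)"
    using assms(2) vector_derivative_works vector_derivative_eq_frechet by metis
  ultimately show ?thesis by simp
qed

lemma T_derivative: "s \<in> K \<Longrightarrow> (T has_vector_derivative \<kappa> *\<^sub>R N s - \<Gamma> (x s) (T s) (T s)) (at s)"
  using cov_deriv_vector_derivative[of s "velocity \<gamma>"] smooth_on_differentiable[OF smooth_T]
    D_velocity K_I K_dom chart unfolding field_eq_on_def by fastforce

lemma N_derivative: "s \<in> K \<Longrightarrow> (N has_vector_derivative - \<kappa> *\<^sub>R T s - \<Gamma> (x s) (T s) (N s)) (at s)"
  using cov_deriv_vector_derivative[of s \<nu>] smooth_on_differentiable[OF smooth_N]
    D_normal K_I K_dom chart unfolding field_eq_on_def by fastforce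

end

locale frenet_variation = frenet_chart M I \<gamma> \<nu> \<kappa> C c K
  for M :: "('a, 2) riemannian_structure" and I \<gamma> \<nu> \<kappa> C c K +
  fixes \<alpha> \<beta> \<epsilon> :: real and a b :: "real \<Rightarrow> real"
  assumes \<alpha>\<beta>: "\<alpha> < \<beta>" "{\<alpha>..\<beta>} \<subseteq> K" and a: "smooth_on UNIV a" and b: "smooth_on UNIV b"
    and support: "s \<notin> {\<alpha>..\<beta>} \<Longrightarrow> a s = 0" "s \<notin> {\<alpha>..\<beta>} \<Longrightarrow> b s = 0"
    and \<epsilon>: "0 < \<epsilon>" "\<bar>t\<bar> < \<epsilon> \<Longrightarrow> s \<in> K \<Longrightarrow> x s + t *\<^sub>R (a s *\<^sub>R T s + b s *\<^sub>R N s) \<in> U"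
begin

definition V where "V s = a s *\<^sub>R T s + b s *\<^sub>R N s"
text \<open>A straight line in coordinates is enough, because the first variation depends on the
  field \<open>V\<close> alone; the bound \<open>\<epsilon>\<close> keeps it in the image of the
  chart.\<close>

definition F where "F p = x (snd p) + fst p *\<^sub>R V (snd p)"
definition S where "S = {-\<epsilon><..<\<epsilon>} \<times> K"
text \<open>The two branches are compatible: \<open>V\<close> vanishes off the support, so on K
  outside the support the first branch is the original curve as well.\<close>

definition \<Phi> where "\<Phi> t s = (if s \<in> K then coord_inv (F (t, s)) else \<gamma> s)"

lemma open_S: "open S" unfolding S_def by (intro open_Times open_K open_greaterThanLessThan)

lemma smooth_V: "smooth_on K V"
  unfolding V_def[abs_def]
  by (rule smooth_on_add[OF open_K smooth_on_scaleR[OF open_K smooth_on_subset[OF a] smooth_T]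
        smooth_on_scaleR[OF open_K smooth_on_subset[OF b] smooth_N]]) auto

lemma smooth_F: "smooth_on S F"
proof -
  have c: "smooth_on S (\<lambda>p. h (snd p))" if "smooth_on K h" for h :: "real \<Rightarrow> real ^ 2"
    by (rule smooth_on_compose[OF open_S open_K that smooth_on_snd]) (auto simp: S_def)
  show ?thesis
    unfolding F_def[abs_def]
    by (rule smooth_on_add[OF open_S c[OF smooth_x] smooth_on_scaleR[OF open_S smooth_on_fst c[OF smooth_V]]])
qed

lemma F_U: "p \<in> S \<Longrightarrow> F p \<in> U"
  using \<epsilon>(2)[of "fst p" "snd p"] by (auto simp: F_def V_def S_def abs_if)

lemma F_derivative:
  assumes "s \<in> K"
  shows "frechet_derivative F (at (0, s)) (h, k) = k *\<^sub>R T s + h *\<^sub>R V s"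
proof -
  have dx: "(x has_derivative frechet_derivative x (at s)) (at s)"
    and dV: "(V has_derivative frechet_derivative V (at s)) (at s)"
    using smooth_on_frechet[OF smooth_x assms] smooth_on_frechet[OF smooth_V assms] by auto
  have sn: "(snd has_derivative snd) (at (0::real, s))" and fs: "(fst has_derivative fst) (at (0::real, s))"
    by (rule bounded_linear_imp_has_derivative[OF bounded_linear_snd]
        bounded_linear_imp_has_derivative[OF bounded_linear_fst])+
  have "((\<lambda>p. x (snd p)) has_derivative (\<lambda>e. frechet_derivative x (at s) (snd e))) (at (0::real, s))"
    using has_derivative_compose[OF sn, of x] dx by simp
  moreover have "((\<lambda>p. V (snd p)) has_derivative (\<lambda>e. frechet_derivative V (at s) (snd e))) (at (0::real, s))"
    using has_derivative_compose[OF sn, of V] dV by simp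
  ultimately have "((\<lambda>p. x (snd p) + fst p *\<^sub>R V (snd p)) has_derivative (\<lambda>e. frechet_derivative x (at s) (snd e) +
      (fst (0::real, s) *\<^sub>R frechet_derivative V (at s) (snd e) + fst e *\<^sub>R V (snd (0::real, s))))) (at (0, s))"
    by (intro has_derivative_add has_derivative_scaleR fs)
  from fun_cong[OF frechet_derivative_at[OF this], of "(h, k)"]
  have "frechet_derivative F (at (0, s)) (h, k) = frechet_derivative x (at s) k + h *\<^sub>R V s"
    unfolding F_def[abs_def] by simp
  moreover have "frechet_derivative x (at s) (k *\<^sub>R 1) = k *\<^sub>R T s"
    using linear_scale[OF linear_frechet_derivative[OF smooth_on_differentiable[OF smooth_x assms]], of k 1]
      frechet_x[OF assms] by simp
  ultimately show ?thesis by simp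
qed

sublocale var: surface_variation M c F S T N "\<lambda>n. (deriv ^^ n) a" "\<lambda>n. (deriv ^^ n) b" K \<kappa> C
proof (intro surface_variation.intro surface_variation_axioms.intro chart_map.intro chart_map_axioms.intro)
  show "riemannian_chart M c" by (rule riemannian_chart_axioms)
  show "constant_sectional_curvature M C" by (rule curvature)
  show "open S" by (rule open_S)
  show "smooth_on S F" by (rule smooth_F)
  show "F p \<in> U" if "p \<in> S" for p by (rule F_U[OF that])
  show "open K" by (rule open_K)
  have F0: "F (0, s) = x s" for s by (simp add: F_def)
  fix s assume s: "s \<in> K"
  show "(0, s) \<in> S" using s \<epsilon>(1) by (simp add: S_def)
  show "frechet_derivative F (at (0, s)) (0, 1) = T s" by (simp add: F_derivative[OF s])
  show "frechet_derivative F (at (0, s)) (1, 0) = (deriv ^^ 0) a s *\<^sub>R T s + (deriv ^^ 0) b s *\<^sub>R N s"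
    by (simp add: F_derivative[OF s] V_def)
  show "orthonormal_frame M c (F (0, s)) (T s) (N s)" unfolding F0 by (rule frame[OF s])
  show "(T has_vector_derivative \<kappa> *\<^sub>R N s - \<Gamma> (F (0, s)) (T s) (T s)) (at s)"
    unfolding F0 by (rule T_derivative[OF s])
  show "(N has_vector_derivative - \<kappa> *\<^sub>R T s - \<Gamma> (F (0, s)) (T s) (N s)) (at s)"
    unfolding F0 by (rule N_derivative[OF s])
  show "((deriv ^^ n) a has_real_derivative (deriv ^^ Suc n) a s) (at s)" for n
    using smooth_on_has_deriv[OF smooth_on_higher_deriv[OF open_UNIV a]] by simp
  show "((deriv ^^ n) b has_real_derivative (deriv ^^ Suc n) b s) (at s)" for n
    using smooth_on_has_deriv[OF smooth_on_higher_deriv[OF open_UNIV b]] by simp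
qed

lemma coord_inv_x: "s \<in> K \<Longrightarrow> coord_inv (x s) = \<gamma> s"
  using inv_into_f_f[OF inj_on_coord K_dom] by simp

lemma \<Phi>_outside: "s \<notin> {\<alpha>..\<beta>} \<Longrightarrow> \<Phi> t s = \<gamma> s"
  using coord_inv_x[of s] support[of s] by (simp add: \<Phi>_def F_def V_def)

lemma \<Phi>_0: "\<Phi> 0 s = \<gamma> s"
  using coord_inv_x[of s] by (simp add: \<Phi>_def F_def)

lemma \<Phi>_K:
  assumes "(t, s) \<in> S"
  shows "\<Phi> t s \<in> cdom c" "coord c (\<Phi> t s) = F (t, s)"
proof -
  have "s \<in> K" using assms by (simp add: S_def)
  then show "\<Phi> t s \<in> cdom c" "coord c (\<Phi> t s) = F (t, s)"
    using inv_into_into[OF F_U[OF assms]] f_inv_into_f[OF F_U[OF assms]] by (simp_all add: \<Phi>_def)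
qed

text \<open>Two open pieces cover the strip: over \<open>K\<close> the map is given by the chart,
  and off the closed support it is the curve itself.\<close>

lemma smooth_into_\<Phi>: "smooth_into M ({-\<epsilon><..<\<epsilon>} \<times> I) (\<lambda>(t, s). \<Phi> t s)"
proof -
  have A: "smooth_into M S (\<lambda>p. case p of (t, s) \<Rightarrow> \<Phi> t s)"
    by (rule smooth_into_cong[OF open_S smooth_into_coord_inv[OF open_S smooth_F F_U] _ smooth_manifold])
      (auto simp: \<Phi>_def S_def)
  let ?B = "{-\<epsilon><..<\<epsilon>} \<times> (I - {\<alpha>..\<beta>})"
  have oB: "open ?B" by (intro open_Times open_Diff open_I closed_atLeastAtMost open_greaterThanLessThan)
  have "smooth_into M ?B (\<lambda>p. \<gamma> (snd p))"
    by (rule smooth_into_compose[OF oB smooth_on_snd _ open_I smooth_\<gamma> smooth_manifold]) auto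
  then have B: "smooth_into M ?B (\<lambda>p. case p of (t, s) \<Rightarrow> \<Phi> t s)"
    by (rule smooth_into_cong[OF oB _ _ smooth_manifold]) (use \<Phi>_outside in auto)
  have "S \<union> ?B = {-\<epsilon><..<\<epsilon>} \<times> I" unfolding S_def using K_I \<alpha>\<beta>(2) by blast
  then show ?thesis using smooth_into_Un[OF open_S A oB B smooth_manifold] by simp
qed

lemma smooth_variation_\<Phi>: "smooth_variation M I {\<alpha>..\<beta>} \<gamma> \<Phi>"
  unfolding smooth_variation_def using \<Phi>_0 \<Phi>_outside \<epsilon>(1) smooth_into_\<Phi> by blast

text \<open>Restriction to fixed t commutes with the derivative in s. This links the energy, defined
  curve by curve, with the calculus in two parameters.\<close>

lemma pullback_cov_slice:
  assumes Y: "smooth_on S Y" and p: "(t, s) \<in> S"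
  shows "pullback_cov M c (\<lambda>s. F (t, s)) 1 (\<lambda>s. Y (t, s)) s = var.Ds Y (t, s)"
proof -
  have i: "((\<lambda>s. (t, s)) has_derivative (\<lambda>r. (0, r))) (at s)"
    by (auto intro!: derivative_eq_intros)
  have "frechet_derivative (\<lambda>s. G (t, s)) (at s) 1 = frechet_derivative G (at (t, s)) (0, 1)"
    if "smooth_on S G" for G :: "real \<times> real \<Rightarrow> real ^ 2"
  proof -
    have "((\<lambda>s. G (t, s)) has_derivative (\<lambda>r. frechet_derivative G (at (t, s)) (0, r))) (at s)"
      using has_derivative_compose[OF i, of G] smooth_on_frechet[OF that p] by simp
    from fun_cong[OF frechet_derivative_at[OF this], of 1] show ?thesis by simp
  qed
  then show ?thesis using Y smooth_F by (simp add: pullback_cov_def)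
qed

definition W where "W = var.Ds (var.Ds (var.Ds var.X))"

lemma smooth_W: "smooth_on S W"
  unfolding W_def by (intro var.smooth_D var.smooth_dF)

text \<open>In the chart the curve \<open>\<Phi> t\<close> is the slice of \<open>F\<close> at t, so
  the three covariant derivatives are translated one after another. Each translation is proved on
  all of \<open>K\<close>, since the next derivative needs it near the point.\<close>

lemma bilaplacian_\<Phi>:
  assumes t: "\<bar>t\<bar> < \<epsilon>" and s: "s \<in> K"
  shows "inner_along M (\<Phi> t) (rough_laplacian M (\<Phi> t) (tension M (\<Phi> t)))
    (rough_laplacian M (\<Phi> t) (tension M (\<Phi> t))) s = g (F (t, s)) (W (t, s)) (W (t, s))"
proof -
  have K_S: "(t, s) \<in> S" if "s \<in> K" for s using that t by (auto simp: S_def abs_if split: if_splits)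
  have "smooth_on K (\<lambda>s. (t, s))"
    by (rule smooth_on_Pair[OF open_K smooth_on_const smooth_on_bounded_linear[OF bounded_linear_ident]])
  then have "smooth_into M K (\<lambda>s. (\<lambda>(t, s). \<Phi> t s) (t, s))"
    by (rule smooth_into_compose[OF open_K _ _ _ smooth_into_\<Phi> smooth_manifold])
      (use K_S K_I open_I in \<open>auto simp: S_def intro: open_Times\<close>)
  then interpret \<sigma>: curve_in M K "\<Phi> t"
    by unfold_locales (use manifold open_K in auto)
  have dom: "s \<in> \<sigma>.dom c" if "s \<in> K" for s using \<Phi>_K(1)[OF K_S[OF that]] that by simp
  have slice: "cov_deriv M (\<Phi> t) X c s = var.Ds Y (t, s)"
    if s: "s \<in> K" and Y: "smooth_on S Y" and X: "\<And>s. s \<in> K \<Longrightarrow> X c s = Y (t, s)" for X Y s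
  proof -
    have dY: "(\<lambda>s. Y (t, s)) differentiable (at s)"
      by (rule smooth_on_differentiable[OF smooth_on_compose[OF open_K open_S Y \<open>smooth_on K (\<lambda>s. (t, s))\<close> K_S] s])
    then have dX: "X c differentiable (at s)"
      using differentiable_cong_open[OF open_K s, of "X c" "\<lambda>s. Y (t, s)"] X by simp
    have "cov_deriv M (\<Phi> t) X c s = pullback_cov M c (coord c \<circ> \<Phi> t) 1 (X c) s"
      by (rule \<sigma>.cov_deriv_eq[of c s X, OF chart dom[OF s] dX])
    also have "\<dots> = pullback_cov M c (\<lambda>s. F (t, s)) 1 (\<lambda>s. Y (t, s)) s"
      using frechet_derivative_cong_open[OF open_K s, of "X c" "\<lambda>s. Y (t, s)"] X s
        frechet_derivative_cong_open[OF open_K s, of "coord c \<circ> \<Phi> t" "\<lambda>s. F (t, s)"] \<Phi>_K(2)[OF K_S]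
      by (simp add: pullback_cov_def)
    finally show ?thesis using pullback_cov_slice[OF Y K_S[OF s]] by simp
  qed
  have 0: "velocity (\<Phi> t) c s = var.X (t, s)" if s: "s \<in> K" for s
  proof -
    have "velocity (\<Phi> t) c s = frechet_derivative (\<lambda>s. F (t, s)) (at s) 1"
      using \<sigma>.velocity_eq[OF chart dom[OF s]] \<Phi>_K(2)[OF K_S]
        frechet_derivative_cong_open[OF open_K s, of "coord c \<circ> \<Phi> t" "\<lambda>s. F (t, s)"] by simp
    also have "\<dots> = frechet_derivative F (at (t, s)) (0, 1)"
    proof -
      have i: "((\<lambda>s. (t, s)) has_derivative (\<lambda>r. (0, r))) (at s)"
        by (auto intro!: derivative_eq_intros)
      have "((\<lambda>s. F (t, s)) has_derivative (\<lambda>r. frechet_derivative F (at (t, s)) (0, r))) (at s)"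
        using has_derivative_compose[OF i, of F] smooth_on_frechet[OF smooth_F K_S[OF s]] by simp
      from fun_cong[OF frechet_derivative_at[OF this], of 1] show ?thesis by simp
    qed
    finally show ?thesis .
  qed
  have 1: "cov_deriv M (\<Phi> t) (velocity (\<Phi> t)) c s = var.Ds var.X (t, s)" if "s \<in> K" for s
    by (rule slice[of _ var.X "velocity (\<Phi> t)", OF that var.smooth_dF 0])
  have 2: "cov_deriv M (\<Phi> t) (cov_deriv M (\<Phi> t) (velocity (\<Phi> t))) c s = var.Ds (var.Ds var.X) (t, s)"
    if "s \<in> K" for s
    by (rule slice[of _ "var.Ds var.X" "cov_deriv M (\<Phi> t) (velocity (\<Phi> t))",
          OF that var.smooth_D[OF var.smooth_dF] 1])
  have 3: "cov_deriv M (\<Phi> t) (cov_deriv M (\<Phi> t) (cov_deriv M (\<Phi> t) (velocity (\<Phi> t)))) c s =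
      var.Ds (var.Ds (var.Ds var.X)) (t, s)" if "s \<in> K" for s
    by (rule slice[of _ "var.Ds (var.Ds var.X)" "cov_deriv M (\<Phi> t) (cov_deriv M (\<Phi> t) (velocity (\<Phi> t)))",
          OF that var.smooth_D[OF var.smooth_D[OF var.smooth_dF]] 2])
  have "cov_deriv M (\<Phi> t) (cov_deriv M (\<Phi> t) (tension M (\<Phi> t))) c s = W (t, s)"
    unfolding tension_def W_def by (rule 3[OF s])
  then show ?thesis
    using \<sigma>.inner_along_bilaplacian[OF chart s] \<Phi>_K[OF K_S[OF s]] by simp
qed

end

section \<open>From criticality to the differential equations for the weight and the value of the
  curvature\<close>

section \<open>The Euler-Lagrange equations\<close>

text \<open>Off the closed interval the function is locally 0. The endpoints, where the boundary
  terms of the integration by parts sit, are reached by continuity of the derivatives.\<close>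

lemma higher_deriv_outside_support:
  fixes u :: "real \<Rightarrow> real"
  assumes u: "smooth_on UNIV u" and supp: "\<And>s. s \<notin> {\<alpha>..\<beta>} \<Longrightarrow> u s = 0" and s: "s \<notin> {\<alpha><..<\<beta>}"
  shows "(deriv ^^ n) u s = 0"
proof -
  have op: "open (- {\<alpha>..\<beta>})" by (rule open_Compl) simp
  have out: "(deriv ^^ n) u s = 0" if "s \<in> - {\<alpha>..\<beta>}" for s
    using that
  proof (induction n arbitrary: s)
    case 0
    then show ?case using supp by simp
  next
    case (Suc n)
    have "((deriv ^^ n) u has_real_derivative 0) (at s)"
      by (rule has_field_derivative_transform_within_open[OF DERIV_const op Suc.prems])
        (simp add: Suc.IH)
    then show ?case by (simp add: DERIV_imp_deriv)
  qed
  have "continuous_on (closure (- {\<alpha>..\<beta>})) ((deriv ^^ n) u)"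
    using smooth_on_continuous[OF smooth_on_higher_deriv[OF open_UNIV u]] continuous_on_subset by blast
  moreover have "s \<in> closure (- {\<alpha>..\<beta>})"
    using s by (simp add: closure_complement)
  ultimately show ?thesis
    using continuous_constant_on_closure[of "- {\<alpha>..\<beta>}" "(deriv ^^ n) u" 0 s] out by blast
qed

lemma fundamental_lemma_calculus_of_variations:
  fixes h :: "real \<Rightarrow> real"
  assumes K: "open K" and h: "continuous_on K h" and s0: "s0 \<in> K"
    and int: "\<And>\<alpha> \<beta> u. \<alpha> < \<beta> \<Longrightarrow> {\<alpha>..\<beta>} \<subseteq> K \<Longrightarrow> smooth_on UNIV u \<Longrightarrow> (\<And>s. s \<notin> {\<alpha>..\<beta>} \<Longrightarrow> u s = 0) \<Longrightarrow>
      integral {\<alpha>..\<beta>} (\<lambda>s. h s * u s) = 0"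
  shows "h s0 = 0"
proof (rule ccontr)
  assume h0: "h s0 \<noteq> 0"
  \<comment> \<open>Multiplying by the constant \<open>h s0\<close> makes the value at s0 a positive
    square, whichever sign \<open>h s0\<close> has.\<close>
  define k where "k s = h s0 * h s" for s
  have k: "continuous_on K k" unfolding k_def by (intro continuous_intros h)
  have "open (K \<inter> k -` {0<..})"
    using continuous_open_preimage[OF k K open_greaterThan] by simp
  moreover have "s0 \<in> K \<inter> k -` {0<..}"
    using s0 h0 by (auto simp: k_def zero_less_mult_iff linorder_neq_iff)
  ultimately obtain e where e: "e > 0" "cball s0 e \<subseteq> K \<inter> k -` {0<..}"
    using open_contains_cball by blast
  let ?J = "{s0 - e..s0 + e}"
  have J: "?J \<subseteq> K \<inter> k -` {0<..}" using e(2) by (simp add: cball_eq_atLeastAtMost)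
  obtain u :: "real \<Rightarrow> real" where u: "smooth_on UNIV u" "\<And>s. 0 \<le> u s"
    "\<And>s. s \<in> {s0 - e<..<s0 + e} \<Longrightarrow> 0 < u s" "\<And>s. s \<notin> {s0 - e<..<s0 + e} \<Longrightarrow> u s = 0"
    using smooth_bump_exists[of "s0 - e" "s0 + e"] e(1) by auto
  have cu: "continuous_on ?J u" using smooth_on_continuous[OF u(1)] continuous_on_subset by blast
  have ck: "continuous_on ?J k" using k J continuous_on_subset by blast
  have "integral ?J (\<lambda>s. h s * u s) = 0"
    by (rule int) (use e(1) J u in auto)
  then have "integral ?J (\<lambda>s. h s0 * (h s * u s)) = 0" by simp
  then have i0: "integral ?J (\<lambda>s. k s * u s) = 0" by (simp add: k_def mult.assoc)
  have c: "continuous_on ?J (\<lambda>s. k s * u s)" by (intro continuous_intros ck cu)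
  have pos: "0 \<le> k s * u s" if "s \<in> ?J" for s
    using that J u(2)[of s] by (auto intro!: mult_nonneg_nonneg simp: subset_iff less_imp_le)
  have hi: "((\<lambda>s. k s * u s) has_integral 0) (cbox (s0 - e) (s0 + e))"
    using integrable_integral[OF integrable_continuous_real[OF c]] i0 by simp
  \<comment> \<open>A continuous nonnegative function with integral 0 vanishes, in particular at s0,
    where both factors are positive.\<close>
  have "k s0 * u s0 = 0"
    by (rule has_integral_0_cbox_imp_0[OF _ _ hi]) (use c pos e(1) in auto)
  moreover have "0 < k s0 * u s0" using J u(3)[of s0] e(1) by (auto intro!: mult_pos_pos simp: subset_iff)
  ultimately show False by linarith
qed

lemma has_real_derivative_fst:
  fixes G :: "real \<times> real \<Rightarrow> real"
  assumes "G differentiable (at (t, s))"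
  shows "((\<lambda>t. G (t, s)) has_real_derivative frechet_derivative G (at (t, s)) (1, 0)) (at t)"
proof -
  have i: "((\<lambda>t. (t, s)) has_derivative (\<lambda>r. (r, 0))) (at t)"
    by (auto intro!: derivative_eq_intros)
  have "((\<lambda>t. G (t, s)) has_derivative (\<lambda>r. frechet_derivative G (at (t, s)) (r, 0))) (at t)"
    using has_derivative_compose[OF i, of G] assms frechet_derivative_works by blast
  moreover have "(\<lambda>r. frechet_derivative G (at (t, s)) (r, 0)) = (*) (frechet_derivative G (at (t, s)) (1, 0))"
  proof
    fix r :: real
    have "frechet_derivative G (at (t, s)) (r *\<^sub>R (1, 0)) = r *\<^sub>R frechet_derivative G (at (t, s)) (1, 0)"
      by (rule linear_scale[OF linear_frechet_derivative[OF assms]])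
    then show "frechet_derivative G (at (t, s)) (r, 0) = frechet_derivative G (at (t, s)) (1, 0) * r" by simp
  qed
  ultimately show ?thesis unfolding has_field_derivative_def by (simp only:)
qed

context frenet_variation
begin

text \<open>The normal component found in \<open>Dt_iterates\<close>, now with the derivatives of
  \<open>a\<close> and \<open>b\<close> themselves.\<close>

definition variation_density where
  "variation_density s = (deriv ^^ 4) b s + 4 * \<kappa> * (deriv ^^ 3) a s + (C - 6 * \<kappa>\<^sup>2) * (deriv ^^ 2) b s
    - 4 * \<kappa> ^ 3 * (deriv ^^ 1) a s + (\<kappa> ^ 4 - 3 * \<kappa>\<^sup>2 * C) * (deriv ^^ 0) b s"

lemma energy_derivative:
  assumes f: "continuous_on {\<alpha>..\<beta>} f"
  shows "((\<lambda>t. f4_energy M f {\<alpha>..\<beta>} (\<Phi> t)) has_real_derivative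
    1 / 2 * integral {\<alpha>..\<beta>} (\<lambda>s. f s * (- 2 * \<kappa> ^ 3 * variation_density s))) (at 0)"
proof -
  define G where "G p = g (F p) (W p) (W p)" for p
  define G' where "G' p = frechet_derivative G (at p) (1, 0)" for p
  let ?U = "{-\<epsilon><..<\<epsilon>}"
  have z: "0 \<in> ?U" using \<epsilon>(1) by simp
  have US: "?U \<times> {\<alpha>..\<beta>} \<subseteq> S" using \<alpha>\<beta>(2) unfolding S_def by blast
  have G: "smooth_on S G"
    unfolding G_def[abs_def] by (rule smooth_g[OF open_S smooth_F F_U smooth_W smooth_W])
  have G': "smooth_on S G'"
    unfolding G'_def[abs_def] by (rule smooth_on_frechet_derivative[OF G])
  have cf: "continuous_on (?U \<times> {\<alpha>..\<beta>}) (\<lambda>p. f (snd p))"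
    by (rule continuous_on_compose2[OF f continuous_on_snd[OF continuous_on_id]]) auto
  have cG: "continuous_on (?U \<times> {\<alpha>..\<beta>}) G" "continuous_on (?U \<times> {\<alpha>..\<beta>}) G'"
    using continuous_on_subset[OF smooth_on_continuous[OF G] US]
      continuous_on_subset[OF smooth_on_continuous[OF G'] US] by auto
  \<comment> \<open>Differentiation under the integral sign, justified by continuity of the
    t-derivative in both variables on the strip.\<close>
  have "((\<lambda>t. integral (cbox \<alpha> \<beta>) (\<lambda>s. f s * G (t, s))) has_field_derivative
      integral (cbox \<alpha> \<beta>) (\<lambda>s. f s * G' (0, s))) (at 0 within ?U)"
  proof (rule leibniz_rule_field_derivative[where f = "\<lambda>t s. f s * G (t, s)" and fx = "\<lambda>t s. f s * G' (t, s)"])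
    fix t s assume ts: "t \<in> ?U" "s \<in> cbox \<alpha> \<beta>"
    then have p: "(t, s) \<in> S" using US unfolding cbox_interval by blast
    have "((\<lambda>t. G (t, s)) has_real_derivative G' (t, s)) (at t)"
      unfolding G'_def by (rule has_real_derivative_fst[OF smooth_on_differentiable[OF G p]])
    then show "((\<lambda>t. f s * G (t, s)) has_field_derivative f s * G' (t, s)) (at t within ?U)"
      by (rule has_field_derivative_at_within[OF DERIV_cmult])
  next
    fix t assume t: "t \<in> ?U"
    have "continuous_on {\<alpha>..\<beta>} (\<lambda>s. G (t, s))"
      by (rule continuous_on_compose2[OF cG(1) continuous_on_Pair[OF continuous_on_const continuous_on_id]])
        (use t in blast)
    then have "continuous_on (cbox \<alpha> \<beta>) (\<lambda>s. f s * G (t, s))"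
      using continuous_on_mult[OF f] by simp
    then show "(\<lambda>s. f s * G (t, s)) integrable_on cbox \<alpha> \<beta>" by (rule integrable_continuous)
  next
    show "continuous_on (?U \<times> cbox \<alpha> \<beta>) (\<lambda>(t, s). f s * G' (t, s))"
      using continuous_on_mult[OF cf cG(2)] by (simp add: case_prod_unfold)
    show "0 \<in> ?U" by (rule z)
    show "convex ?U" by simp
  qed
  then have "((\<lambda>t. 1 / 2 * integral {\<alpha>..\<beta>} (\<lambda>s. f s * G (t, s))) has_real_derivative
      1 / 2 * integral {\<alpha>..\<beta>} (\<lambda>s. f s * G' (0, s))) (at 0)"
    using at_within_open[of 0 ?U] \<epsilon>(1) by (intro DERIV_cmult) (simp only: cbox_interval open_greaterThanLessThan greaterThanLessThan_iff, simp)
  \<comment> \<open>The variation is known to stay in the chart for small t only, which is enough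
    for a derivative at 0.\<close>
  moreover have "1 / 2 * integral {\<alpha>..\<beta>} (\<lambda>s. f s * G (t, s)) = f4_energy M f {\<alpha>..\<beta>} (\<Phi> t)" if "t \<in> ?U" for t
  proof -
    have "integral {\<alpha>..\<beta>} (\<lambda>s. f s * G (t, s)) = integral {\<alpha>..\<beta>} (\<lambda>s. f s * inner_along M (\<Phi> t)
        (rough_laplacian M (\<Phi> t) (tension M (\<Phi> t))) (rough_laplacian M (\<Phi> t) (tension M (\<Phi> t))) s)"
    proof (rule integral_cong)
      fix s assume "s \<in> {\<alpha>..\<beta>}"
      then have "s \<in> K" using \<alpha>\<beta>(2) by blast
      moreover have "\<bar>t\<bar> < \<epsilon>" using that by auto
      ultimately show "f s * G (t, s) = f s * inner_along M (\<Phi> t)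
        (rough_laplacian M (\<Phi> t) (tension M (\<Phi> t))) (rough_laplacian M (\<Phi> t) (tension M (\<Phi> t))) s"
        by (simp add: bilaplacian_\<Phi> G_def)
    qed
    then show ?thesis by (simp add: f4_energy_def)
  qed
  ultimately have "((\<lambda>t. f4_energy M f {\<alpha>..\<beta>} (\<Phi> t)) has_real_derivative
      1 / 2 * integral {\<alpha>..\<beta>} (\<lambda>s. f s * G' (0, s))) (at 0)"
    by (rule has_field_derivative_transform_within_open[OF _ open_greaterThanLessThan z])
  moreover have "integral {\<alpha>..\<beta>} (\<lambda>s. f s * G' (0, s)) =
      integral {\<alpha>..\<beta>} (\<lambda>s. f s * (- 2 * \<kappa> ^ 3 * variation_density s))"
  proof (rule integral_cong)
    fix s assume "s \<in> {\<alpha>..\<beta>}"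
    then have "s \<in> K" using \<alpha>\<beta>(2) by blast
    from var.energy_density_derivative[OF this]
    show "f s * G' (0, s) = f s * (- 2 * \<kappa> ^ 3 * variation_density s)"
      unfolding G'_def G_def[abs_def] W_def variation_density_def by simp
  qed
  ultimately show ?thesis by simp
qed

lemma first_variation:
  assumes f: "continuous_on {\<alpha>..\<beta>} f" and harm: "f4_harmonic M I f \<gamma>" and \<kappa>: "\<kappa> \<noteq> 0"
  shows "integral {\<alpha>..\<beta>} (\<lambda>s. f s * variation_density s) = 0"
proof -
  have "((\<lambda>t. f4_energy M f {\<alpha>..\<beta>} (\<Phi> t)) has_real_derivative 0) (at 0)"
    using harm \<alpha>\<beta> K_I smooth_variation_\<Phi> unfolding f4_harmonic_def by blast
  from DERIV_unique[OF energy_derivative[OF f] this]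
  have "integral {\<alpha>..\<beta>} (\<lambda>s. (- 2 * \<kappa> ^ 3) * (f s * variation_density s)) = 0"
    by (simp add: mult.left_commute)
  then have "(- 2 * \<kappa> ^ 3) * integral {\<alpha>..\<beta>} (\<lambda>s. f s * variation_density s) = 0"
    by (simp only: integral_mult_right)
  then show ?thesis using \<kappa> by simp
qed

lemma first_variation_by_parts:
  assumes f: "smooth_on I f" and harm: "f4_harmonic M I f \<gamma>" and \<kappa>: "\<kappa> \<noteq> 0"
  shows "integral {\<alpha>..\<beta>} (\<lambda>s. 4 * \<kappa> * (\<kappa>\<^sup>2 * (deriv ^^ 1) f s - (deriv ^^ 3) f s) * a s
    + ((deriv ^^ 4) f s + (C - 6 * \<kappa>\<^sup>2) * (deriv ^^ 2) f s + (\<kappa> ^ 4 - 3 * \<kappa>\<^sup>2 * C) * f s) * b s) = 0"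
    (is "integral _ ?E = 0")
proof -
  define A where "A n = (deriv ^^ n) a" for n
  define B where "B n = (deriv ^^ n) b" for n
  define f' where "f' n = (deriv ^^ n) f" for n
  have J: "s \<in> I" if "s \<in> {\<alpha>..\<beta>}" for s using that \<alpha>\<beta>(2) K_I by blast
  have dA: "(A n has_real_derivative A (Suc n) s) (at s)" and dB: "(B n has_real_derivative B (Suc n) s) (at s)" for n s
    using smooth_on_has_deriv[OF smooth_on_higher_deriv[OF open_UNIV a]]
      smooth_on_has_deriv[OF smooth_on_higher_deriv[OF open_UNIV b]] by (simp_all add: A_def B_def)
  have df: "(f' n has_real_derivative f' (Suc n) s) (at s)" if "s \<in> I" for n s
    using smooth_on_has_deriv[OF smooth_on_higher_deriv[OF open_I f] that] by (simp add: f'_def)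
  have zA: "A n s = 0" and zB: "B n s = 0" if "s \<notin> {\<alpha><..<\<beta>}" for n s
    using higher_deriv_outside_support[OF a support(1) that] higher_deriv_outside_support[OF b support(2) that]
    by (simp_all add: A_def B_def)
  \<comment> \<open>The collected boundary terms of all integrations by parts: an antiderivative of
    f times the density minus \<open>?E\<close>. Every summand contains a derivative of
    \<open>a\<close> or \<open>b\<close>, possibly of order 0, so \<open>P\<close> vanishes at both
    endpoints.\<close>
  define P where "P s = 4 * \<kappa> * (f' 0 s * A 2 s - f' 1 s * A 1 s + f' 2 s * A 0 s - \<kappa>\<^sup>2 * (f' 0 s * A 0 s))
    + (f' 0 s * B 3 s - f' 1 s * B 2 s + f' 2 s * B 1 s - f' 3 s * B 0 s)
    + (C - 6 * \<kappa>\<^sup>2) * (f' 0 s * B 1 s - f' 1 s * B 0 s)" for s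
  have "(P has_real_derivative f s * variation_density s - ?E s) (at s)" if s: "s \<in> {\<alpha>..\<beta>}" for s
  proof -
    have d: "((\<lambda>s. f' m s * A n s) has_real_derivative f' (Suc m) s * A n s + A (Suc n) s * f' m s) (at s)"
        "((\<lambda>s. f' m s * B n s) has_real_derivative f' (Suc m) s * B n s + B (Suc n) s * f' m s) (at s)" for m n
      using DERIV_mult[OF df[OF J[OF s]] dA] DERIV_mult[OF df[OF J[OF s]] dB] by auto
    have D: "(P has_real_derivative
      4 * \<kappa> * ((f' (Suc 0) s * A 2 s + A (Suc 2) s * f' 0 s) - (f' (Suc 1) s * A 1 s + A (Suc 1) s * f' 1 s)
        + (f' (Suc 2) s * A 0 s + A (Suc 0) s * f' 2 s) - \<kappa>\<^sup>2 * (f' (Suc 0) s * A 0 s + A (Suc 0) s * f' 0 s))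
      + ((f' (Suc 0) s * B 3 s + B (Suc 3) s * f' 0 s) - (f' (Suc 1) s * B 2 s + B (Suc 2) s * f' 1 s)
        + (f' (Suc 2) s * B 1 s + B (Suc 1) s * f' 2 s) - (f' (Suc 3) s * B 0 s + B (Suc 0) s * f' 3 s))
      + (C - 6 * \<kappa>\<^sup>2) * ((f' (Suc 0) s * B 1 s + B (Suc 1) s * f' 0 s) - (f' (Suc 1) s * B 0 s + B (Suc 0) s * f' 1 s))) (at s)"
      unfolding P_def[abs_def] by (intro DERIV_add DERIV_diff DERIV_cmult d)
    have e: "Suc 0 = 1" "Suc 1 = 2" "Suc 2 = 3" "Suc 3 = 4" by auto
    have z: "f s = f' 0 s" "a s = A 0 s" "b s = B 0 s" by (simp_all add: f'_def A_def B_def)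
    show ?thesis
      unfolding variation_density_def A_def[symmetric] B_def[symmetric] f'_def[symmetric] z
      by (rule DERIV_cong[OF D], unfold e) algebra
  qed
  then have "((\<lambda>s. f s * variation_density s - ?E s) has_integral (P \<beta> - P \<alpha>)) {\<alpha>..\<beta>}"
    using \<alpha>\<beta>(1) by (intro fundamental_theorem_of_calculus)
      (simp_all add: has_real_derivative_iff_has_vector_derivative[symmetric] has_field_derivative_at_within)
  moreover have "P \<beta> - P \<alpha> = 0" by (simp add: P_def zA zB)
  moreover have "((\<lambda>s. f s * variation_density s) has_integral 0) {\<alpha>..\<beta>}"
  proof -
    have cf: "continuous_on {\<alpha>..\<beta>} f"
      using continuous_on_subset[OF smooth_on_continuous[OF f]] J by blast
    have "continuous_on {\<alpha>..\<beta>} (A n)" "continuous_on {\<alpha>..\<beta>} (B n)" for n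
      using DERIV_isCont[OF dA] DERIV_isCont[OF dB] by (auto intro!: continuous_at_imp_continuous_on)
    then have "continuous_on {\<alpha>..\<beta>} (\<lambda>s. f s * variation_density s)"
      unfolding variation_density_def A_def[symmetric] B_def[symmetric] by (intro continuous_intros cf)
    then show ?thesis
      using integrable_integral[OF integrable_continuous_real] first_variation[OF cf harm \<kappa>] by metis
  qed
  ultimately have "((\<lambda>s. f s * variation_density s - (f s * variation_density s - ?E s)) has_integral 0 - 0) {\<alpha>..\<beta>}"
    by (intro has_integral_diff) simp_all
  then show ?thesis by (simp add: integral_unique)
qed

end

context frenet_chart
begin

text \<open>By compactness, the image of the support has a uniform distance \<open>r\<close> to the
  complement of \<open>U\<close>, and \<open>V\<close> is bounded there by some B > 0; r / B serves
  as the range of t. Outside the support \<open>V\<close> is 0 and the curve does not move.\<close>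

lemma frenet_variation_exists:
  assumes \<alpha>\<beta>: "\<alpha> < \<beta>" "{\<alpha>..\<beta>} \<subseteq> K" and a: "smooth_on UNIV a" and b: "smooth_on UNIV b"
    and supp: "\<And>s. s \<notin> {\<alpha>..\<beta>} \<Longrightarrow> a s = 0" "\<And>s. s \<notin> {\<alpha>..\<beta>} \<Longrightarrow> b s = 0"
  obtains \<epsilon> where "frenet_variation M I \<gamma> \<nu> \<kappa> C c K \<alpha> \<beta> \<epsilon> a b"
proof -
  define V where "V s = a s *\<^sub>R T s + b s *\<^sub>R N s" for s
  have cx: "continuous_on {\<alpha>..\<beta>} x" using continuous_on_subset[OF smooth_on_continuous[OF smooth_x] \<alpha>\<beta>(2)] .
  have cV: "continuous_on {\<alpha>..\<beta>} V"
    unfolding V_def[abs_def]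
    by (intro continuous_on_add continuous_on_scaleR
        continuous_on_subset[OF smooth_on_continuous[OF smooth_T] \<alpha>\<beta>(2)]
        continuous_on_subset[OF smooth_on_continuous[OF smooth_N] \<alpha>\<beta>(2)]
        continuous_on_subset[OF smooth_on_continuous[OF a]]
        continuous_on_subset[OF smooth_on_continuous[OF b]]) auto
  have cpt: "compact (x ` {\<alpha>..\<beta>})" by (rule compact_continuous_image[OF cx]) simp
  have sub: "x ` {\<alpha>..\<beta>} \<subseteq> U" using x_U \<alpha>\<beta>(2) by blast
  obtain r where r: "r > 0" "(\<Union>y\<in>x ` {\<alpha>..\<beta>}. ball y r) \<subseteq> U"
    using compact_subset_open_imp_ball_epsilon_subset[OF cpt open_U sub] by blast
  have "bounded (V ` {\<alpha>..\<beta>})"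
    by (rule compact_imp_bounded[OF compact_continuous_image[OF cV]]) simp
  then obtain B where B: "B > 0" "\<And>s. s \<in> {\<alpha>..\<beta>} \<Longrightarrow> norm (V s) \<le> B"
    unfolding bounded_pos by blast
  have inU: "x s + t *\<^sub>R V s \<in> U" if t: "\<bar>t\<bar> < r / B" and s: "s \<in> K" for t s
  proof (cases "s \<in> {\<alpha>..\<beta>}")
    case True
    have "norm (t *\<^sub>R V s) \<le> \<bar>t\<bar> * B" using B(2)[OF True] by (simp add: mult_left_mono)
    also have "\<dots> < r" using t B(1) by (simp add: pos_less_divide_eq)
    finally have "x s + t *\<^sub>R V s \<in> ball (x s) r" by (simp add: dist_norm)
    then show ?thesis using r(2) True by blast
  next
    case False
    then show ?thesis using supp x_U[OF s] by (simp add: V_def)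
  qed
  have "frenet_variation M I \<gamma> \<nu> \<kappa> C c K \<alpha> \<beta> (r / B) a b"
    by (intro frenet_variation.intro frenet_variation_axioms.intro frenet_chart_axioms \<alpha>\<beta> a b supp)
      (use r(1) B(1) inU in \<open>auto simp: V_def\<close>)
  then show ?thesis by (rule that)
qed

text \<open>Purely tangential variations (b = 0) and purely normal ones (a = 0) isolate the two
  coefficients, each of which the fundamental lemma forces to vanish.\<close>

lemma euler_lagrange:
  assumes f: "smooth_on I f" and harm: "f4_harmonic M I f \<gamma>" and \<kappa>: "\<kappa> \<noteq> 0" and s: "s \<in> K"
  shows "(deriv ^^ 3) f s = \<kappa>\<^sup>2 * (deriv ^^ 1) f s"
    and "(deriv ^^ 4) f s + (C - 6 * \<kappa>\<^sup>2) * (deriv ^^ 2) f s + (\<kappa> ^ 4 - 3 * \<kappa>\<^sup>2 * C) * f s = 0"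
proof -
  let ?A = "\<lambda>s. 4 * \<kappa> * (\<kappa>\<^sup>2 * (deriv ^^ 1) f s - (deriv ^^ 3) f s)"
  let ?B = "\<lambda>s. (deriv ^^ 4) f s + (C - 6 * \<kappa>\<^sup>2) * (deriv ^^ 2) f s + (\<kappa> ^ 4 - 3 * \<kappa>\<^sup>2 * C) * f s"
  have cf: "continuous_on K ((deriv ^^ n) f)" for n
    by (rule continuous_on_subset[OF smooth_on_continuous[OF smooth_on_higher_deriv[OF open_I f]] K_I])
  have cf0: "continuous_on K f" using cf[of 0] by simp
  have int: "integral {\<alpha>..\<beta>} (\<lambda>s. ?A s * a s + ?B s * b s) = 0"
    if H: "\<alpha> < \<beta>" "{\<alpha>..\<beta>} \<subseteq> K" "smooth_on UNIV a" "smooth_on UNIV b"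
      "\<And>s. s \<notin> {\<alpha>..\<beta>} \<Longrightarrow> a s = 0" "\<And>s. s \<notin> {\<alpha>..\<beta>} \<Longrightarrow> b s = 0" for \<alpha> \<beta> a b
  proof -
    obtain \<epsilon> where "frenet_variation M I \<gamma> \<nu> \<kappa> C c K \<alpha> \<beta> \<epsilon> a b"
      by (rule frenet_variation_exists[OF H])
    then show ?thesis by (rule frenet_variation.first_variation_by_parts[OF _ f harm \<kappa>])
  qed
  have "?A s = 0"
  proof (rule fundamental_lemma_calculus_of_variations[OF open_K _ s])
    show "continuous_on K ?A" by (intro continuous_intros cf)
    show "integral {\<alpha>..\<beta>} (\<lambda>s. ?A s * u s) = 0"
      if "\<alpha> < \<beta>" "{\<alpha>..\<beta>} \<subseteq> K" "smooth_on UNIV u" "\<And>s. s \<notin> {\<alpha>..\<beta>} \<Longrightarrow> u s = 0" for \<alpha> \<beta> u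
      using int[OF that(1-3) smooth_on_const[of _ 0] that(4) refl] by simp
  qed
  then show "(deriv ^^ 3) f s = \<kappa>\<^sup>2 * (deriv ^^ 1) f s" using \<kappa> by simp
  show "?B s = 0"
  proof (rule fundamental_lemma_calculus_of_variations[OF open_K _ s])
    show "continuous_on K ?B" by (intro continuous_intros cf cf0)
    show "integral {\<alpha>..\<beta>} (\<lambda>s. ?B s * u s) = 0"
      if "\<alpha> < \<beta>" "{\<alpha>..\<beta>} \<subseteq> K" "smooth_on UNIV u" "\<And>s. s \<notin> {\<alpha>..\<beta>} \<Longrightarrow> u s = 0" for \<alpha> \<beta> u
      using int[OF that(1,2) smooth_on_const[of _ 0] that(3) refl that(4)] by simp
  qed
qed

end

section \<open>Proper \<open>f\<close>-4-harmonic curves of constant curvature\<close>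

text \<open>A constant weight only rescales the energy. Hence properness forces a positive weight to
  be nonconstant.\<close>

lemma four_harmonic_if_constant_weight:
  assumes harm: "f4_harmonic M I f \<gamma>" and f: "\<And>s. s \<in> I \<Longrightarrow> f s = k" and k: "k \<noteq> 0"
  shows "four_harmonic M I \<gamma>"
proof -
  have "((\<lambda>t. f4_energy M (\<lambda>_. 1) {a..b} (\<Phi> t)) has_real_derivative 0) (at 0)"
    if "a < b" "{a..b} \<subseteq> I" "smooth_variation M I {a..b} \<gamma> \<Phi>" for a b \<Phi>
  proof -
    have "f4_energy M (\<lambda>_. 1) {a..b} \<sigma> = inverse k * f4_energy M f {a..b} \<sigma>" for \<sigma>
    proof -
      let ?e = "inner_along M \<sigma> (rough_laplacian M \<sigma> (tension M \<sigma>)) (rough_laplacian M \<sigma> (tension M \<sigma>))"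
      have "integral {a..b} (\<lambda>s. f s * ?e s) = integral {a..b} (\<lambda>s. k * ?e s)"
        by (rule integral_cong) (use f that(2) in auto)
      then show ?thesis using k by (simp add: f4_energy_def)
    qed
    moreover have "((\<lambda>t. f4_energy M f {a..b} (\<Phi> t)) has_real_derivative 0) (at 0)"
      using harm that unfolding f4_harmonic_def by blast
    ultimately show ?thesis using DERIV_cmult[of _ 0 0 UNIV "inverse k"] by simp
  qed
  then show ?thesis using harm unfolding four_harmonic_def f4_harmonic_def by blast
qed

theorem theorem4p4:
  fixes M :: "('a, 2) riemannian_structure"
    and C :: real and I :: "real set" and f \<kappa> :: "real \<Rightarrow> real" and \<gamma> :: "real \<Rightarrow> 'a"
  assumes "space_form M C"
    and "open_interval I"
    and "smooth_on I f" and "\<forall>s\<in>I. 0 < f s"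
    and "arclength_param M I \<gamma>"
    and "proper_f4_harmonic M I f \<gamma>"
    and "has_geodesic_curvature M I \<gamma> \<kappa>"
    and "\<forall>s\<in>I. 0 < \<kappa> s"
    and "\<kappa> constant_on I"
  shows "C < 0 \<and> (\<forall>s\<in>I. \<kappa> s = sqrt (- 2 * C) / 2)"
proof -
  have M: "riemannian_manifold M" "constant_sectional_curvature M C"
    using assms(1) unfolding space_form_def by auto
  have I: "open I" "I \<noteq> {}" "convex I"
    using assms(2) unfolding open_interval_def by (auto simp: is_interval_convex)
  have \<gamma>: "smooth_into M I \<gamma>" using assms(5) unfolding arclength_param_def by blast
  have harm: "f4_harmonic M I f \<gamma>" and not4: "\<not> four_harmonic M I \<gamma>"
    using assms(6) unfolding proper_f4_harmonic_def by auto
  obtain k where k: "\<And>s. s \<in> I \<Longrightarrow> \<kappa> s = k"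
    using assms(9) unfolding constant_on_def by blast
  obtain s1 where s1: "s1 \<in> I" using I(2) by blast
  have k0: "k > 0" using k[OF s1] assms(8) s1 by auto
  obtain \<nu> where \<nu>: "smooth_field_along M I \<gamma> \<nu>"
    and on: "\<And>s. s \<in> I \<Longrightarrow> inner_along M \<gamma> (velocity \<gamma>) (velocity \<gamma>) s = 1 \<and>
      inner_along M \<gamma> \<nu> \<nu> s = 1 \<and> inner_along M \<gamma> (velocity \<gamma>) \<nu> s = 0"
    and DT: "field_eq_on M I \<gamma> (cov_deriv M \<gamma> (velocity \<gamma>)) (\<lambda>c s. \<kappa> s *\<^sub>R \<nu> c s)"
    and DN: "field_eq_on M I \<gamma> (cov_deriv M \<gamma> \<nu>) (\<lambda>c s. - \<kappa> s *\<^sub>R velocity \<gamma> c s)"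
    using assms(7) unfolding has_geodesic_curvature_def by blast
  interpret frenet_curve M I \<gamma> \<nu> k C
  proof
    show "field_eq_on M I \<gamma> (cov_deriv M \<gamma> (velocity \<gamma>)) (\<lambda>c s. k *\<^sub>R \<nu> c s)"
      using DT k unfolding field_eq_on_def by simp
    show "field_eq_on M I \<gamma> (cov_deriv M \<gamma> \<nu>) (\<lambda>c s. - k *\<^sub>R velocity \<gamma> c s)"
      using DN k unfolding field_eq_on_def by simp
  qed (use M I(1) \<gamma> \<nu> on in auto)
  \<comment> \<open>The equations are pointwise: each parameter lies in the open set of parameters
    sent into some chart, and that set serves as \<open>K\<close>.\<close>
  have el: "(deriv ^^ 3) f s = k\<^sup>2 * (deriv ^^ 1) f s"
      "(deriv ^^ 4) f s + (C - 6 * k\<^sup>2) * (deriv ^^ 2) f s + (k ^ 4 - 3 * k\<^sup>2 * C) * f s = 0"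
    if s: "s \<in> I" for s
  proof -
    have "\<gamma> s \<in> topspace (mtop M)"
      using \<gamma> s continuous_map_image_subset_topspace unfolding smooth_into_def by fastforce
    then obtain c where c: "c \<in> atlas M" "\<gamma> s \<in> cdom c"
      using M(1) unfolding riemannian_manifold_def smooth_manifold_def by blast
    interpret frenet_chart M I \<gamma> \<nu> k C c "dom c"
      by unfold_locales (use c M(1) open_dom in auto)
    show "(deriv ^^ 3) f s = k\<^sup>2 * (deriv ^^ 1) f s"
      "(deriv ^^ 4) f s + (C - 6 * k\<^sup>2) * (deriv ^^ 2) f s + (k ^ 4 - 3 * k\<^sup>2 * C) * f s = 0"
      using euler_lagrange[OF assms(3) harm] k0 s c(2) by auto
  qed
  have df: "((deriv ^^ n) f has_real_derivative (deriv ^^ Suc n) f s) (at s)" if "s \<in> I" for n s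
    using smooth_on_has_deriv[OF smooth_on_higher_deriv[OF I(1) assms(3)] that] by simp
  \<comment> \<open>The tangential equation may be differentiated because it holds on the open set
    \<open>I\<close>.\<close>
  have f4: "(deriv ^^ 4) f s = k\<^sup>2 * (deriv ^^ 2) f s" if s: "s \<in> I" for s
  proof -
    have "((\<lambda>s. k\<^sup>2 * (deriv ^^ 1) f s) has_real_derivative k\<^sup>2 * (deriv ^^ Suc 1) f s) (at s)"
      by (rule DERIV_cmult[OF df[OF s]])
    then have "((deriv ^^ 3) f has_real_derivative k\<^sup>2 * (deriv ^^ Suc 1) f s) (at s)"
      by (rule has_field_derivative_transform_within_open[OF _ I(1) s]) (simp add: el(1))
    from DERIV_unique[OF df[OF s] this] show ?thesis by (simp add: eval_nat_numeral)
  qed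
  have f': "(C + 2 * k\<^sup>2) * (deriv ^^ 1) f s = 0" if s: "s \<in> I" for s
  proof -
    have z: "(C - 5 * k\<^sup>2) * (deriv ^^ 2) f s + (k ^ 4 - 3 * k\<^sup>2 * C) * (deriv ^^ 0) f s = 0" if "s \<in> I" for s
      using el(2)[OF that] f4[OF that] by (simp add: algebra_simps)
    have "((\<lambda>s. (C - 5 * k\<^sup>2) * (deriv ^^ 2) f s + (k ^ 4 - 3 * k\<^sup>2 * C) * (deriv ^^ 0) f s) has_real_derivative
        (C - 5 * k\<^sup>2) * (deriv ^^ Suc 2) f s + (k ^ 4 - 3 * k\<^sup>2 * C) * (deriv ^^ Suc 0) f s) (at s)"
      by (intro DERIV_add DERIV_cmult df s)
    then have "((\<lambda>s. 0) has_real_derivative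
        (C - 5 * k\<^sup>2) * (deriv ^^ Suc 2) f s + (k ^ 4 - 3 * k\<^sup>2 * C) * (deriv ^^ Suc 0) f s) (at s)"
      by (rule has_field_derivative_transform_within_open[OF _ I(1) s]) (rule z)
    from DERIV_unique[OF this DERIV_const]
    have "(C - 5 * k\<^sup>2) * (deriv ^^ 3) f s + (k ^ 4 - 3 * k\<^sup>2 * C) * (deriv ^^ 1) f s = 0"
      by (simp add: eval_nat_numeral)
    \<comment> \<open>Replacing the third derivative by k^2 f' yields - 2 k^2 (C + 2 k^2) f', and
      the factor -2 is dropped.\<close>
    then have "k\<^sup>2 * ((C + 2 * k\<^sup>2) * (deriv ^^ 1) f s) = 0"
      unfolding el(1)[OF s] by algebra
    then show ?thesis using k0 by simp
  qed
  have C: "C = - 2 * k\<^sup>2"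
  proof (rule ccontr)
    assume "C \<noteq> - 2 * k\<^sup>2"
    \<comment> \<open>Otherwise \<open>f\<close> would be constant on the interval, with a nonzero
      value by positivity, and the curve 4-harmonic.\<close>
    then have "(deriv ^^ 1) f s = 0" if "s \<in> I" for s
      using f'[OF that] by (auto simp: add_eq_0_iff)
    then have "(f has_field_derivative 0) (at s within I)" if "s \<in> I" for s
      using has_field_derivative_at_within[OF df[OF that, of 0]] that by simp
    then obtain l where l: "\<And>s. s \<in> I \<Longrightarrow> f s = l"
      using has_field_derivative_zero_constant[OF I(3), of f] by blast
    moreover have "l \<noteq> 0" using l[OF s1] assms(4) s1 by auto
    ultimately show False using four_harmonic_if_constant_weight[OF harm] not4 by blast
  qed
  have "- 2 * C = (2 * k)\<^sup>2" using C by (simp add: power2_eq_square)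
  then have "sqrt (- 2 * C) = 2 * k" using k0 by (simp add: real_sqrt_unique)
  then show ?thesis using C k k0 by simp
qed

end
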